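(* Let $\Omega$ be a bounded domain in $\mathbb{C}^n$. Suppose that the maximal circularity function satisfies $c_\Omega(x)=1$ at a point $x\in\Omega$. Then $\Omega$ is biholomorphic to a complete circular domain.
   Context: The Kobayashi-Royden metric of a domain $D\subset\mathbb{C}^n$ is $K_D(x;v)=\inf\{\lambda>0:\exists f\in\mathcal{O}(\Delta,D),\ f(0)=x,\ \lambda f'(0)=v\}$, where $\mathcal{O}(\Delta,D)$ is the set of holomorphic maps from the unit disc $\Delta\subset\mathbb{C}$ into $D$; its indicatrix at $x$ is $I_D(x)=\{v\in\mathbb{C}^n:K_D(x;v)<1\}$. For a bounded domain $\Omega$ and $x\in\Omega$, $\mathcal{B}_\Omega(x)$ denotes the class of bounded holomorphic embeddings $\varphi:\Omega\to\mathbb{C}^n$ (injective holomorphic maps with bounded image) with $\varphi(x)=0$. The maximal circularity function is $$c_\Omega(x)=\sup\Big\{\frac{r}{R}:\exists\,\varphi\in\mathcal{B}_\Omega(x),\ R>0,\ r>0\text{ such that } r\,I_{\varphi(\Omega)}(0)\subset\varphi(\Omega)\subset R\,I_{\varphi(\Omega)}(0)\Big\}.$$ A domain $D\subset\mathbb{C}^n$ is complete circular if $\zeta z\in D$ whenever $z\in D$ and $\zeta\in\mathbb{C}$, $|\zeta|\le1$. *)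

theory Defs
  imports "HOL-Complex_Analysis.Complex_Analysis"
begin

text \<open>The space \<open>\<complex>\<^sup>n\<close> is \<^typ>\<open>complex ^ 'n\<close>; its complex scalar multiplication is
  \<open>*s\<close>, while \<open>*\<^sub>R\<close> is multiplication by real scalars.\<close>

definition domain_Cn :: "(complex ^ 'n) set \<Rightarrow> bool" where
  "domain_Cn D \<longleftrightarrow> open D \<and> connected D \<and> D \<noteq> {}"

text \<open>Holomorphy in several variables: Frechet differentiability with complex-linear derivative
  (the derivative being real-linear already, only homogeneity is left to require).
  The notion is meant for open \<open>S\<close>.\<close>

definition holomorphic_map_on ::
    "(complex ^ 'n \<Rightarrow> complex ^ 'm) \<Rightarrow> (complex ^ 'n) set \<Rightarrow> bool" where
  "holomorphic_map_on f S \<longleftrightarrow>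
     (\<forall>z\<in>S. \<exists>f'. (f has_derivative f') (at z) \<and> (\<forall>c v. f' (c *s v) = c *s f' v))"

definition holomorphic_discs :: "(complex ^ 'n) set \<Rightarrow> (complex \<Rightarrow> complex ^ 'n) set" where
  "holomorphic_discs D =
     {f. (\<forall>i. (\<lambda>\<zeta>. f \<zeta> $ i) holomorphic_on ball 0 1) \<and> f ` ball 0 1 \<subseteq> D}"

definition disc_deriv :: "(complex \<Rightarrow> complex ^ 'n) \<Rightarrow> complex \<Rightarrow> complex ^ 'n" where
  "disc_deriv f \<zeta> = (\<chi> i. deriv (\<lambda>w. f w $ i) \<zeta>)"

text \<open>For open \<open>D\<close> and \<open>x \<in> D\<close> the set below is nonempty (use small affine discs) and bounded
  below by 0, so the infimum in the reals is the intended one.\<close>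

definition kobayashi_royden ::
    "(complex ^ 'n) set \<Rightarrow> complex ^ 'n \<Rightarrow> complex ^ 'n \<Rightarrow> real" where
  "kobayashi_royden D x v =
     Inf {l. l > 0 \<and> (\<exists>f\<in>holomorphic_discs D. f 0 = x \<and> l *\<^sub>R disc_deriv f 0 = v)}"

definition indicatrix :: "(complex ^ 'n) set \<Rightarrow> complex ^ 'n \<Rightarrow> (complex ^ 'n) set" where
  "indicatrix D x = {v. kobayashi_royden D x v < 1}"

definition bounded_embeddings ::
    "(complex ^ 'n) set \<Rightarrow> complex ^ 'n \<Rightarrow> (complex ^ 'n \<Rightarrow> complex ^ 'n) set" where
  "bounded_embeddings \<Omega> x =
     {\<phi>. holomorphic_map_on \<phi> \<Omega> \<and> inj_on \<phi> \<Omega> \<and> bounded (\<phi> ` \<Omega>) \<and> \<phi> x = 0}"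

text \<open>For a bounded domain \<open>\<Omega>\<close> and \<open>x \<in> \<Omega>\<close> the set below is nonempty (take \<open>\<phi>\<close> to be the
  translation by \<open>- x\<close>) and bounded above by 1, so the supremum in the reals is the intended one.\<close>

definition maximal_circularity :: "(complex ^ 'n) set \<Rightarrow> complex ^ 'n \<Rightarrow> real" where
  "maximal_circularity \<Omega> x =
     Sup {r / R | r R. R > 0 \<and> r > 0 \<and>
            (\<exists>\<phi>\<in>bounded_embeddings \<Omega> x.
               (\<lambda>v. r *\<^sub>R v) ` indicatrix (\<phi> ` \<Omega>) 0 \<subseteq> \<phi> ` \<Omega> \<and>
               \<phi> ` \<Omega> \<subseteq> (\<lambda>v. R *\<^sub>R v) ` indicatrix (\<phi> ` \<Omega>) 0)}"

definition complete_circular :: "(complex ^ 'n) set \<Rightarrow> bool" where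
  "complete_circular D \<longleftrightarrow> (\<forall>z\<in>D. \<forall>\<zeta>. norm \<zeta> \<le> 1 \<longrightarrow> \<zeta> *s z \<in> D)"

definition biholomorphic :: "(complex ^ 'n) set \<Rightarrow> (complex ^ 'n) set \<Rightarrow> bool" where
  "biholomorphic S T \<longleftrightarrow>
     (\<exists>f g. holomorphic_map_on f S \<and> f ` S = T \<and>
            holomorphic_map_on g T \<and> g ` T = S \<and>
            (\<forall>z\<in>S. g (f z) = z) \<and> (\<forall>w\<in>T. f (g w) = w))"

end

theory Submission imports Defs begin

text \<open>The domain \<open>D\<close> is the indicatrix \<open>I = indicatrix \<Omega> x\<close>, a bounded complete circular domain.
  By biholomorphic invariance an embedding with pinching ratio \<open>t\<close> normalizes to some \<open>\<psi>\<close> with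
  \<open>t I \<subseteq> \<psi>(\<Omega>) \<subseteq> I\<close>. For \<open>t \<rightarrow> 1\<close>, Montel's theorem gives limits \<open>f\<close> of the maps \<open>\<psi>\<close> and \<open>h\<close> of
  their rescaled inverses on \<open>I\<close>. The product of the derivatives at the base points tends to the identity,
  so neither limit degenerates; Hurwitz' theorem then shows that both limits map into the open sets
  \<open>I\<close> and \<open>\<Omega>\<close> and not only into their closures, and they are inverse to each other.

  The inverse of an injective holomorphic map is holomorphic (Osgood) by way of Rado's theorem.
  Holomorphic functions of several variables are handled as continuous functions which are
  holomorphic on complex lines.\<close>

text \<open>The supremum need not be attained a priori, so no single embedding is known to have
  image \<open>I\<close>; this forces the passage to the limit. The obstacle is that limits of
  injective maps may degenerate. It is met by pairing \<psi> with the map g that sends w to the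
  preimage of t w under \<psi>; g lives on all of \<open>I\<close> because t I lies in the image. As
  \<psi> o g = t id, the Jacobian determinants at \<open>x\<close> and 0 multiply to a power of t,
  hence to 1 in the limit. Only f o h = id is obtained as a limit of compositions; h o f = id
  follows from it by injectivity of f. An embedding is only required to be injective and
  holomorphic. Osgood's theorem turns this into a holomorphic inverse, on which both the invariance
  of the indicatrix and the maps g depend. Working on complex lines lets the one-variable theorems
  of Cauchy, Weierstrass, Hurwitz and Rado act on slices.\<close>

no_notation fps_nth (infixl "$" 75)

section \<open>Rado's theorem\<close>

text \<open>The maximum modulus principle for \<open>g ^ n * u\<close>, which vanishes on the exceptional set, as
  \<open>n \<rightarrow> \<infinity>\<close>.\<close>
lemma maximum_modulus_off_zeros:
  fixes g u :: "complex \<Rightarrow> complex"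
  assumes u: "continuous_on (cball 0 1) u"
    and uh: "\<And>z. z \<in> ball 0 1 \<Longrightarrow> u z \<noteq> 0 \<Longrightarrow> u field_differentiable at z"
    and W: "W = {z \<in> ball 0 1. u z \<noteq> 0}"
    and g: "continuous_on (closure W) g"
    and gh: "\<And>z. z \<in> W \<Longrightarrow> g field_differentiable at z"
    and le: "\<And>z. z \<in> closure W \<Longrightarrow> norm z = 1 \<Longrightarrow> norm (g z) \<le> 1"
    and z: "z \<in> W"
  shows "norm (g z) \<le> 1"
proof (rule ccontr)
  assume "\<not> norm (g z) \<le> 1"
  then have g1: "norm (g z) > 1" by simp
  have "bounded (u ` cball 0 1)"
    using compact_continuous_image[OF u compact_cball] compact_imp_bounded by blast
  then obtain M where M: "\<And>w. w \<in> cball 0 1 \<Longrightarrow> norm (u w) \<le> M"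
    unfolding bounded_iff by blast
  have opW: "open W"
  proof -
    have "continuous_on (ball 0 1) u" by (rule continuous_on_subset[OF u]) auto
    then have "open (ball 0 1 \<inter> u -` (- {0}))"
      by (rule continuous_open_preimage) auto
    also have "ball 0 1 \<inter> u -` (- {0}) = W" by (auto simp: W)
    finally show ?thesis .
  qed
  have cl: "closure W \<subseteq> cball 0 1" 
    by (rule closure_minimal) (auto simp: W)
  have bd: "norm (g z) ^ n * norm (u z) \<le> M" for n
  proof -
    have "norm (g z ^ n * u z) \<le> M"
    proof (rule maximum_modulus_frontier[where S=W and f="\<lambda>w. g w ^ n * u w"])
      show "(\<lambda>w. g w ^ n * u w) holomorphic_on interior W"
        unfolding interior_open[OF opW] holomorphic_on_def
      proof
        fix w assume w: "w \<in> W"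
        then have "u field_differentiable at w" using uh by (auto simp: W)
        then have "(\<lambda>w. g w ^ n * u w) field_differentiable at w"
          by (intro field_differentiable_mult field_differentiable_power gh w)
        then show "(\<lambda>w. g w ^ n * u w) field_differentiable at w within W"
          by (rule field_differentiable_at_within)
      qed
      show "continuous_on (closure W) (\<lambda>w. g w ^ n * u w)"
        by (intro continuous_intros g continuous_on_subset[OF u cl])
      show "bounded W" by (rule bounded_subset[of "ball 0 1"]) (auto simp: W)
      show "z \<in> W" by fact
      fix w assume w: "w \<in> frontier W"
      then have wc: "w \<in> closure W" "w \<notin> W" using opW by (auto simp: frontier_def interior_open)
      with cl have w1: "norm w \<le> 1" by auto
      show "norm (g w ^ n * u w) \<le> M"
      proof (cases "norm w = 1")
        case True
        then have "norm (g w) ^ n \<le> 1" using le[OF wc(1)] by (simp add: power_le_one)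
        then show ?thesis using M[of w] w1 mult_mono[of "norm (g w) ^ n" 1 "norm (u w)" M]
          by (simp add: norm_mult norm_power)
      next
        case False
        then have "u w = 0" using wc w1 by (auto simp: W)
        then show ?thesis using M[of 0] by (auto intro: order_trans[OF norm_ge_zero])
      qed
    qed
    then show ?thesis by (simp add: norm_mult norm_power)
  qed
  have uz: "norm (u z) > 0" using z by (auto simp: W)
  obtain n where "M / norm (u z) < norm (g z) ^ n"
    using real_arch_pow[OF g1] by blast
  then show False using bd[of n] uz by (simp add: field_simps)
qed

text \<open>A point of the open disc off \<open>closure W\<close> is at least as far from
  \<open>closure W\<close> as from the unit circle. This is impossible close to a point of
  \<open>closure W\<close> inside the disc, so \<open>closure W\<close> is relatively open as well
  as closed there.\<close>

lemma dense_nonzeros: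
  fixes u :: "complex \<Rightarrow> complex"
  assumes u: "continuous_on (cball 0 1) u"
    and uh: "\<And>z. z \<in> ball 0 1 \<Longrightarrow> u z \<noteq> 0 \<Longrightarrow> u field_differentiable at z"
    and W: "W = {z \<in> ball 0 1. u z \<noteq> 0}"
    and ne: "W \<noteq> {}"
  shows "cball 0 1 \<subseteq> closure W"
proof -
  have dist: "1 - norm b \<le> dist a b" if b: "b \<in> ball 0 1" "b \<notin> closure W" and a: "a \<in> closure W" for a b
  proof -
    define c where "c = 1 - norm b"
    have c: "c > 0" using b by (simp add: c_def)
    \<comment> \<open>The pole \<open>b\<close> lies off \<open>closure W\<close>, and
      \<open>c\<close> is the distance from \<open>b\<close> to the unit circle, so \<open>g\<close>
      has modulus at most 1 on that circle.\<close>
    define g where "g = (\<lambda>z. of_real c / (z - b))"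
    have ng: "norm (g z) \<le> 1 \<longleftrightarrow> c \<le> dist z b" if "z \<noteq> b" for z
      using that c by (simp add: g_def norm_divide dist_norm)
    have nb: "z \<noteq> b" if "z \<in> W" for z using that b closure_subset by blast
    have *: "norm (g z) \<le> 1" if "z \<in> W" for z
    proof (rule maximum_modulus_off_zeros[OF u uh W _ _ _ that])
      show "continuous_on (closure W) g" unfolding g_def using b by (intro continuous_intros) auto
      show "g field_differentiable at z" if "z \<in> W" for z
        unfolding g_def using nb[OF that] by (intro derivative_intros) auto
      show "norm (g z) \<le> 1" if "z \<in> closure W" "norm z = 1" for z
      proof -
        have "z \<noteq> b" using that b by blast
        moreover have "c \<le> dist z b" using norm_triangle_ineq2[of z b] that by (simp add: c_def dist_norm)
        ultimately show ?thesis using ng by blast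
      qed
    qed auto
    have "1 - norm b \<le> dist z b" if "z \<in> W" for z
      using *[OF that] ng[OF nb[OF that]] by (simp add: c_def)
    then have "closure W \<subseteq> {z. 1 - norm b \<le> dist z b}"
      by (intro closure_minimal closed_Collect_le continuous_intros) auto
    then show ?thesis using a by auto
  qed
  have "openin (top_of_set (ball 0 1)) (ball 0 1 \<inter> closure W)"
    unfolding openin_contains_ball
  proof (intro conjI ballI)
    fix p assume p: "p \<in> ball 0 1 \<inter> closure W"
    \<comment> \<open>A point at distance less than \<open>e\<close> from \<open>p\<close> is
      farther than \<open>e\<close> from the unit circle, which contradicts \<open>dist\<close> if
      the point is off \<open>closure W\<close>.\<close>
    define e where "e = (1 - norm p) / 2"
    have e: "e > 0" using p by (auto simp: e_def)
    have "ball p e \<inter> ball 0 1 \<subseteq> closure W"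
    proof (rule ccontr)
      assume "\<not> ?thesis"
      then obtain b where "b \<in> ball p e" and b: "b \<in> ball 0 1" "b \<notin> closure W" by blast
      then have be: "dist p b < e" by simp
      have "1 - norm b \<le> dist p b" using dist[of b p] b p by auto
      moreover have "norm b \<le> norm p + dist p b" 
        by (metis dist_norm norm_minus_commute norm_triangle_sub)
      ultimately show False using be e by (simp add: e_def)
    qed
    then show "\<exists>e>0. ball p e \<inter> ball 0 1 \<subseteq> ball 0 1 \<inter> closure W" using e by blast
  qed auto
  moreover have "closedin (top_of_set (ball 0 1)) (ball 0 1 \<inter> closure W)"
    by (simp add: closedin_closed_Int)
  moreover have "ball 0 1 \<inter> closure W \<noteq> {}" using ne closure_subset[of W] by (auto simp: W)
  ultimately have "ball 0 1 \<inter> closure W = ball 0 1"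
    using connected_ball[of "0::complex" 1] unfolding connected_clopen by blast
  then have "ball 0 1 \<subseteq> closure W" by blast
  then have "closure (ball 0 1) \<subseteq> closure W" by (rule closure_minimal) simp
  then show ?thesis by (simp add: closure_ball)
qed

text \<open>Real parts of polynomials, which on the unit circle are the real trigonometric
  polynomials. Adding one monomial at a time provides the induction for products; closure under
  products holds only on the circle, so the product lemmas speak of
  \<open>norm z = 1\<close>.\<close>

inductive_set re_polys :: "(complex \<Rightarrow> real) set" where
  zero: "(\<lambda>_. 0) \<in> re_polys"
| add: "t \<in> re_polys \<Longrightarrow> (\<lambda>z. t z + Re (c * z ^ n)) \<in> re_polys"

lemma re_polys_plus: "s \<in> re_polys \<Longrightarrow> t \<in> re_polys \<Longrightarrow> (\<lambda>z. t z + s z) \<in> re_polys"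
proof (induction rule: re_polys.induct)
  case zero then show ?case by simp
next
  case (add s c n)
  then show ?case using re_polys.add[of "\<lambda>z. t z + s z" c n] by (simp add: add.assoc)
qed

lemma re_polys_monom: "(\<lambda>z. Re (c * z ^ n)) \<in> re_polys"
  using re_polys.add[OF re_polys.zero] by simp

text \<open>On the circle \<open>cnj z\<close> is the inverse of \<open>z\<close>, so the conjugated
  factor lowers the degree; \<open>m \<le> n\<close> makes \<open>n - m\<close> a true
  difference.\<close>

lemma Re_monom_mult_circle:
  fixes z :: complex
  assumes "norm z = 1" "m \<le> n"
  shows "Re (c * z ^ n) * Re (d * z ^ m) = Re (c * d / 2 * z ^ (n + m)) + Re (c * cnj d / 2 * z ^ (n - m))"
proof -
  have zz: "z * cnj z = 1" using assms(1) by (simp add: complex_norm_square[symmetric])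
  have "z ^ n * cnj z ^ m = z ^ (n - m) * (z * cnj z) ^ m"
    using assms(2) by (simp add: power_mult_distrib power_add[symmetric] mult.assoc[symmetric])
  then have *: "z ^ n * cnj z ^ m = z ^ (n - m)" by (simp add: zz)
  have ReRe: "Re a * Re b = Re (a * b / 2) + Re (a * cnj b / 2)" for a b by (simp add: field_simps)
  have "Re (c * z ^ n) * Re (d * z ^ m) = Re (c * d / 2 * (z ^ n * z ^ m)) + Re (c * cnj d / 2 * (z ^ n * cnj z ^ m))"
    by (subst ReRe) (simp add: mult_ac)
  then show ?thesis by (simp only: * power_add)
qed

lemma re_polys_mult_monom:
  assumes "t \<in> re_polys"
  shows "\<exists>s\<in>re_polys. \<forall>z. norm z = 1 \<longrightarrow> s z = t z * Re (d * z ^ m)"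
  using assms
proof (induction rule: re_polys.induct)
  case zero then show ?case using re_polys.zero by force
next
  case (add t c n)
  then obtain s where s: "s \<in> re_polys" "\<And>z. norm z = 1 \<Longrightarrow> s z = t z * Re (d * z ^ m)" by blast
  have "\<exists>r\<in>re_polys. \<forall>z. norm z = 1 \<longrightarrow> r z = Re (c * z ^ n) * Re (d * z ^ m)"
  proof (cases "m \<le> n")
    case True
    then show ?thesis
      by (intro bexI[OF _ re_polys_plus[OF re_polys_monom re_polys_monom]]) (auto simp only: Re_monom_mult_circle)
  next
    case False
    then have "n \<le> m" by simp
    have "\<exists>r\<in>re_polys. \<forall>z. norm z = 1 \<longrightarrow> r z = Re (d * z ^ m) * Re (c * z ^ n)"
      by (intro bexI[OF _ re_polys_plus[OF re_polys_monom re_polys_monom]]) (auto simp only: Re_monom_mult_circle[OF _ \<open>n \<le> m\<close>])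
    then show ?thesis by (simp only: mult.commute)
  qed
  then obtain r where r: "r \<in> re_polys" "\<And>z. norm z = 1 \<Longrightarrow> r z = Re (c * z ^ n) * Re (d * z ^ m)" by blast
  show ?case
    by (intro bexI[OF _ re_polys_plus[OF s(1) r(1)]]) (simp add: s r distrib_right)
qed

lemma re_polys_mult:
  assumes "t \<in> re_polys" "r \<in> re_polys"
  shows "\<exists>s\<in>re_polys. \<forall>z. norm z = 1 \<longrightarrow> s z = t z * r z"
  using assms(2)
proof (induction rule: re_polys.induct)
  case zero then show ?case using re_polys.zero by force
next
  case (add r c n)
  then obtain s where s: "s \<in> re_polys" "\<And>z. norm z = 1 \<Longrightarrow> s z = t z * r z" by blast
  obtain q where q: "q \<in> re_polys" "\<And>z. norm z = 1 \<Longrightarrow> q z = t z * Re (c * z ^ n)"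
    using re_polys_mult_monom[OF assms(1)] by blast
  show ?case
    by (intro bexI[OF _ re_polys_plus[OF s(1) q(1)]]) (simp add: s q distrib_left)
qed

lemma re_polys_Re_entire:
  assumes "t \<in> re_polys"
  shows "\<exists>p. p holomorphic_on UNIV \<and> (\<forall>z. t z = Re (p z))"
  using assms
proof (induction rule: re_polys.induct)
  case zero then show ?case by (intro exI[of _ "\<lambda>_. 0"]) auto
next
  case (add t c n)
  then obtain p where "p holomorphic_on UNIV" "\<forall>z. t z = Re (p z)" by blast
  then show ?case by (intro exI[of _ "\<lambda>z. p z + c * z ^ n"]) (auto intro!: holomorphic_intros)
qed

text \<open>This stands in for the Poisson integral: Stone-Weierstrass for trigonometric polynomials
  approximates boundary values by harmonic functions that are visibly real parts of entire
  functions.\<close>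

lemma circle_approx_Re_entire:
  fixes h :: "complex \<Rightarrow> real"
  assumes "continuous_on (sphere 0 1) h" "e > 0"
  shows "\<exists>p. p holomorphic_on UNIV \<and> (\<forall>z. norm z = 1 \<longrightarrow> \<bar>h z - Re (p z)\<bar> < e)"
proof -
  \<comment> \<open>Membership depends on the values on the circle alone, because
    \<open>re_polys\<close> becomes an algebra only after restriction to it.\<close>
  define R where "R = {g. \<exists>t\<in>re_polys. \<forall>z::complex. norm z = 1 \<longrightarrow> g z = t z}"
  interpret function_ring_on R "sphere 0 1"
  proof
    show "compact (sphere 0 1 :: complex set)" by simp
  next
    fix f assume "f \<in> R"
    then obtain t where t: "t \<in> re_polys" "\<And>z. norm z = 1 \<Longrightarrow> f z = t z" by (auto simp: R_def)
    obtain p where p: "p holomorphic_on UNIV" "\<And>z. t z = Re (p z)" using re_polys_Re_entire[OF t(1)] by blast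
    have "continuous_on (sphere 0 1) (\<lambda>z. Re (p z))"
      by (intro continuous_intros) (meson p(1) holomorphic_on_imp_continuous_on continuous_on_subset top_greatest)
    then show "continuous_on (sphere 0 1) f" by (rule continuous_on_eq) (auto simp: t p)
  next
    fix f g assume fg: "f \<in> R" "g \<in> R"
    then obtain s t where st: "s \<in> re_polys" "t \<in> re_polys" 
       "\<And>z. norm z = 1 \<Longrightarrow> f z = s z" "\<And>z. norm z = 1 \<Longrightarrow> g z = t z"
      unfolding R_def by blast
    show "(\<lambda>x. f x + g x) \<in> R" using re_polys_plus[OF st(2,1)] st(3,4) by (force simp: R_def)
    obtain q where "q \<in> re_polys" "\<And>z. norm z = 1 \<Longrightarrow> q z = s z * t z" using re_polys_mult[OF st(1,2)] by blast
    then show "(\<lambda>x. f x * g x) \<in> R" unfolding R_def using st(3,4) by (auto intro!: bexI[of _ q])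
  next
    show "(\<lambda>_. c) \<in> R" for c :: real
      using re_polys_monom[of "of_real c" 0] by (force simp: R_def)
  next
    fix x y :: complex assume "x \<noteq> y"
    moreover have "Re \<in> R" using re_polys_monom[of 1 1] by (force simp: R_def)
    moreover have "Im \<in> R" using re_polys_monom[of "-\<i>" 1] by (force simp: R_def)
    ultimately show "\<exists>f\<in>R. f x \<noteq> f y" using complex_eqI by blast
  qed
  obtain g where g: "g \<in> R" "\<And>z. z \<in> sphere 0 1 \<Longrightarrow> \<bar>h z - g z\<bar> < e"
    using Stone_Weierstrass_basic[OF assms] by blast
  then obtain t where t: "t \<in> re_polys" "\<And>z. norm z = 1 \<Longrightarrow> g z = t z" by (auto simp: R_def)
  obtain p where p: "p holomorphic_on UNIV" "\<And>z. t z = Re (p z)" using re_polys_Re_entire[OF t(1)] by blast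
  show ?thesis
    by (intro exI[of _ p] conjI p(1)) (use g t p in auto)
qed

text \<open>\<open>Re f\<close> is approximated on the circle by real parts of entire functions. The
  maximum principle off the zeros of \<open>u\<close>, together with the density of
  \<open>W\<close>, carries the approximation to the whole disc.\<close>

lemma Re_eq_Re_holomorphic_off_zeros:
  fixes f u :: "complex \<Rightarrow> complex"
  assumes u: "continuous_on (cball 0 1) u"
    and uh: "\<And>z. z \<in> ball 0 1 \<Longrightarrow> u z \<noteq> 0 \<Longrightarrow> u field_differentiable at z"
    and W: "W = {z \<in> ball 0 1. u z \<noteq> 0}" "W \<noteq> {}"
    and f: "continuous_on (cball 0 1) f"
    and fh: "\<And>z. z \<in> W \<Longrightarrow> f field_differentiable at z"
  obtains P where "P holomorphic_on ball 0 1" "\<And>z. z \<in> ball 0 1 \<Longrightarrow> Re (f z) = Re (P z)"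
proof -
  have cl: "closure W \<subseteq> cball 0 1" by (rule closure_minimal) (auto simp: W(1))
  have dense: "cball 0 1 \<subseteq> closure W" by (rule dense_nonzeros[OF u uh W])
  have "\<exists>p. p holomorphic_on UNIV \<and> (\<forall>z. norm z = 1 \<longrightarrow> \<bar>Re (f z) - Re (p z)\<bar> < 1 / Suc m)" for m
  proof (rule circle_approx_Re_entire)
    have "continuous_on (sphere 0 1) f" by (rule continuous_on_subset[OF f]) auto
    then show "continuous_on (sphere 0 1) (\<lambda>z. Re (f z))" by (intro continuous_intros)
  qed auto
  then obtain p where p: "\<And>m. p m holomorphic_on UNIV"
      "\<And>m z. norm z = 1 \<Longrightarrow> \<bar>Re (f z) - Re (p m z)\<bar> < 1 / Suc m"
    by metis
  have cp: "continuous_on A (p m)" for m A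
    using p(1) holomorphic_on_imp_continuous_on holomorphic_on_subset by blast
  have dp: "p m field_differentiable at z" for m z
    using p(1)[of m] by (simp add: holomorphic_on_def)
  have bound: "s * (Re (f z) - Re (p m z)) \<le> 1 / Suc m" if z: "z \<in> W" and s: "s = 1 \<or> s = -1" for s z m
  proof -
    \<comment> \<open>The exponential turns a bound of a real part into a bound of a modulus. The
      two signs \<open>s\<close> give the two-sided estimate, and the shift by
      \<open>1 / Suc m\<close> makes the bound on the circle equal to 1.\<close>
    define g where "g = (\<lambda>z. exp (of_real s * (f z - p m z) - of_real (1 / Suc m)))"
    have ng: "norm (g z) = exp (s * (Re (f z) - Re (p m z)) - 1 / Suc m)" for z
      by (simp add: g_def del: of_real_divide)
    have "norm (g z) \<le> 1"
    proof (rule maximum_modulus_off_zeros[OF u uh W(1) _ _ _ z])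
      show "continuous_on (closure W) g" unfolding g_def
        by (intro continuous_intros cp continuous_on_subset[OF f cl])
      show "g field_differentiable at w" if "w \<in> W" for w
        unfolding g_def
        by (rule field_differentiable_compose[where g=exp, unfolded o_def])
           (intro field_differentiable_diff field_differentiable_mult field_differentiable_const fh[OF that] dp 
             | rule field_differentiable_within_exp)+
      show "norm (g w) \<le> 1" if "norm w = 1" for w
        using p(2)[OF that, of m] s unfolding ng by auto
    qed auto
    then show ?thesis unfolding ng by simp
  qed
  have approx: "\<bar>Re (f z) - Re (p m z)\<bar> \<le> 1 / Suc m" if "z \<in> cball 0 1" for z m
  proof -
    have "closed ({z \<in> cball 0 1. \<bar>Re (f z) - Re (p m z)\<bar> \<le> 1 / Suc m})"
      by (intro continuous_on_closed_Collect_le continuous_intros f cp) auto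
    then have "closure W \<subseteq> {z \<in> cball 0 1. \<bar>Re (f z) - Re (p m z)\<bar> \<le> 1 / Suc m}"
      using bound[of _ 1 m] bound[of _ "-1" m] W(1) by (intro closure_minimal) (fastforce simp: abs_le_iff)+
    then show ?thesis using dense that by blast
  qed
  have "bounded (f ` cball 0 1)"
    using compact_continuous_image[OF f compact_cball] compact_imp_bounded by blast
  then obtain B where B: "\<And>w. w \<in> cball 0 1 \<Longrightarrow> norm (f w) \<le> B"
    unfolding bounded_iff by blast
  \<comment> \<open>The imaginary parts of the \<open>p m\<close> are uncontrolled, so Montel's
    theorem is applied to the exponentials, whose moduli depend on the real parts alone. The limit
    has modulus \<open>exp (Re f)\<close>, hence no zeros and a logarithm \<open>P\<close>.\<close>
  define E where "E = (\<lambda>m z. exp (p m z))"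
  obtain g r where g: "g holomorphic_on ball 0 1" "strict_mono (r :: nat \<Rightarrow> nat)"
          "\<And>x. x \<in> ball 0 1 \<Longrightarrow> ((\<lambda>n. E (r n) x) \<longlonglongrightarrow> g x)"
  proof (rule Montel[of "ball 0 1" "range E" E])
    show "open (ball (0::complex) 1)" by simp
    show "h holomorphic_on ball 0 1" if "h \<in> range E" for h
      using that holomorphic_on_subset[OF p(1)] by (auto simp: E_def intro!: holomorphic_on_exp')
    show "\<exists>C. \<forall>h\<in>range E. \<forall>z\<in>K. norm (h z) \<le> C" if "K \<subseteq> ball 0 1" for K
    proof -
      have "norm (E m z) \<le> exp (B + 1)" if "z \<in> ball 0 1" for m z
      proof -
        have "Re (p m z) \<le> Re (f z) + 1 / Suc m" using approx[of z m] that by (auto simp: abs_le_iff)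
        also have "\<dots> \<le> B + 1" using B[of z] complex_Re_le_cmod[of "f z"] that
          by (intro add_mono) (auto simp: divide_simps)
        finally show ?thesis by (simp add: E_def)
      qed
      then show ?thesis using that by blast
    qed
  qed auto
  have ng: "norm (g z) = exp (Re (f z))" if z: "z \<in> ball 0 1" for z
  proof (rule LIMSEQ_unique)
    show "(\<lambda>n. norm (E (r n) z)) \<longlonglongrightarrow> norm (g z)" by (intro tendsto_norm g(3) z)
    have "(\<lambda>m. Re (p m z) - Re (f z)) \<longlonglongrightarrow> 0"
    proof (rule Lim_null_comparison)
      show "\<forall>\<^sub>F m in sequentially. norm (Re (p m z) - Re (f z)) \<le> 1 / Suc m"
        using approx[of z] z by (intro always_eventually) (auto simp: abs_minus_commute)
      show "(\<lambda>m. 1 / real (Suc m)) \<longlonglongrightarrow> 0" by (rule lim_1_over_n[THEN LIMSEQ_Suc])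
    qed
    then have "(\<lambda>m. exp (Re (p m z))) \<longlonglongrightarrow> exp (Re (f z))" 
      by (intro tendsto_exp) (simp add: LIM_zero_iff)
    then show "(\<lambda>n. norm (E (r n) z)) \<longlonglongrightarrow> exp (Re (f z))"
      using LIMSEQ_subseq_LIMSEQ[OF _ g(2)] by (force simp: E_def o_def)
  qed
  obtain P where P: "P holomorphic_on ball 0 1" "\<And>z. z \<in> ball 0 1 \<Longrightarrow> g z = exp (P z)"
  proof (rule contractible_imp_holomorphic_log[OF g(1)])
    show "contractible (ball (0::complex) 1)" by (simp add: convex_imp_contractible)
    show "g z \<noteq> 0" if "z \<in> ball 0 1" for z using ng[OF that] by auto
  qed blast
  show thesis
  proof (rule that[OF P(1)])
    fix z :: complex assume z: "z \<in> ball 0 1"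
    show "Re (f z) = Re (P z)" using ng[OF z] P(2)[OF z] by simp
  qed
qed

lemma deriv_eq_0_of_Re_zero:
  assumes "open S" "z \<in> S" and F: "(F has_field_derivative D) (at z)" and Re: "\<And>w. w \<in> S \<Longrightarrow> Re (F w) = 0"
  shows "D = 0"
proof -
  have "((\<lambda>w. Re (F w)) has_derivative (\<lambda>h. Re (D * h))) (at z)"
    using F by (intro derivative_intros) (simp add: has_field_derivative_def)
  moreover have "((\<lambda>w. Re (F w)) has_derivative (\<lambda>h. 0)) (at z)"
    by (rule has_derivative_transform_within_open[OF has_derivative_const[of 0] assms(1,2)]) (simp add: Re)
  ultimately have "(\<lambda>h. Re (D * h)) = (\<lambda>h. 0)" by (rule has_derivative_unique)
  then have "Re (D * 1) = 0" "Re (D * \<i>) = 0" by metis+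
  then show ?thesis by (simp add: complex_eq_iff)
qed

text \<open>The exceptional set is given by a second function \<open>u\<close>: in the application
  \<open>f\<close> is a component of an inverse map and \<open>u\<close> a Jacobian determinant
  pulled back by it. Both Re f and Im f are real parts of holomorphic functions \<open>P\<close> and
  \<open>Q\<close>. Off the zeros the derivatives of \<open>P\<close> and \<open>Q\<close> are
  linked through that of \<open>f\<close>, and the identity theorem extends the link to the
  disc.\<close>

theorem rado:
  fixes f u :: "complex \<Rightarrow> complex"
  assumes u: "continuous_on (cball 0 1) u"
    and uh: "\<And>z. z \<in> ball 0 1 \<Longrightarrow> u z \<noteq> 0 \<Longrightarrow> u field_differentiable at z"
    and f: "continuous_on (cball 0 1) f"
    and fh: "\<And>z. z \<in> ball 0 1 \<Longrightarrow> u z \<noteq> 0 \<Longrightarrow> f field_differentiable at z"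
    and u0: "u 0 \<noteq> 0"
  shows "f holomorphic_on ball 0 1"
proof -
  define W where "W = {z \<in> ball 0 1. u z \<noteq> 0}"
  have W0: "0 \<in> W" using u0 by (simp add: W_def)
  have Wne: "W \<noteq> {}" using W0 by blast
  have fW: "\<And>z. z \<in> W \<Longrightarrow> f field_differentiable at z" using fh by (simp add: W_def)
  have opW: "open W"
  proof -
    have "continuous_on (ball 0 1) u" by (rule continuous_on_subset[OF u]) auto
    then have "open (ball 0 1 \<inter> u -` (- {0}))"
      by (rule continuous_open_preimage) auto
    also have "ball 0 1 \<inter> u -` (- {0}) = W" by (auto simp: W_def)
    finally show ?thesis .
  qed
  obtain P where P: "P holomorphic_on ball 0 1" "\<And>z. z \<in> ball 0 1 \<Longrightarrow> Re (f z) = Re (P z)"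
    using Re_eq_Re_holomorphic_off_zeros[OF u uh W_def Wne f fW] by blast
  have "continuous_on (cball 0 1) (\<lambda>z. - \<i> * f z)" by (intro continuous_intros f)
  moreover have "(\<lambda>z. - \<i> * f z) field_differentiable at z" if "z \<in> W" for z
    by (intro field_differentiable_mult field_differentiable_const fW that)
  ultimately have "\<exists>Q. Q holomorphic_on ball 0 1 \<and> (\<forall>z\<in>ball 0 1. Re (- \<i> * f z) = Re (Q z))"
    using Re_eq_Re_holomorphic_off_zeros[OF u uh W_def Wne, of "\<lambda>z. - \<i> * f z"] by metis
  then obtain Q where Q: "Q holomorphic_on ball 0 1" "\<And>z. z \<in> ball 0 1 \<Longrightarrow> Im (f z) = Re (Q z)"
    by auto
  have Wb: "W \<subseteq> ball 0 1" by (auto simp: W_def)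
  have der: "(F has_field_derivative deriv F z) (at z)" if "F holomorphic_on ball 0 1" "z \<in> ball 0 1" for F z
    using holomorphic_derivI[OF that(1) open_ball that(2)] .
  have dW: "deriv Q z + \<i> * deriv P z = 0" if z: "z \<in> W" for z
  proof -
    have zb: "z \<in> ball 0 1" using z Wb by blast
    have df: "(f has_field_derivative deriv f z) (at z)" using fW[OF z] by (simp add: field_differentiable_derivI)
    have "deriv f z - deriv P z = 0"
      by (rule deriv_eq_0_of_Re_zero[OF opW z DERIV_diff[OF df der[OF P(1) zb]]]) (use P(2) Wb in auto)
    moreover have "- \<i> * deriv f z - deriv Q z = 0"
      by (rule deriv_eq_0_of_Re_zero[OF opW z DERIV_diff[OF DERIV_cmult[OF df] der[OF Q(1) zb]]]) (use Q(2) Wb in auto)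
    ultimately have "deriv f z = deriv P z" "deriv Q z = - (\<i> * deriv f z)" by auto
    then show ?thesis by simp
  qed
  define R where "R = (\<lambda>z. Q z + \<i> * P z)"
  have dR: "(R has_field_derivative (deriv Q z + \<i> * deriv P z)) (at z)" if "z \<in> ball 0 1" for z
    unfolding R_def by (intro DERIV_add DERIV_cmult der P Q that)
  have zero: "deriv Q z + \<i> * deriv P z = 0" if "z \<in> ball 0 1" for z
  proof (rule analytic_continuation_open[where s=W and s'="ball 0 1" and f="\<lambda>z. deriv Q z + \<i> * deriv P z" and g="\<lambda>_. 0"])
    show "(\<lambda>z. deriv Q z + \<i> * deriv P z) holomorphic_on ball 0 1"
      by (intro holomorphic_intros P Q) auto
  qed (use opW Wne Wb dW that in auto)
  have "\<exists>c. \<forall>z\<in>ball 0 1. R z = c"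
  proof (rule DERIV_zero_connected_constant[of "ball 0 1" "{}", THEN exE])
    show "continuous_on (ball 0 1) R"
      by (rule holomorphic_on_imp_continuous_on) (auto simp: R_def intro!: holomorphic_intros P Q)
  qed (use dR zero in auto)
  then obtain c where c: "\<And>z. z \<in> ball 0 1 \<Longrightarrow> R z = c" by blast
  \<comment> \<open>The real part of \<open>Q z + \<i> * P z = c\<close> reads Im f - Im P = Re
    c.\<close>
  have "f z = P z + \<i> * of_real (Re c)" if z: "z \<in> ball 0 1" for z
    using P(2)[OF z] Q(2)[OF z] arg_cong[OF c[OF z], of Re] by (simp add: R_def complex_eq_iff)
  moreover have "(\<lambda>z. P z + \<i> * of_real (Re c)) holomorphic_on ball 0 1"
    by (intro holomorphic_intros P)
  ultimately show ?thesis by (metis (no_types, lifting) holomorphic_cong)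
qed

section \<open>Holomorphy along complex lines\<close>

lemma norm_cscale: "norm (c *s (v :: complex ^ 'n)) = norm c * norm v"
  by (simp add: norm_vec_def norm_mult L2_set_right_distrib)

lemma bounded_linear_cscale_left: "bounded_linear (\<lambda>c. c *s (v :: complex ^ 'n))"
  by (rule bounded_linear_intro[where K="norm v"])
     (auto simp: vec_eq_iff norm_cscale algebra_simps)

lemma continuous_on_cscale [continuous_intros]:
  fixes g :: "'a::topological_space \<Rightarrow> complex ^ 'n"
  assumes "continuous_on A f" "continuous_on A g"
  shows "continuous_on A (\<lambda>x. f x *s g x)"
  unfolding vector_scalar_mult_def by (intro continuous_intros assms)

lemma scaleR_eq_cscale: "r *\<^sub>R (v :: complex ^ 'n) = of_real r *s v"
  unfolding vec_eq_iff vector_scaleR_component vector_smult_component by (simp add: scaleR_conv_of_real)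

text \<open>Asking for the closed disc in \<open>S\<close> gives continuity up to the boundary, as
  Cauchy's estimates want it; rescaling \<open>v\<close> turns any disc into the unit disc. Unlike
  Frechet differentiability, this notion passes directly to locally uniform limits.\<close>

definition line_holomorphic_on :: "(complex ^ 'n \<Rightarrow> complex) \<Rightarrow> (complex ^ 'n) set \<Rightarrow> bool" where
  "line_holomorphic_on f S \<longleftrightarrow> continuous_on S f \<and>
     (\<forall>a v. (\<forall>\<zeta>\<in>cball 0 1. a + \<zeta> *s v \<in> S) \<longrightarrow> (\<lambda>\<zeta>. f (a + \<zeta> *s v)) holomorphic_on ball 0 1)"

definition dir_deriv :: "(complex ^ 'n \<Rightarrow> complex) \<Rightarrow> complex ^ 'n \<Rightarrow> complex ^ 'n \<Rightarrow> complex" where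
  "dir_deriv f v z = deriv (\<lambda>\<zeta>. f (z + \<zeta> *s v)) 0"

lemma line_holomorphic_onD_slice:
  assumes "line_holomorphic_on f S" "\<And>\<zeta>. norm \<zeta> \<le> 1 \<Longrightarrow> a + \<zeta> *s v \<in> S"
  shows "(\<lambda>\<zeta>. f (a + \<zeta> *s v)) holomorphic_on ball 0 1"
    and "continuous_on (cball 0 1) (\<lambda>\<zeta>. f (a + \<zeta> *s v))"
proof -
  show "(\<lambda>\<zeta>. f (a + \<zeta> *s v)) holomorphic_on ball 0 1"
    using assms unfolding line_holomorphic_on_def by simp
  have "continuous_on S f" using assms by (simp add: line_holomorphic_on_def)
  then show "continuous_on (cball 0 1) (\<lambda>\<zeta>. f (a + \<zeta> *s v))"
    by (rule continuous_on_compose2) (use assms(2) in \<open>auto intro!: continuous_intros\<close>)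
qed

lemma line_holomorphic_on_subset: "line_holomorphic_on f S \<Longrightarrow> T \<subseteq> S \<Longrightarrow> line_holomorphic_on f T"
  unfolding line_holomorphic_on_def by (meson continuous_on_subset subset_eq)

section \<open>Cauchy estimates on slices and the Frechet derivative\<close>

lemma disc_cauchy_bound:
  fixes h :: "complex \<Rightarrow> complex"
  assumes "h holomorphic_on ball 0 1" "continuous_on (cball 0 1) h" "\<And>\<zeta>. norm \<zeta> \<le> 1 \<Longrightarrow> norm (h \<zeta>) \<le> M"
  shows "norm (deriv h 0) \<le> M"
  using Cauchy_inequality[of h 0 1 M 1] assms by simp

lemma disc_taylor_bound:
  fixes h :: "complex \<Rightarrow> complex"
  assumes h: "h holomorphic_on ball 0 1" and c: "continuous_on (cball 0 1) h"
    and M: "\<And>\<zeta>. norm \<zeta> \<le> 1 \<Longrightarrow> norm (h \<zeta>) \<le> M" and \<zeta>: "norm \<zeta> \<le> 1/2"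
  shows "norm (h \<zeta> - h 0 - \<zeta> * deriv h 0) \<le> 8 * M * norm \<zeta> ^ 2"
proof -
  have "norm ((deriv ^^ 0) h \<zeta> - (\<Sum>i\<le>1. (deriv ^^ i) h 0 * (\<zeta> - 0) ^ i / fact i))
      \<le> (8 * M) * norm (\<zeta> - 0) ^ Suc 1 / fact 1"
  proof (rule complex_Taylor[where S="cball 0 (1/2)" and n=1])
    fix i x assume x: "x \<in> cball (0::complex) (1/2)"
    have "(deriv ^^ i) h holomorphic_on ball 0 1" by (simp add: h holomorphic_higher_deriv)
    then have "((deriv ^^ i) h has_field_derivative deriv ((deriv ^^ i) h) x) (at x)"
      by (rule holomorphic_derivI) (use x in auto)
    then show "((deriv ^^ i) h has_field_derivative (deriv ^^ (Suc i)) h x) (at x within cball 0 (1/2))"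
      by (simp add: has_field_derivative_at_within)
  next
    fix x assume x: "x \<in> cball (0::complex) (1/2)"
    have sub: "cball x (1/2) \<subseteq> cball 0 1" 
      using x by (simp add: cball_subset_cball_iff)
    have sub': "ball x (1/2) \<subseteq> ball 0 1" 
      using x by (simp add: ball_subset_ball_iff)
    \<comment> \<open>Discs of radius 1/2 about points of \<open>cball 0 (1/2)\<close> stay in the
      unit disc; Cauchy's estimate on them gives 2 M / (1/2)^2 = 8 M.\<close>
    have "norm ((deriv ^^ 2) h x) \<le> fact 2 * M / (1/2) ^ 2"
    proof (rule Cauchy_inequality)
      show "h holomorphic_on ball x (1/2)" by (rule holomorphic_on_subset[OF h sub'])
      show "continuous_on (cball x (1/2)) h" by (rule continuous_on_subset[OF c sub])
      fix y assume "norm (x - y) = 1/2"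
      then have "y \<in> cball x (1/2)" by (simp add: dist_norm)
      then show "norm (h y) \<le> M" using sub M[of y] by (metis mem_cball_0 subsetD)
    qed auto
    then show "norm ((deriv ^^ Suc 1) h x) \<le> 8 * M" by (simp add: numeral_2_eq_2 power2_eq_square)
  qed (use \<zeta> in auto)
  then show ?thesis by (simp add: algebra_simps power2_eq_square)
qed

lemma small_affine_disc:
  fixes z v :: "complex ^ 'n"
  assumes "open S" "z \<in> S"
  obtains e where "e > 0" "\<And>\<zeta>. norm \<zeta> \<le> 1 \<Longrightarrow> z + \<zeta> *s (of_real e *s v) \<in> S"
proof -
  obtain r where r: "r > 0" "ball z r \<subseteq> S" using assms open_contains_ball by blast
  \<comment> \<open>Adding 1 covers \<open>v = 0\<close>; the same guard occurs in later choices of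
    radii.\<close>
  define e where "e = r / (norm v + 1)"
  have e: "e > 0" using r by (simp add: e_def add_nonneg_pos)
  show ?thesis
  proof (rule that[OF e])
    fix \<zeta> :: complex assume z: "norm \<zeta> \<le> 1"
    have "e * norm v < r" using r by (simp add: e_def divide_simps add_nonneg_pos mult_strict_left_mono)
    moreover have "norm \<zeta> * (e * norm v) \<le> e * norm v"
      using z e by (intro mult_left_le_one_le) auto
    moreover have "norm (\<zeta> *s (of_real e *s v)) = norm \<zeta> * (e * norm v)"
      unfolding norm_cscale norm_of_real using e by (simp only: abs_of_pos)
    ultimately have "norm (\<zeta> *s (of_real e *s v)) < r" by linarith
    then show "z + \<zeta> *s (of_real e *s v) \<in> S" using r by (auto simp: dist_norm)
  qed
qed

lemma line_holomorphic_slice_differentiable: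
  assumes f: "line_holomorphic_on f S" "open S" "z \<in> S"
  shows "(\<lambda>\<zeta>. f (z + \<zeta> *s v)) field_differentiable at 0"
proof -
  obtain e where e: "e > 0" "\<And>\<zeta>. norm \<zeta> \<le> 1 \<Longrightarrow> z + \<zeta> *s (of_real e *s v) \<in> S"
    using small_affine_disc[OF f(2,3)] by blast
  have "(\<lambda>\<zeta>. f (z + \<zeta> *s (of_real e *s v))) holomorphic_on ball 0 1"
    by (rule line_holomorphic_onD_slice[OF f(1) e(2)])
  then have "(\<lambda>\<zeta>. f (z + \<zeta> *s (of_real e *s v))) field_differentiable at ((\<lambda>\<zeta>. \<zeta> / of_real e) 0)"
    by (simp add: holomorphic_on_imp_differentiable_at)
  then have "((\<lambda>\<zeta>. f (z + \<zeta> *s (of_real e *s v))) \<circ> (\<lambda>\<zeta>. \<zeta> / of_real e)) field_differentiable at 0"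
    by (intro field_differentiable_compose derivative_intros) (use e in auto)
  then show ?thesis using e by (simp add: o_def)
qed

lemma dir_deriv_cscale:
  assumes f: "line_holomorphic_on f S" "open S" "z \<in> S"
  shows "dir_deriv f (c *s v) z = c * dir_deriv f v z"
proof -
  have "((\<lambda>\<zeta>. f (z + \<zeta> *s v)) has_field_derivative dir_deriv f v z) (at ((\<lambda>\<zeta>. \<zeta> * c) 0))"
    using line_holomorphic_slice_differentiable[OF assms] 
    by (simp add: dir_deriv_def field_differentiable_derivI)
  moreover have "((\<lambda>\<zeta>. \<zeta> * c) has_field_derivative c) (at 0)" by (auto intro!: derivative_eq_intros)
  ultimately have "((\<lambda>\<zeta>. f (z + \<zeta> *s v)) \<circ> (\<lambda>\<zeta>. \<zeta> * c) has_field_derivative dir_deriv f v z * c) (at 0)"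
    by (rule DERIV_chain)
  then show ?thesis
    by (simp add: dir_deriv_def o_def DERIV_imp_deriv mult.commute)
qed

lemma
  assumes f: "line_holomorphic_on f S" "open S" and r: "r > 0" "cball z r \<subseteq> S"
    and M: "\<And>y. y \<in> cball z r \<Longrightarrow> norm (f y) \<le> M"
  shows dir_deriv_bound: "norm (dir_deriv f w z) \<le> M * (norm w / r)"
    and dir_deriv_remainder: "norm w \<le> r / 2 \<Longrightarrow> 
      norm (f (z + w) - f z - dir_deriv f w z) \<le> 8 * M * (norm w / r) ^ 2"
proof -
  have z: "z \<in> S" using r by auto
  have M0: "0 \<le> M" using M[of z] r by (auto intro: order_trans[OF norm_ge_zero])
  \<comment> \<open>The slice through \<open>z\<close> in the direction \<open>v\<close>, of length
    at most \<open>r\<close>, is a unit disc inside \<open>cball z r\<close>, and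
    \<open>z + w\<close> sits on it at the parameter \<open>t\<close>. For \<open>w = 0\<close> the
    vector \<open>v\<close> is set to 0.\<close>
  define t where "t = norm w / r"
  define v where "v = (if w = 0 then 0 else of_real (1 / t) *s w)"
  have w: "w = of_real t *s v" using r by (simp add: v_def t_def)
  have nv: "norm v \<le> r" using r by (simp add: v_def t_def norm_cscale norm_divide)
  have in_cb: "z + \<zeta> *s v \<in> cball z r" if "norm \<zeta> \<le> 1" for \<zeta>
    using mult_mono[OF that nv] r by (simp add: dist_norm norm_cscale)
  then have S: "z + \<zeta> *s v \<in> S" if "norm \<zeta> \<le> 1" for \<zeta> using that r by blast
  note sl = line_holomorphic_onD_slice[OF f(1) S]
  have t: "t \<ge> 0" using r by (simp add: t_def)
  have dd: "dir_deriv f w z = of_real t * dir_deriv f v z"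
    by (subst w) (rule dir_deriv_cscale[OF f z])
  have "norm (dir_deriv f v z) \<le> M"
    unfolding dir_deriv_def by (rule disc_cauchy_bound[OF sl]) (use M in_cb in auto)
  then show "norm (dir_deriv f w z) \<le> M * (norm w / r)"
    using mult_left_mono[of "norm (dir_deriv f v z)" M t] t
    unfolding dd norm_mult norm_of_real t_def[symmetric] by (simp add: mult.commute)
  assume "norm w \<le> r / 2"
  then have "t \<le> 1/2" using r by (simp add: t_def field_simps)
  then have "norm (f (z + of_real t *s v) - f (z + 0 *s v) - of_real t * deriv (\<lambda>\<zeta>. f (z + \<zeta> *s v)) 0) 
     \<le> 8 * M * norm (of_real t :: complex) ^ 2"
    using t by (intro disc_taylor_bound[OF sl]) (use M in_cb in auto)
  then show "norm (f (z + w) - f z - dir_deriv f w z) \<le> 8 * M * (norm w / r) ^ 2"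
    using t by (simp add: w[symmetric] dir_deriv_def[symmetric] dd[symmetric]) (simp add: t_def)
qed

lemma line_holomorphic_lipschitz:
  assumes f: "line_holomorphic_on f S" "open S" and r: "r > 0" "cball z r \<subseteq> S"
    and M: "\<And>y. y \<in> cball z r \<Longrightarrow> norm (f y) \<le> M" and w: "norm w \<le> r / 2"
  shows "norm (f (z + w) - f z) \<le> 5 * M * (norm w / r)"
proof -
  have M0: "0 \<le> M" using M[of z] r by (auto intro: order_trans[OF norm_ge_zero])
  define t where "t = norm w / r"
  have t: "0 \<le> t" "t \<le> 1/2" using r w by (auto simp: t_def field_simps)
  have "norm (f (z + w) - f z) \<le> norm (f (z + w) - f z - dir_deriv f w z) + norm (dir_deriv f w z)"
    by (metis add.commute diff_add_cancel norm_triangle_ineq)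
  \<comment> \<open>As \<open>t\<close> is at most 1/2, the quadratic term is at most 4 M t; with
    the linear term M t this gives the constant 5.\<close>
  also have "\<dots> \<le> 8 * M * t ^ 2 + M * t"
    unfolding t_def by (intro add_mono dir_deriv_remainder[OF f r M w] dir_deriv_bound[OF f r M])
  also have "8 * M * t ^ 2 = 8 * M * t * t" by (simp add: power2_eq_square)
  also have "\<dots> \<le> 8 * M * t * (1/2)" using t M0 by (intro mult_left_mono) auto
  finally show ?thesis by (simp add: t_def)
qed

lemma line_holomorphic_on_diff:
  "line_holomorphic_on f S \<Longrightarrow> line_holomorphic_on g S \<Longrightarrow> line_holomorphic_on (\<lambda>z. f z - g z) S"
  by (auto simp: line_holomorphic_on_def intro!: continuous_intros holomorphic_on_diff)

lemma line_holomorphic_on_translate: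
  assumes "line_holomorphic_on f S"
  shows "line_holomorphic_on (\<lambda>z. f (z + u)) {z. z + u \<in> S}"
proof -
  have "continuous_on {z. z + u \<in> S} (\<lambda>z. f (z + u))"
    by (rule continuous_on_compose2[of S f])
       (use assms in \<open>auto simp: line_holomorphic_on_def intro: continuous_on_add continuous_on_id continuous_on_const\<close>)
  moreover have "(\<lambda>\<zeta>. f (a + \<zeta> *s v + u)) holomorphic_on ball 0 1" 
    if "\<forall>\<zeta>\<in>cball 0 1. a + \<zeta> *s v + u \<in> S" for a v
    using line_holomorphic_onD_slice(1)[OF assms, of "a + u" v] that by (simp add: add_ac)
  ultimately show ?thesis by (simp add: line_holomorphic_on_def)
qed

text \<open>Cauchy's estimate in the direction \<open>w\<close> is applied to the difference
  \<open>f (y + u) - f y\<close> as a function of \<open>y\<close>, which is itself small by the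
  Lipschitz estimate. Each of the two estimates uses up a radius \<open>r\<close>, hence the ball of
  radius \<open>2 * r\<close>.\<close>

lemma dir_deriv_lipschitz:
  assumes f: "line_holomorphic_on f S" "open S" and r: "r > 0" "cball z (2 * r) \<subseteq> S"
    and M: "\<And>y. y \<in> cball z (2 * r) \<Longrightarrow> norm (f y) \<le> M" and u: "norm u \<le> r / 2"
  shows "norm (dir_deriv f w (z + u) - dir_deriv f w z) \<le> 5 * M * (norm u / r) * (norm w / r)"
proof -
  define T where "T = {y. y + u \<in> S} \<inter> S"
  define k where "k = (\<lambda>y. f (y + u) - f y)"
  have "open {y. y + u \<in> S}" 
    using open_vimage[OF f(2), of "\<lambda>y. y + u"] by (simp add: vimage_def continuous_intros)
  then have T: "open T" by (simp add: T_def f(2) open_Int)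
  have k: "line_holomorphic_on k T" unfolding k_def
    by (intro line_holomorphic_on_diff line_holomorphic_on_subset[OF line_holomorphic_on_translate[OF f(1)]] 
         line_holomorphic_on_subset[OF f(1)]) (auto simp: T_def)
  have in2: "y + u \<in> cball z (2 * r)" "y \<in> cball z (2 * r)" if "y \<in> cball z r" for y
  proof -
    have "dist z (y + u) \<le> dist z y + norm u" using norm_triangle_ineq4[of "z - y" u] by (simp add: dist_norm algebra_simps)
    then show "y + u \<in> cball z (2 * r)" "y \<in> cball z (2 * r)" using that u r by auto
  qed
  then have sub: "cball z r \<subseteq> T" using r by (auto simp: T_def simp del: mem_cball)
  have zS: "z \<in> S" "z + u \<in> S" using in2[of z] r by auto
  have "norm (dir_deriv k w z) \<le> 5 * M * (norm u / r) * (norm w / r)"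
  proof (rule dir_deriv_bound[OF k T r(1) sub])
    fix y assume y: "y \<in> cball z r"
    have "cball y r \<subseteq> cball z (2 * r)" using y r by (simp add: cball_subset_cball_iff dist_commute)
    then show "norm (k y) \<le> 5 * M * (norm u / r)" unfolding k_def
      using r M u by (intro line_holomorphic_lipschitz[OF f]) auto
  qed
  moreover have "dir_deriv k w z = dir_deriv f w (z + u) - dir_deriv f w z"
    using line_holomorphic_slice_differentiable[OF f zS(1), of w] line_holomorphic_slice_differentiable[OF f zS(2), of w]
    by (simp add: dir_deriv_def k_def deriv_diff add_ac)
  ultimately show ?thesis by simp
qed

lemma line_holomorphic_local_bound:
  assumes f: "line_holomorphic_on f S" "open S" "z \<in> S"
  obtains r M where "r > 0" "cball z (2 * r) \<subseteq> S" "\<And>y. y \<in> cball z (2 * r) \<Longrightarrow> norm (f y) \<le> M"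
proof -
  obtain s where s: "s > 0" "cball z s \<subseteq> S" using f open_contains_cball by blast
  have "continuous_on (cball z s) f" using f s by (meson continuous_on_subset line_holomorphic_on_def)
  then have "bounded (f ` cball z s)"
    using compact_continuous_image compact_cball compact_imp_bounded by blast
  then obtain M where "\<And>y. y \<in> cball z s \<Longrightarrow> norm (f y) \<le> M" unfolding bounded_iff by blast
  then show ?thesis using s that[of "s/2" M] by simp
qed

lemma tendsto_dir_deriv_translate:
  assumes f: "line_holomorphic_on f S" "open S" "z \<in> S"
  shows "((\<lambda>u. dir_deriv f w (z + u)) \<longlongrightarrow> dir_deriv f w z) (at 0)"
proof -
  obtain r M where rM: "r > 0" "cball z (2 * r) \<subseteq> S" "\<And>y. y \<in> cball z (2 * r) \<Longrightarrow> norm (f y) \<le> M"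
    using line_holomorphic_local_bound[OF f] by metis
  have "((\<lambda>u. dir_deriv f w (z + u) - dir_deriv f w z) \<longlongrightarrow> 0) (at 0)"
  proof (rule Lim_null_comparison)
    have "\<forall>\<^sub>F u in at (0::complex^'a). u \<in> ball 0 (r/2)"
      using rM by (intro eventually_at_in_open') auto
    then show "\<forall>\<^sub>F u in at 0. norm (dir_deriv f w (z + u) - dir_deriv f w z) \<le> 5 * M * (norm u / r) * (norm w / r)"
      by eventually_elim (rule dir_deriv_lipschitz[OF f(1,2) rM], auto)
    have "((\<lambda>u::complex^'a. 5 * M * (norm u / r) * (norm w / r)) \<longlongrightarrow> 5 * M * (norm (0::complex^'a) / r) * (norm w / r)) (at 0)"
      by (intro tendsto_intros) (use rM in auto)
    then show "((\<lambda>u::complex^'a. 5 * M * (norm u / r) * (norm w / r)) \<longlongrightarrow> 0) (at 0)" by simp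
  qed
  then show ?thesis by (simp add: LIM_zero_iff)
qed

lemma continuous_on_dir_deriv:
  assumes f: "line_holomorphic_on f S" "open S"
  shows "continuous_on S (dir_deriv f w)"
  unfolding continuous_on_eq_continuous_at[OF f(2)] isCont_iff
  using tendsto_dir_deriv_translate[OF f] by blast

text \<open>The point z + s (v + w) is reached from \<open>z\<close> directly or by way of z + s v.
  The Taylor remainders on the three segments are quadratic in \<open>s\<close>, so after division
  by \<open>s\<close> only the derivatives survive. One of them has the moving base point z + s v
  and is brought back to \<open>z\<close> by continuity.\<close>

lemma dir_deriv_add:
  assumes f: "line_holomorphic_on f S" "open S" "z \<in> S"
  shows "dir_deriv f (v + w) z = dir_deriv f v z + dir_deriv f w z"
proof -
  obtain r M where rM: "r > 0" "cball z (2 * r) \<subseteq> S" "\<And>y. y \<in> cball z (2 * r) \<Longrightarrow> norm (f y) \<le> M"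
    using line_holomorphic_local_bound[OF f] by metis
  define C where "C = 8 * M * ((norm v + norm w) / r) ^ 2"
  have M0: "0 \<le> M" using rM(3)[of z] rM(1) by (auto intro: order_trans[OF norm_ge_zero])
  \<comment> \<open>For \<open>s < e\<close> all three increments have norm at most
    \<open>r / 2\<close>, as the Taylor bound on a ball of radius \<open>r\<close> requires.\<close>
  define e where "e = r / (2 * (norm v + norm w + 1))"
  have e: "e > 0" using rM by (simp add: e_def add_nonneg_pos)
  have rem: "norm (f (y + s *\<^sub>R x) - f y - s *\<^sub>R dir_deriv f x y) \<le> s ^ 2 * C"
    if s: "0 < s" "s < e" and y: "y \<in> cball z r" and x: "norm x \<le> norm v + norm w" for s x y
  proof -
    have sub: "cball y r \<subseteq> cball z (2 * r)" using y rM by (simp add: cball_subset_cball_iff dist_commute)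
    have "norm (s *\<^sub>R x) \<le> s * (norm v + norm w)" using s x by simp
    also have "\<dots> \<le> e * (norm v + norm w)" using s by (intro mult_right_mono) auto
    also have "\<dots> \<le> r / 2" using rM by (simp add: e_def divide_simps add_nonneg_pos)
    finally have "norm (f (y + s *\<^sub>R x) - f y - dir_deriv f (s *\<^sub>R x) y) \<le> 8 * M * (norm (s *\<^sub>R x) / r)\<^sup>2"
      using sub rM by (intro dir_deriv_remainder[OF f(1,2)]) auto
    also have "(norm (s *\<^sub>R x) / r)\<^sup>2 = s ^ 2 * (norm x / r) ^ 2" using s by (simp add: power_mult_distrib power_divide)
    also have "8 * M * (s ^ 2 * (norm x / r) ^ 2) \<le> 8 * M * (s ^ 2 * ((norm v + norm w) / r) ^ 2)"
      using M0 x rM by (intro mult_left_mono power_mono divide_right_mono) auto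
    finally show ?thesis using dir_deriv_cscale[OF f(1,2), of y "of_real s" x] sub rM(1,2)
      by (simp add: C_def scaleR_eq_cscale scaleR_conv_of_real mult_ac subset_iff)
  qed
  have "((\<lambda>s. dir_deriv f (v + w) z - dir_deriv f v z - dir_deriv f w (z + s *\<^sub>R v)) \<longlongrightarrow> 0) (at_right 0)"
  proof (rule Lim_null_comparison)
    have "\<forall>\<^sub>F s in at_right 0. 0 < s \<and> s < e"
      using e by (simp add: eventually_at_right_less eventually_conj eventually_at_right_real[of 0 e, simplified])
    then show "\<forall>\<^sub>F s in at_right 0. norm (dir_deriv f (v + w) z - dir_deriv f v z - dir_deriv f w (z + s *\<^sub>R v)) \<le> 3 * C * s"
    proof eventually_elim
      case (elim s)
      then have s: "0 < s" "s < e" by auto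
      have "norm (s *\<^sub>R v) \<le> s * (norm v + norm w)" using s by simp
      also have "\<dots> \<le> e * (norm v + norm w)" using s by (intro mult_right_mono) auto
      also have "\<dots> \<le> r" using rM by (simp add: e_def divide_simps add_nonneg_pos)
      finally have zs: "z + s *\<^sub>R v \<in> cball z r" by (simp add: dist_norm)
      define A1 where "A1 = f (z + s *\<^sub>R (v + w)) - f z - s *\<^sub>R dir_deriv f (v + w) z"
      define A2 where "A2 = f (z + s *\<^sub>R v) - f z - s *\<^sub>R dir_deriv f v z"
      define A3 where "A3 = f (z + s *\<^sub>R v + s *\<^sub>R w) - f (z + s *\<^sub>R v) - s *\<^sub>R dir_deriv f w (z + s *\<^sub>R v)"
      have "norm A1 \<le> s ^ 2 * C" "norm A2 \<le> s ^ 2 * C" "norm A3 \<le> s ^ 2 * C"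
        unfolding A1_def A2_def A3_def using rM by (intro rem s zs; simp add: norm_triangle_ineq)+
      moreover have "s *\<^sub>R (dir_deriv f (v + w) z - dir_deriv f v z - dir_deriv f w (z + s *\<^sub>R v)) = A2 + A3 - A1"
        by (simp add: A1_def A2_def A3_def algebra_simps)
      ultimately have "norm (s *\<^sub>R (dir_deriv f (v + w) z - dir_deriv f v z - dir_deriv f w (z + s *\<^sub>R v))) \<le> 3 * (s^2 * C)"
        using norm_triangle_ineq4[of "A2 + A3" A1] norm_triangle_ineq[of A2 A3] by simp
      then have "s * norm (dir_deriv f (v + w) z - dir_deriv f v z - dir_deriv f w (z + s *\<^sub>R v)) \<le> s * (3 * C * s)"
        using s by (simp add: power2_eq_square mult_ac)
      then show ?case using s by simp
    qed
    have "((\<lambda>s. 3 * C * s) \<longlongrightarrow> 3 * C * 0) (at_right 0)" by (intro tendsto_intros)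
    then show "((\<lambda>s. 3 * C * s) \<longlongrightarrow> 0) (at_right 0)" by simp
  qed
  moreover have "((\<lambda>s. dir_deriv f (v + w) z - dir_deriv f v z - dir_deriv f w (z + s *\<^sub>R v)) \<longlongrightarrow>
      dir_deriv f (v + w) z - dir_deriv f v z - dir_deriv f w z) (at_right 0)"
  proof (intro tendsto_intros)
    have "isCont (dir_deriv f w) (z + 0 *\<^sub>R v)"
      using continuous_on_dir_deriv[OF f(1,2)] f(2,3) by (simp add: continuous_on_eq_continuous_at)
    then have "isCont (\<lambda>s. dir_deriv f w (z + s *\<^sub>R v)) (0::real)"
      by (rule isCont_o2[rotated]) (intro continuous_intros)
    then show "((\<lambda>s. dir_deriv f w (z + s *\<^sub>R v)) \<longlongrightarrow> dir_deriv f w z) (at_right 0)"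
      by (simp add: isCont_def tendsto_within_subset filterlim_at_split)
  qed
  ultimately have "dir_deriv f (v + w) z - dir_deriv f v z - dir_deriv f w z = 0"
    using tendsto_unique trivial_limit_at_right_real by blast
  then show ?thesis by (simp add: algebra_simps)
qed

text \<open>Additivity and homogeneity of the slice derivatives give a linear candidate, and the
  quadratic Taylor remainder is uniform over the directions; this upgrades directional to Frechet
  differentiability.\<close>

lemma line_holomorphic_has_derivative:
  assumes f: "line_holomorphic_on f S" "open S" "z \<in> S"
  shows "(f has_derivative (\<lambda>v. dir_deriv f v z)) (at z)"
proof -
  obtain r M where rM: "r > 0" "cball z (2 * r) \<subseteq> S" "\<And>y. y \<in> cball z (2 * r) \<Longrightarrow> norm (f y) \<le> M"
    using line_holomorphic_local_bound[OF f] by metis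
  have sub: "cball z r \<subseteq> S" and M: "\<And>y. y \<in> cball z r \<Longrightarrow> norm (f y) \<le> M" using rM by auto
  have bl: "bounded_linear (\<lambda>v. dir_deriv f v z)"
  proof (rule bounded_linear_intro)
    show "dir_deriv f (v + w) z = dir_deriv f v z + dir_deriv f w z" for v w by (rule dir_deriv_add[OF f])
    show "dir_deriv f (c *\<^sub>R v) z = c *\<^sub>R dir_deriv f v z" for c v
      by (simp add: scaleR_eq_cscale dir_deriv_cscale[OF f] scaleR_conv_of_real)
    show "norm (dir_deriv f v z) \<le> norm v * (M / r)" for v
      using dir_deriv_bound[OF f(1,2) rM(1) sub M, of v] by (simp add: mult.commute)
  qed
  show ?thesis unfolding has_derivative_at
  proof (intro conjI bl)
    show "(\<lambda>h. norm (f (z + h) - f z - dir_deriv f h z) / norm h) \<midarrow>0\<rightarrow> 0"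
    proof (rule Lim_null_comparison)
      have "\<forall>\<^sub>F u in at (0::complex^'a). u \<in> ball 0 (r/2)"
        using rM by (intro eventually_at_in_open') auto
      then show "\<forall>\<^sub>F h in at 0. norm (norm (f (z + h) - f z - dir_deriv f h z) / norm h) \<le> 8 * M / r ^ 2 * norm h"
      proof eventually_elim
        case (elim h)
        have "norm (f (z + h) - f z - dir_deriv f h z) \<le> 8 * M * (norm h / r) ^ 2"
          by (rule dir_deriv_remainder[OF f(1,2) rM(1) sub M]) (use elim in auto)
        also have "8 * M * (norm h / r) ^ 2 = (8 * M / r ^ 2 * norm h) * norm h"
          by (simp add: power_divide power2_eq_square)
        finally show ?case by (cases "h = 0") (simp_all add: pos_divide_le_eq)
      qed
      have "((\<lambda>h::complex^'a. 8 * M / r ^ 2 * norm h) \<longlongrightarrow> 8 * M / r ^ 2 * norm (0::complex^'a)) (at 0)" by (intro tendsto_intros)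
      then show "((\<lambda>h::complex^'a. 8 * M / r ^ 2 * norm h) \<longlongrightarrow> 0) (at 0)" by simp
    qed
  qed
qed

section \<open>Jacobians\<close>

lemma line_holomorphic_on_const: "line_holomorphic_on (\<lambda>z. c) S"
  by (simp add: line_holomorphic_on_def)

lemma line_holomorphic_on_add:
  "line_holomorphic_on f S \<Longrightarrow> line_holomorphic_on g S \<Longrightarrow> line_holomorphic_on (\<lambda>z. f z + g z) S"
  by (auto simp: line_holomorphic_on_def intro!: continuous_on_add holomorphic_on_add)

lemma line_holomorphic_on_mult:
  "line_holomorphic_on f S \<Longrightarrow> line_holomorphic_on g S \<Longrightarrow> line_holomorphic_on (\<lambda>z. f z * g z) S"
  by (auto simp: line_holomorphic_on_def intro!: continuous_on_mult holomorphic_on_mult)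

lemma line_holomorphic_on_sum:
  "(\<And>i. i \<in> A \<Longrightarrow> line_holomorphic_on (f i) S) \<Longrightarrow> line_holomorphic_on (\<lambda>z. \<Sum>i\<in>A. f i z) S"
  by (induction A rule: infinite_finite_induct) (auto intro!: line_holomorphic_on_const line_holomorphic_on_add)

lemma line_holomorphic_on_prod:
  "(\<And>i. i \<in> A \<Longrightarrow> line_holomorphic_on (f i) S) \<Longrightarrow> line_holomorphic_on (\<lambda>z. \<Prod>i\<in>A. f i z) S"
  by (induction A rule: infinite_finite_induct) (auto intro!: line_holomorphic_on_const line_holomorphic_on_mult)

lemma line_holomorphic_on_det:
  fixes A :: "complex ^ 'n \<Rightarrow> complex ^ 'm ^ 'm"
  assumes "\<And>i j. line_holomorphic_on (\<lambda>z. A z $ i $ j) S"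
  shows "line_holomorphic_on (\<lambda>z. det (A z)) S"
  unfolding det_def
  by (intro line_holomorphic_on_sum line_holomorphic_on_mult line_holomorphic_on_const line_holomorphic_on_prod assms)

lemma slice_has_field_derivative:
  fixes f :: "complex ^ 'n \<Rightarrow> complex"
  assumes f: "(f has_derivative f') (at (z + \<zeta> *s v))" and hom: "\<And>c v. f' (c *s v) = c * f' v"
  shows "((\<lambda>\<zeta>. f (z + \<zeta> *s v)) has_field_derivative f' v) (at \<zeta>)"
proof -
  have "((\<lambda>\<zeta>. z + \<zeta> *s v) has_derivative (\<lambda>h. 0 + h *s v)) (at \<zeta>)"
    by (rule has_derivative_add[OF has_derivative_const bounded_linear.has_derivative[OF bounded_linear_cscale_left has_derivative_ident]])
  from has_derivative_compose[OF this f]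
  show ?thesis by (simp add: has_field_derivative_def hom mult.commute[of _ "f' v"])
qed

lemma dir_deriv_eq:
  assumes "(f has_derivative f') (at z)" "\<And>c v. f' (c *s v) = c * f' v"
  shows "dir_deriv f v z = f' v"
  using slice_has_field_derivative[of f f' z 0 v] assms unfolding dir_deriv_def
  by (simp add: DERIV_imp_deriv)

text \<open>Built from slice derivatives of the components, so that every entry is a function of
  \<open>z\<close> to which the results on lines apply.\<close>

definition jacobian :: "(complex ^ 'n \<Rightarrow> complex ^ 'm) \<Rightarrow> complex ^ 'n \<Rightarrow> complex ^ 'n ^ 'm" where
  "jacobian F z = (\<chi> i j. dir_deriv (\<lambda>z. F z $ i) (axis j 1) z)"

lemma has_derivative_vec_component:
  fixes f :: "'a::real_normed_vector \<Rightarrow> complex ^ 'n"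
  assumes "(f has_derivative f') F"
  shows "((\<lambda>x. f x $ i) has_derivative (\<lambda>x. f' x $ i)) F"
  by (rule bounded_linear.has_derivative[OF bounded_linear_vec_nth assms])

lemma has_derivative_vecI:
  fixes f :: "'a::real_normed_vector \<Rightarrow> complex ^ 'n"
  assumes "\<And>i. ((\<lambda>x. f x $ i) has_derivative (\<lambda>x. f' x $ i)) (at x)"
  shows "(f has_derivative f') (at x)"
  unfolding has_derivative_componentwise_within[of f]
  by (auto simp: Basis_vec_def inner_axis intro!: has_derivative_inner_left assms)

lemma linear_hom_expand:
  fixes f' :: "complex ^ 'n \<Rightarrow> complex ^ 'm"
  assumes "linear f'" "\<And>c v. f' (c *s v) = c *s f' v"
  shows "f' v = (\<Sum>j\<in>UNIV. (v $ j) *s f' (axis j 1))"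
  by (subst basis_expansion[of v, symmetric]) (simp add: linear_sum[OF assms(1)] assms(2))

text \<open>A complex-linear map is determined by the vectors \<open>axis j 1\<close>, along which
  it agrees with the slice derivatives. Chain rules thereby become identities of matrices.\<close>

lemma jacobian_eqI:
  fixes F :: "complex ^ 'n \<Rightarrow> complex ^ 'm"
  assumes F: "(F has_derivative f') (at z)" and hom: "\<And>c v. f' (c *s v) = c *s f' v"
  shows "f' = (*v) (jacobian F z)"
proof
  fix v
  have "jacobian F z $ i $ j = f' (axis j 1) $ i" for i j
    unfolding jacobian_def
    using dir_deriv_eq[OF has_derivative_vec_component[OF F], of i "axis j 1"] hom by simp
  then show "f' v = jacobian F z *v v"
    by (subst linear_hom_expand[OF has_derivative_linear[OF F] hom])
       (simp add: vec_eq_iff matrix_vector_mult_def mult.commute)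
qed

lemma matrix_vector_mult_cscale: "A *v (c *s v) = c *s (A *v (v :: complex ^ 'n))"
  by (simp add: vec_eq_iff matrix_vector_mult_def sum_distrib_left mult_ac)

lemma holomorphic_map_on_jacobian:
  assumes "holomorphic_map_on F S" "z \<in> S"
  shows "(F has_derivative (*v) (jacobian F z)) (at z)"
  using assms jacobian_eqI unfolding holomorphic_map_on_def by metis

lemma holomorphic_map_on_compose:
  assumes F: "holomorphic_map_on F S" and G: "holomorphic_map_on G T" and sub: "F ` S \<subseteq> T"
  shows "holomorphic_map_on (\<lambda>z. G (F z)) S"
    and "z \<in> S \<Longrightarrow> jacobian (\<lambda>z. G (F z)) z = jacobian G (F z) ** jacobian F z"
proof -
  have *: "((\<lambda>z. G (F z)) has_derivative (*v) (jacobian G (F z) ** jacobian F z)) (at z)" if "z \<in> S" for z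
    using has_derivative_compose[OF holomorphic_map_on_jacobian[OF F that] holomorphic_map_on_jacobian[OF G, of "F z"]]
      sub that by (auto simp: matrix_vector_mul_assoc)
  show "holomorphic_map_on (\<lambda>z. G (F z)) S"
    using * unfolding holomorphic_map_on_def by (metis matrix_vector_mult_cscale)
  show "jacobian (\<lambda>z. G (F z)) z = jacobian G (F z) ** jacobian F z" if "z \<in> S"
    using jacobian_eqI[OF *[OF that] matrix_vector_mult_cscale] by (metis matrix_eq)
qed

lemma jacobian_cong:
  assumes "open S" "z \<in> S" "\<And>w. w \<in> S \<Longrightarrow> F w = G w" "holomorphic_map_on F S"
  shows "jacobian F z = jacobian G z"
proof -
  have "(G has_derivative (*v) (jacobian F z)) (at z)"
    by (rule has_derivative_transform_within_open[OF holomorphic_map_on_jacobian[OF assms(4,2)] assms(1,2,3)])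
  from jacobian_eqI[OF this matrix_vector_mult_cscale] show ?thesis by (metis matrix_eq)
qed

lemma holomorphic_map_on_matrix:
  fixes A :: "complex ^ 'n ^ 'm"
  shows "holomorphic_map_on ((*v) A) S" "jacobian ((*v) A) z = A"
proof -
  have *: "((*v) A has_derivative (*v) A) (at z)" for z
  proof (rule linear_imp_has_derivative, rule linearI)
    show "A *v (x + y) = A *v x + A *v y" for x y by (rule matrix_vector_right_distrib)
    show "A *v (c *\<^sub>R x) = c *\<^sub>R (A *v x)" for c x
      by (simp add: scaleR_eq_cscale matrix_vector_mult_cscale)
  qed
  then show "holomorphic_map_on ((*v) A) S"
    unfolding holomorphic_map_on_def by (metis matrix_vector_mult_cscale)
  show "jacobian ((*v) A) z = A"
    using jacobian_eqI[OF * matrix_vector_mult_cscale] by (metis matrix_eq)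
qed

lemma holomorphic_map_on_continuous: "holomorphic_map_on F S \<Longrightarrow> continuous_on S F"
  unfolding holomorphic_map_on_def
  by (meson continuous_at_imp_continuous_on has_derivative_continuous)

lemma holomorphic_map_on_subset: "holomorphic_map_on F S \<Longrightarrow> T \<subseteq> S \<Longrightarrow> holomorphic_map_on F T"
  unfolding holomorphic_map_on_def by blast

lemma holomorphic_map_on_component:
  assumes F: "holomorphic_map_on F S"
  shows "line_holomorphic_on (\<lambda>z. F z $ i) S"
  unfolding line_holomorphic_on_def
proof (intro conjI allI impI)
  show "continuous_on S (\<lambda>z. F z $ i)"
    by (intro continuous_intros holomorphic_map_on_continuous F)
  fix a v assume *: "\<forall>\<zeta>\<in>cball 0 1. a + \<zeta> *s v \<in> S"
  have "(\<lambda>\<zeta>. F (a + \<zeta> *s v) $ i) field_differentiable at \<zeta>" if "\<zeta> \<in> ball 0 1" for \<zeta>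
  proof -
    have "(F has_derivative (*v) (jacobian F (a + \<zeta> *s v))) (at (a + \<zeta> *s v))"
      by (rule holomorphic_map_on_jacobian[OF F]) (use * that in auto)
    from has_derivative_vec_component[OF this, of i]
    have "((\<lambda>\<zeta>. F (a + \<zeta> *s v) $ i) has_field_derivative (jacobian F (a + \<zeta> *s v) *v v) $ i) (at \<zeta>)"
      by (rule slice_has_field_derivative) (simp add: matrix_vector_mult_cscale)
    then show ?thesis by (auto simp: field_differentiable_def)
  qed
  then show "(\<lambda>\<zeta>. F (a + \<zeta> *s v) $ i) holomorphic_on ball 0 1"
    by (auto simp: holomorphic_on_def intro: field_differentiable_at_within)
qed

text \<open>Together with \<open>holomorphic_map_on_component\<close> this is the passage between
  holomorphic maps and components holomorphic on lines.\<close>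

lemma holomorphic_map_onI:
  assumes S: "open S" and F: "\<And>i. line_holomorphic_on (\<lambda>z. F z $ i) S"
  shows "holomorphic_map_on F S"
  unfolding holomorphic_map_on_def
proof
  fix z assume z: "z \<in> S"
  have "(F has_derivative (\<lambda>v. \<chi> i. dir_deriv (\<lambda>z. F z $ i) v z)) (at z)"
    by (rule has_derivative_vecI) (simp add: line_holomorphic_has_derivative[OF F S z])
  moreover have "(\<chi> i. dir_deriv (\<lambda>z. F z $ i) (c *s v) z) = c *s (\<chi> i. dir_deriv (\<lambda>z. F z $ i) v z)" for c v
    by (simp add: vec_eq_iff dir_deriv_cscale[OF F S z])
  ultimately show "\<exists>f'. (F has_derivative f') (at z) \<and> (\<forall>c v. f' (c *s v) = c *s f' v)"
    by blast
qed

lemma compact_nbhd: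
  fixes K :: "'a::heine_borel set"
  assumes "compact K" "open S" "K \<subseteq> S"
  obtains r where "r > 0" "\<And>y. y \<in> K \<Longrightarrow> cball y r \<subseteq> S" "compact (\<Union>y\<in>K. cball y r)" 
proof -
  obtain e where e: "e > 0" "(\<Union>x\<in>K. cball x e) \<subseteq> S"
    using compact_subset_open_imp_cball_epsilon_subset[OF assms] by blast
  have "compact (\<Union>x\<in>K. cball x e)"
  proof (cases "K = {}")
    case False
    \<comment> \<open>The closed neighbourhood is a sublevel set of the distance to
      \<open>K\<close>, which is attained because \<open>K\<close> is closed. The empty set is kept
      apart since \<open>infdist\<close> to it is 0.\<close>
    have eq: "(\<Union>x\<in>K. cball x e) = {y. infdist y K \<le> e}"
    proof safe
      fix x y assume "x \<in> K" "y \<in> cball x e"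
      then show "infdist y K \<le> e" using infdist_le[of x K y] by (simp add: dist_commute)
    next
      fix y assume "infdist y K \<le> e"
      moreover obtain x where "x \<in> K" "infdist y K = dist y x"
        using infdist_attains_inf[OF compact_imp_closed[OF assms(1)] False] by blast
      ultimately show "y \<in> (\<Union>x\<in>K. cball x e)" by (auto simp: dist_commute)
    qed
    show ?thesis unfolding eq using compact_infdist_le[OF False assms(1) e(1)] by simp
  qed auto
  then show ?thesis using that[of e] e by blast
qed

text \<open>On a disc the derivative in the direction \<open>w\<close> is a uniform limit of
  difference quotients, which are holomorphic along the disc: the Taylor remainder is uniform over a
  compact neighbourhood of it. Through this lemma Jacobian determinants become holomorphic on lines
  and open to Hurwitz' theorem.\<close>

lemma line_holomorphic_on_dir_deriv:
  assumes f: "line_holomorphic_on f S" "open S"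
  shows "line_holomorphic_on (dir_deriv f w) S"
  unfolding line_holomorphic_on_def
proof (intro conjI allI impI)
  show "continuous_on S (dir_deriv f w)" by (rule continuous_on_dir_deriv[OF f])
  fix a v assume av: "\<forall>\<zeta>\<in>cball 0 1. a + \<zeta> *s v \<in> S"
  define K where "K = (\<lambda>\<zeta>. a + \<zeta> *s v) ` cball 0 1"
  have K: "compact K" unfolding K_def
    by (intro compact_continuous_image continuous_intros) auto
  have KS: "K \<subseteq> S" using av by (auto simp: K_def)
  obtain r where r: "r > 0" "\<And>y. y \<in> K \<Longrightarrow> cball y r \<subseteq> S" "compact (\<Union>y\<in>K. cball y r)"
    using compact_nbhd[OF K f(2) KS] by blast
  have "(\<Union>y\<in>K. cball y r) \<subseteq> S" using r by blast
  then have "bounded (f ` (\<Union>y\<in>K. cball y r))"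
    by (intro compact_imp_bounded compact_continuous_image r) (meson f continuous_on_subset line_holomorphic_on_def)
  then obtain M where M: "\<And>x y. y \<in> K \<Longrightarrow> x \<in> cball y r \<Longrightarrow> norm (f x) \<le> M"
    unfolding bounded_iff by blast
  define e where "e = r / (2 * (norm w + 1))"
  have e: "e > 0" using r by (simp add: e_def add_nonneg_pos)
  have ew: "e * norm w \<le> r / 2" using r by (simp add: e_def divide_simps add_nonneg_pos)
  define t where "t = (\<lambda>m. e / Suc m)"
  have t: "t m > 0" "t m \<le> e" for m using e by (auto simp: t_def divide_simps)
  define q where "q = (\<lambda>m \<zeta>. (f (a + \<zeta> *s v + t m *\<^sub>R w) - f (a + \<zeta> *s v)) / of_real (t m))"
  have small: "norm (t m *\<^sub>R w) \<le> r / 2" for m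
    using t[of m] mult_right_mono[of "t m" e "norm w"] ew by simp
  show "(\<lambda>\<zeta>. dir_deriv f w (a + \<zeta> *s v)) holomorphic_on ball 0 1"
  proof (rule holomorphic_uniform_sequence[where f=q])
    fix m
    have "(\<lambda>\<zeta>. f ((a + t m *\<^sub>R w) + \<zeta> *s v)) holomorphic_on ball 0 1"
    proof (rule line_holomorphic_onD_slice[OF f(1)])
      fix \<zeta> :: complex assume "norm \<zeta> \<le> 1"
      then have "a + \<zeta> *s v \<in> K" by (auto simp: K_def)
      moreover have "a + t m *\<^sub>R w + \<zeta> *s v \<in> cball (a + \<zeta> *s v) r"
        using small[of m] r(1) by (simp add: dist_norm)
      ultimately show "a + t m *\<^sub>R w + \<zeta> *s v \<in> S" using r(2) by blast
    qed
    moreover have "(\<lambda>\<zeta>. f (a + \<zeta> *s v)) holomorphic_on ball 0 1"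
      by (rule line_holomorphic_onD_slice[OF f(1)]) (use av in auto)
    ultimately show "q m holomorphic_on ball 0 1"
      unfolding q_def using t[of m] by (intro holomorphic_intros) (auto simp: add_ac)
  next
    fix x :: complex assume x: "x \<in> ball 0 1"
    have ul: "uniform_limit (ball 0 1) q (\<lambda>\<zeta>. dir_deriv f w (a + \<zeta> *s v)) sequentially"
    proof (rule uniform_limitI)
      fix \<epsilon> :: real assume \<epsilon>: "\<epsilon> > 0"
      define C where "C = 8 * M * (norm w / r) ^ 2"
      have est: "norm (q m \<zeta> - dir_deriv f w (a + \<zeta> *s v)) \<le> C * t m" if "\<zeta> \<in> ball 0 1" for m \<zeta>
      proof -
        have y: "a + \<zeta> *s v \<in> K" using that by (auto simp: K_def)
        have "norm (f (a + \<zeta> *s v + t m *\<^sub>R w) - f (a + \<zeta> *s v) - dir_deriv f (t m *\<^sub>R w) (a + \<zeta> *s v)) 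
            \<le> 8 * M * (norm (t m *\<^sub>R w) / r) ^ 2"
          by (rule dir_deriv_remainder[OF f r(1) r(2)[OF y] M[OF y] small])
        also have "\<dots> = (C * t m) * t m" using t[of m] by (simp add: C_def power2_eq_square power_mult_distrib)
        also have "dir_deriv f (t m *\<^sub>R w) (a + \<zeta> *s v) = of_real (t m) * dir_deriv f w (a + \<zeta> *s v)"
          unfolding scaleR_eq_cscale by (rule dir_deriv_cscale[OF f]) (use y KS in blast)
        also have "f (a + \<zeta> *s v + t m *\<^sub>R w) - f (a + \<zeta> *s v) - of_real (t m) * dir_deriv f w (a + \<zeta> *s v)
            = (q m \<zeta> - dir_deriv f w (a + \<zeta> *s v)) * of_real (t m)"
          using t[of m] by (simp add: q_def field_simps)
        finally show ?thesis using t[of m] by (simp add: norm_mult)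
      qed
      have "(\<lambda>m. C * (e * (1 / real (Suc m)))) \<longlonglongrightarrow> C * (e * 0)"
        by (intro tendsto_intros lim_1_over_n[THEN LIMSEQ_Suc])
      then have "\<forall>\<^sub>F m in sequentially. C * (e * (1 / real (Suc m))) < \<epsilon>"
        using \<epsilon> by (intro order_tendstoD(2)) auto
      then show "\<forall>\<^sub>F m in sequentially. \<forall>\<zeta>\<in>ball 0 1. dist (q m \<zeta>) (dir_deriv f w (a + \<zeta> *s v)) < \<epsilon>"
      proof eventually_elim
        case (elim m)
        then show ?case using est[of _ m] by (force simp: dist_norm t_def)
      qed
    qed
    obtain d where "d > 0" "cball x d \<subseteq> ball 0 1" 
      using x open_contains_cball[of "ball (0::complex) 1"] open_ball by blast
    then show "\<exists>d>0. cball x d \<subseteq> ball 0 1 \<and> uniform_limit (cball x d) q (\<lambda>\<zeta>. dir_deriv f w (a + \<zeta> *s v)) sequentially"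
      using uniform_limit_on_subset[OF ul] by blast
  qed simp
qed

lemma line_holomorphic_on_jacobian:
  assumes "holomorphic_map_on F S" "open S"
  shows "line_holomorphic_on (\<lambda>z. jacobian F z $ i $ j) S"
  unfolding jacobian_def using line_holomorphic_on_dir_deriv[OF holomorphic_map_on_component[OF assms(1)] assms(2)]
  by simp

lemma line_holomorphic_on_det_jacobian:
  fixes F :: "complex ^ 'n \<Rightarrow> complex ^ 'n"
  assumes "holomorphic_map_on F S" "open S"
  shows "line_holomorphic_on (\<lambda>z. det (jacobian F z)) S"
  by (intro line_holomorphic_on_det line_holomorphic_on_jacobian assms)

section \<open>Limits of holomorphic maps\<close>

text \<open>Stated with one closed ball about each point instead of all compact subsets, since every
  argument below is local.\<close>

definition locally_uniform_limit ::
    "(complex ^ 'n) set \<Rightarrow> (nat \<Rightarrow> complex ^ 'n \<Rightarrow> 'b::metric_space) \<Rightarrow> (complex ^ 'n \<Rightarrow> 'b) \<Rightarrow> bool" where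
  "locally_uniform_limit S F f \<longleftrightarrow>
     (\<forall>z\<in>S. \<exists>r>0. cball z r \<subseteq> S \<and> uniform_limit (cball z r) F f sequentially)"

lemma locally_uniform_limitE:
  assumes "locally_uniform_limit S F f" "z \<in> S"
  obtains r where "r > 0" "cball z r \<subseteq> S" "uniform_limit (cball z r) F f sequentially"
  using assms unfolding locally_uniform_limit_def by blast

lemma locally_uniform_limit_pointwise:
  assumes "locally_uniform_limit S F f" "z \<in> S"
  shows "(\<lambda>k. F k z) \<longlonglongrightarrow> f z"
proof -
  obtain r where r: "r > 0" "cball z r \<subseteq> S" "uniform_limit (cball z r) F f sequentially"
    using locally_uniform_limitE[OF assms] .
  show ?thesis by (rule tendsto_uniform_limitI[OF r(3)]) (use r in auto)
qed

lemma locally_uniform_limit_continuous: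
  assumes "locally_uniform_limit S F f" "\<And>k. continuous_on S (F k)"
  shows "continuous_on S f"
proof (rule continuous_at_imp_continuous_on, rule ballI)
  fix z assume "z \<in> S"
  then obtain r where r: "r > 0" "cball z r \<subseteq> S" "uniform_limit (cball z r) F f sequentially"
    using locally_uniform_limitE[OF assms(1)] by blast
  have "continuous_on (cball z r) f"
    by (rule uniform_limit_theorem[OF _ r(3)])
       (use continuous_on_subset[OF assms(2) r(2)] in \<open>auto intro!: always_eventually\<close>)
  then show "isCont f z"
    using r(1) by (simp add: continuous_on_interior)
qed

lemma locally_uniform_limit_subseq:
  assumes "locally_uniform_limit S F f" "strict_mono \<sigma>"
  shows "locally_uniform_limit S (\<lambda>k. F (\<sigma> k)) f"
  unfolding locally_uniform_limit_def
proof
  fix z assume "z \<in> S"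
  then obtain r where r: "r > 0" "cball z r \<subseteq> S" "uniform_limit (cball z r) F f sequentially"
    using locally_uniform_limitE[OF assms(1)] by blast
  have "uniform_limit (cball z r) (\<lambda>k. F (\<sigma> k)) f sequentially"
    by (rule filterlim_compose[OF r(3) filterlim_subseq[OF assms(2)]])
  then show "\<exists>r>0. cball z r \<subseteq> S \<and> uniform_limit (cball z r) (\<lambda>k. F (\<sigma> k)) f sequentially"
    using r by blast
qed

lemma line_holomorphic_on_limit:
  assumes F: "\<And>k. line_holomorphic_on (F k) S" and lim: "locally_uniform_limit S F f"
  shows "line_holomorphic_on f S"
  unfolding line_holomorphic_on_def
proof (intro conjI allI impI)
  show "continuous_on S f"
    by (rule locally_uniform_limit_continuous[OF lim]) (use F in \<open>simp add: line_holomorphic_on_def\<close>)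
  fix a v assume av: "\<forall>\<zeta>\<in>cball 0 1. a + \<zeta> *s v \<in> S"
  show "(\<lambda>\<zeta>. f (a + \<zeta> *s v)) holomorphic_on ball 0 1"
  proof (rule holomorphic_uniform_sequence[where f="\<lambda>k \<zeta>. F k (a + \<zeta> *s v)"])
    show "(\<lambda>\<zeta>. F k (a + \<zeta> *s v)) holomorphic_on ball 0 1" for k
      by (rule line_holomorphic_onD_slice[OF F]) (use av in auto)
    fix x :: complex assume x: "x \<in> ball 0 1"
    then have "a + x *s v \<in> S" using av by simp
    then obtain r where r: "r > 0" "uniform_limit (cball (a + x *s v) r) F f sequentially"
      using locally_uniform_limitE[OF lim] by blast
    obtain d where d: "d > 0" "cball x d \<subseteq> ball 0 1"
      using x open_contains_cball[of "ball (0::complex) 1"] open_ball by blast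
    define e where "e = min d (r / (norm v + 1))"
    have e: "e > 0" "e \<le> d" "e * norm v \<le> r"
    proof -
      have "e * norm v \<le> r / (norm v + 1) * norm v" by (rule mult_right_mono) (auto simp: e_def)
      also have "\<dots> \<le> r" using r(1) by (simp add: divide_simps add_nonneg_pos)
      finally show "e * norm v \<le> r" .
    qed (use d r in \<open>auto simp: e_def add_nonneg_pos\<close>)
    have "uniform_limit (cball x e) (\<lambda>k \<zeta>. F k (a + \<zeta> *s v)) (\<lambda>\<zeta>. f (a + \<zeta> *s v)) sequentially"
    proof (rule uniform_limit_compose'[OF r(2)], rule Pi_I)
      fix \<zeta> assume "\<zeta> \<in> cball x e"
      then have "norm (x - \<zeta>) * norm v \<le> e * norm v" by (intro mult_right_mono) (auto simp: dist_norm)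
      moreover have "a + x *s v - (a + \<zeta> *s v) = (x - \<zeta>) *s v" by (simp add: vec_eq_iff algebra_simps)
      ultimately show "a + \<zeta> *s v \<in> cball (a + x *s v) r" using e(3)
        by (metis dist_norm mem_cball norm_cscale order_trans)
    qed
    moreover have "cball x e \<subseteq> ball 0 1" using d e by (meson subset_cball subset_trans)
    ultimately show "\<exists>d>0. cball x d \<subseteq> ball 0 1 \<and> uniform_limit (cball x d) (\<lambda>k \<zeta>. F k (a + \<zeta> *s v)) (\<lambda>\<zeta>. f (a + \<zeta> *s v)) sequentially"
      using e by blast
  qed simp
qed

text \<open>Cauchy's estimate for \<open>F k - f\<close> on balls of half the radius turns uniform
  closeness of functions into uniform closeness of derivatives.\<close>

lemma locally_uniform_limit_dir_deriv:
  assumes F: "\<And>k. line_holomorphic_on (F k) S" and S: "open S" and lim: "locally_uniform_limit S F f"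
  shows "locally_uniform_limit S (\<lambda>k. dir_deriv (F k) v) (dir_deriv f v)"
  unfolding locally_uniform_limit_def
proof
  fix z assume "z \<in> S"
  then obtain r where r: "r > 0" "cball z r \<subseteq> S" "uniform_limit (cball z r) F f sequentially"
    using locally_uniform_limitE[OF lim] by blast
  have f: "line_holomorphic_on f S" by (rule line_holomorphic_on_limit[OF F lim])
  have sub: "cball y (r/2) \<subseteq> cball z r" if "y \<in> cball z (r/2)" for y
    using that r by (simp add: cball_subset_cball_iff dist_commute)
  have "uniform_limit (cball z (r/2)) (\<lambda>k. dir_deriv (F k) v) (dir_deriv f v) sequentially"
  proof (rule uniform_limitI)
    fix \<epsilon> :: real assume \<epsilon>: "\<epsilon> > 0"
    define e where "e = \<epsilon> * (r/2) / (norm v + 1)"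
    have e: "e > 0" using \<epsilon> r by (simp add: e_def add_nonneg_pos)
    have ev: "e * (norm v / (r/2)) < \<epsilon>" using \<epsilon> r(1) by (simp add: e_def divide_simps add_nonneg_pos)
    have ev_k: "\<forall>\<^sub>F k in sequentially. \<forall>y\<in>cball z r. dist (F k y) (f y) < e" by (rule uniform_limitD[OF r(3) e])
    show "\<forall>\<^sub>F k in sequentially. \<forall>y\<in>cball z (r/2). dist (dir_deriv (F k) v y) (dir_deriv f v y) < \<epsilon>"
    proof (rule eventually_mono[OF ev_k], rule ballI)
      fix k y assume k: "\<forall>y\<in>cball z r. dist (F k y) (f y) < e" and y: "y \<in> cball z (r/2)"
      have "cball y (r/2) \<subseteq> S" using sub[OF y] r(2) by blast
      then have yS: "y \<in> S" using r(1) by (auto simp: subset_iff)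
      have "norm (dir_deriv (\<lambda>w. F k w - f w) v y) \<le> e * (norm v / (r/2))"
        by (rule dir_deriv_bound[OF line_holomorphic_on_diff[OF F f] S _ \<open>cball y (r/2) \<subseteq> S\<close>])
           (use k sub[OF y] r in \<open>auto simp: dist_norm subset_iff intro: less_imp_le\<close>)
      moreover have "dir_deriv (\<lambda>w. F k w - f w) v y = dir_deriv (F k) v y - dir_deriv f v y"
        using line_holomorphic_slice_differentiable[OF F S yS] line_holomorphic_slice_differentiable[OF f S yS]
        by (simp add: dir_deriv_def deriv_diff)
      ultimately show "dist (dir_deriv (F k) v y) (dir_deriv f v y) < \<epsilon>" using ev by (simp add: dist_norm)
    qed
  qed
  moreover have "cball z (r/2) \<subseteq> S" 
    using r(1) by (intro order_trans[OF subset_cball r(2)]) simp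
  ultimately show "\<exists>r>0. cball z r \<subseteq> S \<and> uniform_limit (cball z r) (\<lambda>k. dir_deriv (F k) v) (dir_deriv f v) sequentially"
    using r(1) by (intro exI[of _ "r/2"]) auto
qed

section \<open>Limits of vector- and matrix-valued maps\<close>

lemma norm_vec_le_sum: "norm (v :: 'a::real_normed_vector ^ 'n) \<le> (\<Sum>i\<in>UNIV. norm (v $ i))"
  by (simp add: norm_vec_def L2_set_le_sum)

lemma uniform_limit_vecI:
  fixes f :: "'c \<Rightarrow> 'b \<Rightarrow> 'a::real_normed_vector ^ 'n"
  assumes "\<And>i. uniform_limit A (\<lambda>k x. f k x $ i) (\<lambda>x. g x $ i) F"
  shows "uniform_limit A f g F"
proof (rule uniform_limitI)
  fix e :: real assume e: "e > 0"
  define d where "d = e / (real CARD('n) + 1)"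
  have d: "d > 0" using e by (simp add: d_def add_nonneg_pos)
  have ev_k: "\<forall>\<^sub>F k in F. \<forall>i. \<forall>x\<in>A. dist (f k x $ i) (g x $ i) < d"
    by (intro eventually_all_finite uniform_limitD[OF assms d])
  show "\<forall>\<^sub>F k in F. \<forall>x\<in>A. dist (f k x) (g x) < e"
  proof (rule eventually_mono[OF ev_k], rule ballI)
    fix k x assume k: "\<forall>i. \<forall>x\<in>A. dist (f k x $ i) (g x $ i) < d" and x: "x \<in> A"
    have "dist (f k x) (g x) \<le> (\<Sum>i\<in>UNIV. norm ((f k x - g x) $ i))"
      unfolding dist_norm by (rule norm_vec_le_sum)
    also have "\<dots> \<le> (\<Sum>i\<in>(UNIV::'n set). d)"
      using k x by (intro sum_mono) (auto simp: dist_norm intro: less_imp_le)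
    also have "\<dots> < e" using e by (simp add: d_def divide_simps add_nonneg_pos)
    finally show "dist (f k x) (g x) < e" .
  qed
qed

lemma uniform_limit_vec_nth:
  fixes f :: "'c \<Rightarrow> 'b \<Rightarrow> 'a::real_normed_vector ^ 'n"
  assumes "uniform_limit A f g F"
  shows "uniform_limit A (\<lambda>k x. f k x $ i) (\<lambda>x. g x $ i) F"
  by (rule bounded_linear.uniform_limit[OF bounded_linear_vec_nth assms])

lemma continuous_on_det_complex: "continuous_on A (\<lambda>x::complex ^ 'n ^ 'n. det x)"
  unfolding det_def by (intro continuous_intros)

text \<open>The determinant is uniformly continuous on bounded sets: the limit is bounded by
  \<open>R\<close> on the compact set \<open>K\<close>, hence the sequence eventually by
  \<open>R + 1\<close>.\<close>

lemma uniform_limit_det: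
  fixes A :: "nat \<Rightarrow> 'b::metric_space \<Rightarrow> complex ^ 'n ^ 'n"
  assumes lim: "uniform_limit K A B sequentially" and K: "compact K" and B: "continuous_on K B"
  shows "uniform_limit K (\<lambda>k x. det (A k x)) (\<lambda>x. det (B x)) sequentially"
proof -
  have "bounded (B ` K)" by (intro compact_imp_bounded compact_continuous_image B K)
  then obtain R where R: "\<And>x. x \<in> K \<Longrightarrow> norm (B x) \<le> R" unfolding bounded_iff by blast
  show ?thesis
  proof (rule uniform_limit_compose_uniformly_continuous_on[OF lim, where B="cball 0 (R + 1)"])
    show "uniformly_continuous_on (cball 0 (R + 1)) (det :: complex ^ 'n ^ 'n \<Rightarrow> complex)"
      by (intro compact_uniformly_continuous continuous_on_det_complex) auto
    have ev_k: "\<forall>\<^sub>F k in sequentially. \<forall>x\<in>K. dist (A k x) (B x) < 1" by (rule uniform_limitD[OF lim]) simp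
    show "\<forall>\<^sub>F k in sequentially. \<forall>x\<in>K. A k x \<in> cball 0 (R + 1)"
    proof (rule eventually_mono[OF ev_k], rule ballI)
      fix k x assume "\<forall>x\<in>K. dist (A k x) (B x) < 1" "x \<in> K"
      then show "A k x \<in> cball 0 (R + 1)"
        using R[of x] norm_triangle_sub[of "A k x" "B x"] by (force simp: dist_norm)
    qed
  qed auto
qed

lemma holomorphic_map_on_limit:
  fixes F :: "nat \<Rightarrow> complex ^ 'n \<Rightarrow> complex ^ 'm"
  assumes F: "\<And>k. holomorphic_map_on (F k) S" and S: "open S" and lim: "locally_uniform_limit S F f"
  shows "holomorphic_map_on f S"
    and "locally_uniform_limit S (\<lambda>k. jacobian (F k)) (jacobian f)"
proof -
  have comp: "locally_uniform_limit S (\<lambda>k z. F k z $ i) (\<lambda>z. f z $ i)" for i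
    using lim uniform_limit_vec_nth unfolding locally_uniform_limit_def by blast
  note hF = holomorphic_map_on_component[OF F]
  show f: "holomorphic_map_on f S"
    by (intro holomorphic_map_onI S line_holomorphic_on_limit[OF hF comp])
  show "locally_uniform_limit S (\<lambda>k. jacobian (F k)) (jacobian f)"
    unfolding locally_uniform_limit_def
  proof
    fix z assume z: "z \<in> S"
    have "\<exists>r>0. cball z r \<subseteq> S \<and> uniform_limit (cball z r) (\<lambda>k z. jacobian (F k) z $ i $ j) (\<lambda>z. jacobian f z $ i $ j) sequentially" for i j
      using locally_uniform_limitE[OF locally_uniform_limit_dir_deriv[OF hF S comp] z, of i "axis j 1"]
      unfolding jacobian_def by (simp, metis)
    then obtain r where r: "\<And>i j. r i j > 0" "\<And>i j. cball z (r i j) \<subseteq> S"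
      "\<And>i j. uniform_limit (cball z (r i j)) (\<lambda>k z. jacobian (F k) z $ i $ j) (\<lambda>z. jacobian f z $ i $ j) sequentially"
      by metis
    \<comment> \<open>Each entry converges on a ball of its own; finitely many entries leave a
      common radius.\<close>
    define s where "s = Min (range (\<lambda>(i, j). r i j))"
    have s: "s \<le> r i j" for i j unfolding s_def by (rule Min_le) (auto intro: rev_image_eqI[of "(i,j)"])
    have "s > 0" unfolding s_def using r(1) by (subst Min_gr_iff) auto
    moreover have "cball z s \<subseteq> S" using r(2) s subset_cball by blast
    moreover have "uniform_limit (cball z s) (\<lambda>k. jacobian (F k)) (jacobian f) sequentially"
      by (intro uniform_limit_vecI uniform_limit_on_subset[OF r(3)] subset_cball s)
    ultimately show "\<exists>r>0. cball z r \<subseteq> S \<and> uniform_limit (cball z r) (\<lambda>k. jacobian (F k)) (jacobian f) sequentially"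
      by blast
  qed
qed

lemma continuous_on_jacobian:
  assumes "holomorphic_map_on F S" "open S"
  shows "continuous_on S (jacobian F)"
proof -
  have "continuous_on S (\<lambda>z. \<chi> i. \<chi> j. jacobian F z $ i $ j)"
    using line_holomorphic_on_jacobian[OF assms]
    by (intro continuous_on_vec_lambda) (simp add: line_holomorphic_on_def)
  then show ?thesis by simp
qed

lemma locally_uniform_limit_det_jacobian:
  fixes F :: "nat \<Rightarrow> complex ^ 'n \<Rightarrow> complex ^ 'n"
  assumes F: "\<And>k. holomorphic_map_on (F k) S" and S: "open S" and lim: "locally_uniform_limit S F f"
  shows "locally_uniform_limit S (\<lambda>k z. det (jacobian (F k) z)) (\<lambda>z. det (jacobian f z))"
  unfolding locally_uniform_limit_def
proof
  note f = holomorphic_map_on_limit[OF F S lim]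
  fix z assume "z \<in> S"
  then obtain r where r: "r > 0" "cball z r \<subseteq> S" "uniform_limit (cball z r) (\<lambda>k. jacobian (F k)) (jacobian f) sequentially"
    using locally_uniform_limitE[OF f(2)] by blast
  have "uniform_limit (cball z r) (\<lambda>k z. det (jacobian (F k) z)) (\<lambda>z. det (jacobian f z)) sequentially"
    by (rule uniform_limit_det[OF r(3)]) (use r(2) continuous_on_subset[OF continuous_on_jacobian[OF f(1) S]] in auto)
  then show "\<exists>r>0. cball z r \<subseteq> S \<and> uniform_limit (cball z r) (\<lambda>k z. det (jacobian (F k) z)) (\<lambda>z. det (jacobian f z)) sequentially"
    using r by blast
qed

text \<open>The zero set of \<open>f\<close> is relatively closed, and open by the theorem in one
  variable: on a complex line through a zero, the limit of the zero-free slices must be constant,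
  hence 0. Connectedness and \<open>f x \<noteq> 0\<close> then exclude zeros.\<close>

lemma hurwitz_nonvanishing:
  assumes S: "open S" "connected S" and F: "\<And>k. line_holomorphic_on (F k) S"
    and nz: "\<And>k z. z \<in> S \<Longrightarrow> F k z \<noteq> 0" and lim: "locally_uniform_limit S F f"
    and x: "x \<in> S" "f x \<noteq> 0" and z: "z \<in> S"
  shows "f z \<noteq> 0"
proof
  assume fz: "f z = 0"
  have f: "line_holomorphic_on f S" by (rule line_holomorphic_on_limit[OF F lim])
  have "continuous_on S f" using f by (simp add: line_holomorphic_on_def)
  then have o1: "open (S \<inter> f -` (- {0}))" by (rule continuous_open_preimage[OF _ S(1)]) auto
  have o2: "open (S \<inter> f -` {0})"
    unfolding open_contains_ball
  proof
    fix a assume "a \<in> S \<inter> f -` {0}"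
    then have a: "a \<in> S" "f a = 0" by auto
    obtain r where r: "r > 0" "cball a r \<subseteq> S" "uniform_limit (cball a r) F f sequentially"
      using locally_uniform_limitE[OF lim a(1)] by blast
    have "f w = 0" if w: "w \<in> ball a r" for w
    proof (cases "w = a")
      case False
      \<comment> \<open>With this scaling the unit disc in the direction \<open>v\<close> reaches
        the boundary of the ball, and \<open>w\<close> sits at the interior parameter
        \<open>t\<close>.\<close>
      define t where "t = norm (w - a) / r"
      define v where "v = of_real (1 / t) *s (w - a)"
      have t: "t > 0" "t < 1" using w r False by (auto simp: t_def dist_norm norm_minus_commute)
      have wv: "w = a + of_real t *s v" using t by (simp add: v_def)
      have nv: "norm v = r" unfolding v_def norm_cscale using False r(1) by (simp add: t_def norm_divide)
      have inb: "a + \<zeta> *s v \<in> cball a r" if "norm \<zeta> \<le> 1" for \<zeta>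
        using that mult_right_mono[of "norm \<zeta>" 1 r] r by (simp add: dist_norm norm_cscale nv)
      then have inS: "a + \<zeta> *s v \<in> S" if "norm \<zeta> \<le> 1" for \<zeta> using that r by blast
      have "(\<lambda>\<zeta>. f (a + \<zeta> *s v)) constant_on ball 0 1"
      proof (rule ccontr)
        assume nc: "\<not> (\<lambda>\<zeta>. f (a + \<zeta> *s v)) constant_on ball 0 1"
        have "(\<lambda>\<zeta>. f (a + \<zeta> *s v)) 0 \<noteq> 0"
        proof (rule Hurwitz_no_zeros[where S="ball 0 1" and \<F>="\<lambda>k \<zeta>. F k (a + \<zeta> *s v)" and g="\<lambda>\<zeta>. f (a + \<zeta> *s v)" and ?z0.0=0])
          show "(\<lambda>\<zeta>. F k (a + \<zeta> *s v)) holomorphic_on ball 0 1" for k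
            by (rule line_holomorphic_onD_slice[OF F inS])
          show "(\<lambda>\<zeta>. f (a + \<zeta> *s v)) holomorphic_on ball 0 1"
            by (rule line_holomorphic_onD_slice[OF f inS])
          show "uniform_limit K (\<lambda>k \<zeta>. F k (a + \<zeta> *s v)) (\<lambda>\<zeta>. f (a + \<zeta> *s v)) sequentially" 
            if "compact K" "K \<subseteq> ball 0 1" for K
            using that inb by (intro uniform_limit_compose'[OF r(3)]) force
          show "F k (a + \<zeta> *s v) \<noteq> 0" if "\<zeta> \<in> ball 0 1" for k \<zeta>
            using that by (intro nz inS) auto
        qed (use nc in auto)
        then show False using a(2) by simp
      qed
      then obtain c where c: "\<And>\<zeta>. norm \<zeta> < 1 \<Longrightarrow> f (a + \<zeta> *s v) = c" unfolding constant_on_def by auto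
      have "f w = f (a + 0 *s v)" unfolding wv using c[of "of_real t"] c[of 0] t by simp
      then show "f w = 0" using a by simp
    qed (use a in simp)
    then show "\<exists>e>0. ball a e \<subseteq> S \<inter> f -` {0}" using r by (intro exI[of _ r]) auto
  qed
  show False using connectedD[OF S(2) o1 o2] x z fz by auto
qed

text \<open>A connectedness argument in place of degree theory.\<close>
lemma ball_subset_image_eventually:
  fixes F :: "nat \<Rightarrow> complex ^ 'n \<Rightarrow> complex ^ 'n"
  assumes S: "open S" and F: "\<And>k. continuous_on S (F k)" "\<And>k. inj_on (F k) S"
    and lim: "locally_uniform_limit S F f" and z: "z \<in> S"
    and f: "(f has_derivative (*v) A) (at z)" and A: "det A \<noteq> 0" and e: "e > 0"
  obtains d where "d > 0" "\<forall>\<^sub>F k in sequentially. ball (f z) d \<subseteq> F k ` (S \<inter> ball z e)"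
proof -
  have lin: "linear ((*v) A)" by (rule has_derivative_linear[OF f])
  have "inj ((*v) A)"
    using A by (metis invertible_det_nz invertible_left_inverse matrix_left_invertible_injective)
  then obtain B where B: "B > 0" "\<And>v. B * norm v \<le> norm (A *v v)"
    using linear_inj_bounded_below_pos[OF lin] by blast
  obtain d where d: "d > 0" "\<And>y. norm (y - z) < d \<Longrightarrow> norm (f y - f z - A *v (y - z)) \<le> B / 2 * norm (y - z)"
    using f B(1) unfolding has_derivative_at_alt by (meson half_gt_zero)
  obtain r where r: "r > 0" "cball z r \<subseteq> S" "uniform_limit (cball z r) F f sequentially"
    using locally_uniform_limitE[OF lim z] by blast
  define s where "s = min r (min (d / 2) (e / 2))"
  have s: "s > 0" "s \<le> r" "s < d" "s < e" using r d e by (auto simp: s_def)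
  \<comment> \<open>Half of the lower bound \<open>B\<close> for the linear part is given up to the
    linearization error; on the sphere of radius \<open>s\<close> the values of \<open>f\<close>
    thus keep distance \<open>m\<close> from \<open>f z\<close>.\<close>
  define m where "m = B / 2 * s"
  have m: "m > 0" using B s by (simp add: m_def)
  have low: "m \<le> norm (f y - f z)" if "norm (y - z) = s" for y
  proof -
    have "B * s \<le> norm (A *v (y - z))" using B(2)[of "y - z"] that by simp
    also have "\<dots> \<le> norm (f y - f z) + norm (f y - f z - A *v (y - z))"
      using norm_triangle_ineq4[of "f y - f z" "f y - f z - A *v (y - z)"] by simp
    also have "norm (f y - f z - A *v (y - z)) \<le> B / 2 * s" using d(2)[of y] that s by simp
    finally show ?thesis by (simp add: m_def)
  qed
  have sub: "cball z s \<subseteq> S" "ball z s \<subseteq> S" "ball z s \<subseteq> S \<inter> ball z e" using r s by (auto simp: subset_iff)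
  have "\<forall>\<^sub>F k in sequentially. \<forall>y\<in>cball z r. dist (F k y) (f y) < m / 3"
    by (rule uniform_limitD[OF r(3)]) (use m in auto)
  then have "\<forall>\<^sub>F k in sequentially. ball (f z) (m / 3) \<subseteq> F k ` (S \<inter> ball z e)"
  proof eventually_elim
    fix k assume k: "\<forall>y\<in>cball z r. dist (F k y) (f y) < m / 3"
    let ?B = "ball (f z) (m / 3)"
    have o1: "open (F k ` ball z s)"
      by (rule invariance_of_domain) (use continuous_on_subset[OF F(1) sub(2)] inj_on_subset[OF F(2) sub(2)] in auto)
    have "compact (F k ` cball z s)"
      by (rule compact_continuous_image[OF continuous_on_subset[OF F(1) sub(1)]]) simp
    then have o2: "open (- (F k ` cball z s))" by (simp add: compact_imp_closed open_Compl)
    \<comment> \<open>On the sphere \<open>F k\<close> is farther than 2 m / 3 from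
      \<open>f z\<close>, at the centre it is closer than m / 3. The connected set \<open>?B\<close>
      therefore avoids the image of the sphere and meets the open image of the open ball, so it lies
      inside that image.\<close>
    have sph: "F k y \<notin> ?B" if "norm (y - z) = s" for y
    proof -
      have "dist (F k y) (f y) < m / 3" using k that s by (auto simp: dist_norm norm_minus_commute)
      moreover have "m \<le> dist (f y) (f z)" using low[OF that] by (simp add: dist_norm)
      moreover have "dist (f y) (f z) \<le> dist (F k y) (f y) + dist (f z) (F k y)"
        using dist_triangle3[of "f y" "f z" "F k y"] by (simp add: dist_commute add.commute)
      ultimately show ?thesis using m by auto
    qed
    have cov: "?B \<subseteq> F k ` ball z s \<union> - (F k ` cball z s)"
    proof
      fix w assume w: "w \<in> ?B"
      show "w \<in> F k ` ball z s \<union> - (F k ` cball z s)"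
      proof (cases "w \<in> F k ` cball z s")
        case True
        then obtain y where y: "w = F k y" "dist z y \<le> s" by auto
        then have "dist z y \<noteq> s" using sph[of y] w by (auto simp: dist_norm norm_minus_commute)
        then show ?thesis using y by auto
      qed auto
    qed
    have "F k ` ball z s \<inter> - (F k ` cball z s) \<inter> ?B = {}" using ball_subset_cball by blast
    moreover have "F k z \<in> F k ` ball z s \<inter> ?B"
      using k s r(1) by (auto simp: dist_commute)
    ultimately have "- (F k ` cball z s) \<inter> ?B = {}"
      using connectedD[OF connected_ball o1 o2 _ cov] by blast
    then show "?B \<subseteq> F k ` (S \<inter> ball z e)" using cov sub(3) by blast
  qed
  then show ?thesis using that[of "m/3"] m by simp
qed

text \<open>The Jacobian determinant of the limit has no zeros, so for large \<open>k\<close> the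
  image under \<open>F k\<close> of a small ball about \<open>z\<close> covers a fixed ball about
  \<open>f z\<close>. Two points with the same limit value would give \<open>F k\<close> a common
  value on disjoint balls; moreover \<open>f z\<close> is itself a value of
  \<open>F k\<close>.\<close>

lemma hurwitz_injective:
  fixes F :: "nat \<Rightarrow> complex ^ 'n \<Rightarrow> complex ^ 'n"
  assumes S: "open S" "connected S" and F: "\<And>k. holomorphic_map_on (F k) S" "\<And>k. inj_on (F k) S"
    and nz: "\<And>k z. z \<in> S \<Longrightarrow> det (jacobian (F k) z) \<noteq> 0" and lim: "locally_uniform_limit S F f"
    and x: "x \<in> S" "det (jacobian f x) \<noteq> 0"
  shows "inj_on f S" and "(\<And>k. F k ` S \<subseteq> V) \<Longrightarrow> f ` S \<subseteq> V"
proof -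
  note f = holomorphic_map_on_limit(1)[OF F(1) S(1) lim]
  have det: "det (jacobian f z) \<noteq> 0" if "z \<in> S" for z
    by (rule hurwitz_nonvanishing[OF S line_holomorphic_on_det_jacobian[OF F(1) S(1)] nz 
         locally_uniform_limit_det_jacobian[OF F(1) S(1) lim] x that])
  have ball: "\<exists>d>0. \<forall>\<^sub>F k in sequentially. ball (f z) d \<subseteq> F k ` (S \<inter> ball z e)" if "z \<in> S" "e > 0" for z e
    using ball_subset_image_eventually[OF S(1) holomorphic_map_on_continuous[OF F(1)] F(2) lim that(1)
        holomorphic_map_on_jacobian[OF f that(1)] det[OF that(1)] that(2)] by metis
  show "inj_on f S"
  proof (rule inj_onI, rule ccontr)
    fix z w assume zw: "z \<in> S" "w \<in> S" "f z = f w" "z \<noteq> w"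
    define e where "e = dist z w / 2"
    have e: "e > 0" using zw by (simp add: e_def)
    obtain d1 d2 where d: "d1 > 0" "d2 > 0"
      "\<forall>\<^sub>F k in sequentially. ball (f z) d1 \<subseteq> F k ` (S \<inter> ball z e)"
      "\<forall>\<^sub>F k in sequentially. ball (f w) d2 \<subseteq> F k ` (S \<inter> ball w e)"
      using ball[OF zw(1) e] ball[OF zw(2) e] by blast
    obtain k where k: "ball (f z) d1 \<subseteq> F k ` (S \<inter> ball z e)" "ball (f w) d2 \<subseteq> F k ` (S \<inter> ball w e)"
      using eventually_happens[OF eventually_conj[OF d(3,4)]] by auto
    have "f z \<in> F k ` (S \<inter> ball z e)" using k(1) d(1) by (meson centre_in_ball subsetD)
    moreover have "f z \<in> F k ` (S \<inter> ball w e)" using k(2) d(2) zw(3) by (metis centre_in_ball subsetD)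
    ultimately obtain a b where ab: "a \<in> S" "b \<in> S" "a \<in> ball z e" "b \<in> ball w e" "F k a = F k b" by auto
    then have "a = b" using inj_onD[OF F(2)] by blast
    then have "dist z w < e + e" using ab(3,4) dist_triangle[of z w a] by (simp add: dist_commute)
    then show False by (simp add: e_def)
  qed
  assume V: "\<And>k. F k ` S \<subseteq> V"
  show "f ` S \<subseteq> V"
  proof
    fix w assume "w \<in> f ` S"
    then obtain z where z: "z \<in> S" "w = f z" by blast
    obtain d where d: "d > 0" "\<forall>\<^sub>F k in sequentially. ball (f z) d \<subseteq> F k ` (S \<inter> ball z 1)"
      using ball[OF z(1), of 1] by auto
    then obtain k where "ball (f z) d \<subseteq> F k ` (S \<inter> ball z 1)" using eventually_happens by force
    then have "f z \<in> F k ` S" using d(1) by (meson IntD1 centre_in_ball image_mono inf_le1 subsetD)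
    then show "w \<in> V" using V[of k] z(2) by blast
  qed
qed

section \<open>Osgood's and Montel's theorems\<close>

text \<open>The real coordinates are indexed by \<open>'n bit0\<close>, which has \<open>2 * CARD('n)\<close> elements and the
  well-order that Sard's theorem in the library asks for.\<close>
lemma injective_holomorphic_det_nonzero:
  fixes F :: "complex ^ 'n \<Rightarrow> complex ^ 'n"
  assumes S: "open S" "S \<noteq> {}" and F: "holomorphic_map_on F S" "inj_on F S"
  shows "\<exists>z\<in>S. det (jacobian F z) \<noteq> 0"
proof (rule ccontr)
  assume "\<not> ?thesis"
  then have det0: "det (jacobian F z) = 0" if "z \<in> S" for z using that by blast
  have "dim (UNIV :: (complex ^ 'n) set) = dim (UNIV :: (real ^ ('n bit0)) set)"
    by simp
  then obtain T :: "complex ^ 'n \<Rightarrow> real ^ ('n bit0)" and T'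
    where T: "linear T" "linear T'" "\<And>x. T' (T x) = x" "\<And>y. T (T' y) = y"
    using isometries_subspaces[of "UNIV :: (complex ^ 'n) set" "UNIV :: (real ^ ('n bit0)) set"] subspace_UNIV
    by (metis UNIV_I)
  define f where "f = (\<lambda>y. T (F (T' y)))"
  define U where "U = T' -` S"
  define f' where "f' = (\<lambda>y v. T (jacobian F (T' y) *v T' v))"
  have contT: "continuous_on A T" "continuous_on B T'" for A B
    using T(1,2) by (simp_all add: linear_continuous_on linear_conv_bounded_linear)
  have U: "open U" unfolding U_def by (rule open_vimage[OF S(1) contT(2)])
  have der: "(f has_derivative f' y) (at y)" if "y \<in> U" for y
  proof -
    have dF: "(F has_derivative (*v) (jacobian F (T' y))) (at (T' y))"
      by (rule holomorphic_map_on_jacobian[OF F(1)]) (use that in \<open>simp add: U_def\<close>)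
    have "((\<lambda>y. F (T' y)) has_derivative (\<lambda>v. jacobian F (T' y) *v T' v)) (at y)"
      by (rule has_derivative_compose[OF linear_imp_has_derivative[OF T(2)] dF])
    from has_derivative_compose[OF this linear_imp_has_derivative[OF T(1)]]
    show ?thesis by (simp add: f_def f'_def)
  qed
  \<comment> \<open>A Jacobian singular everywhere makes the image negligible by Sard's theorem,
    while invariance of domain makes the injective image of a nonempty open set open.\<close>
  have "negligible (f ` U)"
  proof (rule baby_Sard)
    show "(f has_derivative f' y) (at y within U)" if "y \<in> U" for y
      using der[OF that] has_derivative_at_withinI by blast
    \<comment> \<open>The real rank and the complex determinant are compared through injectivity,
      which does not see the field of scalars.\<close>
    show "rank (matrix (f' y)) < CARD('n bit0)" if "y \<in> U" for y
    proof (rule ccontr)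
      assume "\<not> ?thesis"
      then have "rank (matrix (f' y)) = CARD('n bit0)"
        using rank_bound[of "matrix (f' y)"] by simp
      then have inj: "inj ((*v) (matrix (f' y)))" by (simp only: full_rank_injective)
      have lin: "linear (f' y)" using der[OF that] by (rule has_derivative_linear)
      have "det (jacobian F (T' y)) = 0" using that det0 by (simp add: U_def)
      then have "\<not> inj ((*v) (jacobian F (T' y)))"
        by (metis invertible_det_nz invertible_left_inverse matrix_left_invertible_injective)
      then obtain a b where ab: "jacobian F (T' y) *v a = jacobian F (T' y) *v b" "a \<noteq> b"
        unfolding inj_def by blast
      then have "f' y (T a) = f' y (T b)" by (simp add: f'_def T)
      then have "matrix (f' y) *v T a = matrix (f' y) *v T b"
        using matrix_vector_mul(2)[OF lin] by metis
      then have "T a = T b" using inj by (simp add: inj_eq)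
      then show False using ab(2) T(3) by metis
    qed
  qed simp
  moreover have "open (f ` U)"
  proof (rule invariance_of_domain)
    show "continuous_on U f"
      using der by (meson continuous_at_imp_continuous_on has_derivative_continuous)
    show "inj_on f U"
    proof (rule inj_onI)
      fix a b assume ab: "a \<in> U" "b \<in> U" "f a = f b"
      then have "F (T' a) = F (T' b)" unfolding f_def by (metis T(3))
      then have "T' a = T' b" using ab inj_onD[OF F(2)] by (auto simp: U_def)
      then show "a = b" by (metis T(4))
    qed
  qed (rule U)
  moreover have "f ` U \<noteq> {}"
  proof -
    obtain z where "z \<in> S" using S(2) by blast
    then have "T z \<in> U" by (simp add: U_def T)
    then show ?thesis by blast
  qed
  ultimately show False using open_not_negligible by blast
qed

lemma matrix_inv_mult_left:
  fixes A :: "complex ^ 'n ^ 'n"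
  assumes "det A \<noteq> 0"
  shows "matrix_inv A ** A = mat 1"
proof -
  have "\<exists>B. A ** B = mat 1 \<and> B ** A = mat 1"
    using assms invertible_det_nz[of A] by (simp add: invertible_def)
  then show ?thesis unfolding matrix_inv_def by (rule someI2_ex) simp
qed

text \<open>Off the zero set of \<open>det (jacobian F \<circ> F\<inverse>)\<close>, the inverse is holomorphic by the inverse
  function theorem; Rado's theorem on complex lines removes the exceptional set, which by Sard's
  theorem has no interior.\<close>
theorem osgood:
  fixes F :: "complex ^ 'n \<Rightarrow> complex ^ 'n"
  assumes S: "open S" and F: "holomorphic_map_on F S" "inj_on F S"
  shows "open (F ` S)" and "holomorphic_map_on (inv_into S F) (F ` S)"
    and "z \<in> S \<Longrightarrow> det (jacobian F z) \<noteq> 0"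
proof -
  define V where "V = F ` S"
  define h where "h = inv_into S F"
  have cF: "continuous_on S F" by (rule holomorphic_map_on_continuous[OF F(1)])
  show oV: "open (F ` S)" by (rule invariance_of_domain[OF cF S F(2)])
  then have V: "open V" by (simp add: V_def)
  have hS: "h w \<in> S" and Fh: "F (h w) = w" if "w \<in> V" for w
    using that by (auto simp: h_def V_def inv_into_into f_inv_into_f)
  have hF: "h (F z) = z" if "z \<in> S" for z using that F(2) by (simp add: h_def)
  have ch: "continuous_on V h" unfolding V_def
    by (rule continuous_on_inverse_open[OF S cF]) (use hF in auto)
  define d where "d = (\<lambda>z. det (jacobian F z))"
  have ld: "line_holomorphic_on d S" unfolding d_def by (rule line_holomorphic_on_det_jacobian[OF F(1) S])
  define u where "u = (\<lambda>w. d (h w))"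
  have cu: "continuous_on V u" unfolding u_def
    by (rule continuous_on_compose2[of S d V h]) (use ld ch hS in \<open>auto simp: line_holomorphic_on_def\<close>)
  \<comment> \<open>Since \<open>h\<close> is already continuous by invariance of domain, an
    invertible Jacobian of \<open>F\<close> is all that its differentiability still asks
    for.\<close>
  have dh: "(h has_derivative (*v) (matrix_inv (jacobian F (h w)))) (at w)" if w: "w \<in> V" "u w \<noteq> 0" for w
  proof (rule has_derivative_inverse_basic[where f=F and T=V])
    show "(F has_derivative (*v) (jacobian F (h w))) (at (h w))"
      by (rule holomorphic_map_on_jacobian[OF F(1) hS[OF w(1)]])
    show "bounded_linear ((*v) (matrix_inv (jacobian F (h w))))"
      by simp
    show "(*v) (matrix_inv (jacobian F (h w))) \<circ> (*v) (jacobian F (h w)) = id"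
      using w(2) by (simp add: fun_eq_iff matrix_vector_mul_assoc u_def d_def matrix_inv_mult_left)
    show "isCont h w" using ch V w by (simp add: continuous_on_eq_continuous_at)
  qed (use V w Fh in auto)
  have slice_h: "(\<lambda>\<zeta>. h (a + \<zeta> *s v) $ i) field_differentiable at \<zeta>" if "a + \<zeta> *s v \<in> V" "u (a + \<zeta> *s v) \<noteq> 0" for a v \<zeta> i
    using slice_has_field_derivative[OF has_derivative_vec_component[OF dh[OF that]], of i]
    by (auto simp: field_differentiable_def matrix_vector_mult_cscale)
  have slice_u: "(\<lambda>\<zeta>. u (a + \<zeta> *s v)) field_differentiable at \<zeta>" if "a + \<zeta> *s v \<in> V" "u (a + \<zeta> *s v) \<noteq> 0" for a v \<zeta>
  proof -
    let ?w = "a + \<zeta> *s v"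
    have "(u has_derivative (\<lambda>x. dir_deriv d (matrix_inv (jacobian F (h ?w)) *v x) (h ?w))) (at ?w)"
      unfolding u_def
      by (rule has_derivative_compose[OF dh[OF that] line_holomorphic_has_derivative[OF ld S hS[OF that(1)]]])
    from slice_has_field_derivative[OF this]
    show ?thesis
      by (auto simp: field_differentiable_def matrix_vector_mult_cscale dir_deriv_cscale[OF ld S hS[OF that(1)]])
  qed
  \<comment> \<open>Rado's theorem wants a nonzero value of \<open>u\<close> at the centre of the
    disc; the remaining discs are reached as limits of such discs.\<close>
  have good: "(\<lambda>\<zeta>. h (a + \<zeta> *s v) $ i) holomorphic_on ball 0 1"
    if av: "\<And>\<zeta>. norm \<zeta> \<le> 1 \<Longrightarrow> a + \<zeta> *s v \<in> V" and ua: "u a \<noteq> 0" for a v i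
  proof (rule rado[where u="\<lambda>\<zeta>. u (a + \<zeta> *s v)"])
    have c: "continuous_on (cball 0 1) (\<lambda>\<zeta>. a + \<zeta> *s v)" "(\<lambda>\<zeta>. a + \<zeta> *s v) ` cball 0 1 \<subseteq> V"
      using av by (auto intro!: continuous_intros)
    show "continuous_on (cball 0 1) (\<lambda>\<zeta>. u (a + \<zeta> *s v))"
      by (rule continuous_on_compose2[OF cu c])
    have "continuous_on (cball 0 1) (\<lambda>\<zeta>. h (a + \<zeta> *s v))"
      by (rule continuous_on_compose2[OF ch c])
    then show "continuous_on (cball 0 1) (\<lambda>\<zeta>. h (a + \<zeta> *s v) $ i)"
      by (intro continuous_intros)
  qed (use slice_u slice_h av ua in auto)
  have dense: "\<exists>b\<in>V. dist b a < e \<and> u b \<noteq> 0" if a: "a \<in> V" "e > 0" for a e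
  proof -
    define W where "W = S \<inter> F -` (ball a e)"
    have "open W" unfolding W_def by (rule continuous_open_preimage[OF cF S open_ball])
    moreover have "W \<noteq> {}" using hS[OF a(1)] Fh[OF a(1)] a(2) by (auto simp: W_def)
    moreover have "W \<subseteq> S" by (auto simp: W_def)
    ultimately obtain z where z: "z \<in> W" "d z \<noteq> 0"
      using injective_holomorphic_det_nonzero[of W F] holomorphic_map_on_subset[OF F(1)] inj_on_subset[OF F(2)]
      unfolding d_def by blast
    then show ?thesis using hF by (intro bexI[of _ "F z"]) (auto simp: W_def u_def V_def dist_commute)
  qed
  have lh: "line_holomorphic_on (\<lambda>w. h w $ i) V" for i
    unfolding line_holomorphic_on_def
  proof (intro conjI allI impI)
    show chi: "continuous_on V (\<lambda>w. h w $ i)" by (intro continuous_intros ch)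
    fix a v assume av: "\<forall>\<zeta>\<in>cball 0 1. a + \<zeta> *s v \<in> V"
    define K where "K = (\<lambda>\<zeta>. a + \<zeta> *s v) ` cball 0 1"
    have "compact K" unfolding K_def by (intro compact_continuous_image continuous_intros) auto
    moreover have "K \<subseteq> V" using av by (auto simp: K_def)
    ultimately obtain r where r: "r > 0" "\<And>y. y \<in> K \<Longrightarrow> cball y r \<subseteq> V" "compact (\<Union>y\<in>K. cball y r)"
      using compact_nbhd[OF _ V] by metis
    have "(\<Union>y\<in>K. cball y r) \<subseteq> V" using r by blast
    then have uc: "uniformly_continuous_on (\<Union>y\<in>K. cball y r) (\<lambda>w. h w $ i)"
      by (intro compact_uniformly_continuous continuous_on_subset[OF chi] r(3))
    have aV: "a \<in> V" using av[rule_format, of 0] by simp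
    \<comment> \<open>The disc is translated to centres \<open>b m\<close> with nonzero
      \<open>u\<close>. All translates stay in the compact neighbourhood of radius \<open>r\<close>,
      where uniform continuity of \<open>h\<close> makes the slices converge uniformly.\<close>
    have "\<exists>b\<in>V. dist b a < r / Suc m \<and> u b \<noteq> 0" for m using dense[OF aV] r(1) by simp
    then obtain b where b: "\<And>m. dist (b m) a < r / Suc m" "\<And>m. u (b m) \<noteq> 0" by metis
    have bK: "b m + \<zeta> *s v \<in> cball (a + \<zeta> *s v) r" for m \<zeta>
    proof -
      have "dist (b m) a < r" using less_le_trans[OF b(1)[of m]] r(1) by (simp add: divide_le_eq)
      then show ?thesis by (simp add: dist_norm norm_minus_commute)
    qed
    have inK: "a + \<zeta> *s v \<in> K" if "norm \<zeta> \<le> 1" for \<zeta> using that by (auto simp: K_def)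
    show "(\<lambda>\<zeta>. h (a + \<zeta> *s v) $ i) holomorphic_on ball 0 1"
    proof (rule holomorphic_uniform_sequence[where f="\<lambda>m \<zeta>. h (b m + \<zeta> *s v) $ i"])
      show "(\<lambda>\<zeta>. h (b m + \<zeta> *s v) $ i) holomorphic_on ball 0 1" for m
        using bK r(2)[OF inK] by (intro good b(2)) blast
      have ul: "uniform_limit (ball 0 1) (\<lambda>m \<zeta>. h (b m + \<zeta> *s v) $ i) (\<lambda>\<zeta>. h (a + \<zeta> *s v) $ i) sequentially"
      proof (rule uniform_limitI)
        fix e :: real assume "e > 0"
        then obtain \<delta> where \<delta>: "\<delta> > 0" "\<And>x y. x \<in> (\<Union>y\<in>K. cball y r) \<Longrightarrow> y \<in> (\<Union>y\<in>K. cball y r) \<Longrightarrow> dist y x < \<delta> \<Longrightarrow> dist (h y $ i) (h x $ i) < e"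
          using uc unfolding uniformly_continuous_on_def by metis
        have "(\<lambda>m. r * (1 / real (Suc m))) \<longlonglongrightarrow> r * 0"
          by (intro tendsto_intros lim_1_over_n[THEN LIMSEQ_Suc])
        then have ev: "\<forall>\<^sub>F m in sequentially. r * (1 / real (Suc m)) < \<delta>"
          using \<delta>(1) by (intro order_tendstoD(2)) auto
        show "\<forall>\<^sub>F m in sequentially. \<forall>\<zeta>\<in>ball 0 1. dist (h (b m + \<zeta> *s v) $ i) (h (a + \<zeta> *s v) $ i) < e"
        proof (rule eventually_mono[OF ev], rule ballI)
          fix m and \<zeta> :: complex assume m: "r * (1 / real (Suc m)) < \<delta>" and \<zeta>: "\<zeta> \<in> ball 0 1"
          have k: "a + \<zeta> *s v \<in> K" using \<zeta> by (intro inK) auto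
          show "dist (h (b m + \<zeta> *s v) $ i) (h (a + \<zeta> *s v) $ i) < e"
          proof (rule \<delta>(2))
            show "a + \<zeta> *s v \<in> (\<Union>y\<in>K. cball y r)" using k r(1) by force
            show "b m + \<zeta> *s v \<in> (\<Union>y\<in>K. cball y r)" using k bK by blast
            show "dist (b m + \<zeta> *s v) (a + \<zeta> *s v) < \<delta>" using b(1)[of m] m by simp
          qed
        qed
      qed
      fix x :: complex assume x: "x \<in> ball 0 1"
      obtain d where d: "d > 0" "cball x d \<subseteq> ball 0 1"
        using x open_contains_cball[of "ball (0::complex) 1"] open_ball by blast
      then show "\<exists>d>0. cball x d \<subseteq> ball 0 1 \<and>
          uniform_limit (cball x d) (\<lambda>m \<zeta>. h (b m + \<zeta> *s v) $ i) (\<lambda>\<zeta>. h (a + \<zeta> *s v) $ i) sequentially"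
        using uniform_limit_on_subset[OF ul] by blast
    qed simp
  qed
  have hh: "holomorphic_map_on h V" by (rule holomorphic_map_onI[OF V lh])
  then show "holomorphic_map_on (inv_into S F) (F ` S)" by (simp add: h_def V_def)
  show "det (jacobian F z) \<noteq> 0" if z: "z \<in> S"
  proof -
    have FV: "F ` S \<subseteq> V" by (simp add: V_def)
    \<comment> \<open>The identity map is written as the matrix \<open>mat 1\<close> so that its
      Jacobian is at hand for the chain rule.\<close>
    have "jacobian (\<lambda>z. h (F z)) z = jacobian ((*v) (mat 1)) z"
      by (rule jacobian_cong[OF S z]) (use hF holomorphic_map_on_compose(1)[OF F(1) hh FV] in auto)
    then have "jacobian h (F z) ** jacobian F z = mat 1"
      by (simp only: holomorphic_map_on_matrix(2) holomorphic_map_on_compose(2)[OF F(1) hh FV z])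
    then have "det (jacobian h (F z)) * det (jacobian F z) = 1" by (metis det_I det_mul)
    then show ?thesis by auto
  qed
qed

section \<open>Normal families of bounded maps\<close>

lemma equi_lipschitz:
  fixes F :: "complex ^ 'n \<Rightarrow> complex ^ 'm"
  assumes F: "holomorphic_map_on F S" and S: "open S" and r: "r > 0" "cball z r \<subseteq> S"
    and M: "\<And>y. y \<in> S \<Longrightarrow> norm (F y) \<le> M" and w: "norm w \<le> r / 2"
  shows "norm (F (z + w) - F z) \<le> real CARD('m) * (5 * M * (norm w / r))"
proof -
  have "norm (F (z + w) - F z) \<le> (\<Sum>i\<in>UNIV. norm ((F (z + w) - F z) $ i))" by (rule norm_vec_le_sum)
  also have "\<dots> \<le> (\<Sum>i\<in>(UNIV::'m set). 5 * M * (norm w / r))"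
  proof (rule sum_mono)
    fix i
    have "norm (F y $ i) \<le> M" if "y \<in> cball z r" for y
      using M[of y] r(2) that Finite_Cartesian_Product.norm_nth_le[of "F y" i] by (meson order_trans subsetD)
    then show "norm ((F (z + w) - F z) $ i) \<le> 5 * M * (norm w / r)"
      using line_holomorphic_lipschitz[OF holomorphic_map_on_component[OF F, of i] S r _ w] by simp
  qed
  finally show ?thesis by simp
qed

text \<open>Cauchy's estimates make the family uniformly Lipschitz on small balls, so pointwise
  convergence on a countable dense subset of \<open>S\<close>, which a diagonal subsequence
  provides, spreads to uniform convergence on these balls.\<close>

theorem montel_maps:
  fixes F :: "nat \<Rightarrow> complex ^ 'n \<Rightarrow> complex ^ 'm"
  assumes S: "open S" and F: "\<And>k. holomorphic_map_on (F k) S"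
    and M: "\<And>k y. y \<in> S \<Longrightarrow> norm (F k y) \<le> M"
  obtains \<sigma> f where "strict_mono (\<sigma> :: nat \<Rightarrow> nat)" "locally_uniform_limit S (\<lambda>k. F (\<sigma> k)) f"
proof -
  obtain T where T: "countable T" "T \<subseteq> S" "S \<subseteq> closure T" using separable by blast
  obtain \<sigma> where \<sigma>: "strict_mono \<sigma>" "\<And>x. x \<in> T \<Longrightarrow> \<exists>l. (\<lambda>n. F (\<sigma> n) x) \<longlonglongrightarrow> l"
    using function_convergent_subsequence[OF T(1), of F M] M T(2) by (metis subsetD)
  have conv: "\<exists>r>0. cball z r \<subseteq> S \<and> uniformly_convergent_on (cball z r) (\<lambda>k. F (\<sigma> k))" if z: "z \<in> S" for z
  proof -
    obtain R where R: "R > 0" "cball z R \<subseteq> S" using S z open_contains_cball by blast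
    \<comment> \<open>Every point of \<open>cball z r\<close> is the centre of a ball of radius
      \<open>r\<close> inside \<open>S\<close>, so one Lipschitz constant serves them all.\<close>
    define r where "r = R / 2"
    have r: "r > 0" "\<And>y. y \<in> cball z r \<Longrightarrow> cball y r \<subseteq> S" 
    proof -
      fix y assume "y \<in> cball z r"
      then have "cball y r \<subseteq> cball z R" by (simp add: r_def cball_subset_cball_iff dist_commute)
      then show "cball y r \<subseteq> S" using R by blast
    qed (use R in \<open>simp add: r_def\<close>)
    define L where "L = real CARD('m) * (5 * M / r)"
    have M0: "M \<ge> 0" using M[OF z, of 0] by (auto intro: order_trans[OF norm_ge_zero])
    have L: "L \<ge> 0" using r M0 by (simp add: L_def)
    have lip: "dist (F k x) (F k y) \<le> L * dist x y" if "y \<in> cball z r" "dist x y \<le> r / 2" for k x y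
    proof -
      have "norm (F k (y + (x - y)) - F k y) \<le> real CARD('m) * (5 * M * (norm (x - y) / r))"
        by (rule equi_lipschitz[OF F S r(1) r(2)[OF that(1)] M]) (use that in \<open>auto simp: dist_norm\<close>)
      then show ?thesis by (simp add: dist_norm L_def)
    qed
    have "uniformly_Cauchy_on (cball z r) (\<lambda>k. F (\<sigma> k))"
    proof (rule uniformly_Cauchy_onI)
      fix e :: real assume e: "e > 0"
      \<comment> \<open>The first bound makes the Lipschitz estimate applicable, the second lets
        each of its two uses cost less than e / 3. The last third comes from the Cauchy property at
        the finitely many centres in \<open>T'\<close>.\<close>
      define \<delta> where "\<delta> = min (r / 2) (e / (3 * (L + 1)))"
      have \<delta>: "\<delta> > 0" "\<delta> \<le> r / 2" "L * \<delta> < e / 3"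
      proof -
        have "L * \<delta> \<le> L * (e / (3 * (L + 1)))" using L by (intro mult_left_mono) (auto simp: \<delta>_def)
        also have "\<dots> < e / 3" using e L by (simp add: divide_simps)
        finally show "L * \<delta> < e / 3" .
        show "\<delta> \<le> r / 2" unfolding \<delta>_def by (rule min.cobounded1)
      qed (use r e L in \<open>auto simp: \<delta>_def\<close>)
      have "cball z r \<subseteq> (\<Union>t\<in>T. ball t \<delta>)"
      proof
        fix x assume "x \<in> cball z r"
        moreover have "x \<in> cball x r" using r(1) by simp
        ultimately have "x \<in> S" using r(2)[of x] by blast
        then have "x \<in> closure T" using T(3) by blast
        then obtain t where "t \<in> T" "dist t x < \<delta>" using \<delta>(1) closure_approachable by blast
        then show "x \<in> (\<Union>t\<in>T. ball t \<delta>)" by auto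
      qed
      then obtain T' where T': "T' \<subseteq> T" "finite T'" "cball z r \<subseteq> (\<Union>t\<in>T'. ball t \<delta>)"
        using compactE_image[OF compact_cball, of T "\<lambda>t. ball t \<delta>"] open_ball by metis
      have "\<exists>N. \<forall>m\<ge>N. \<forall>n\<ge>N. dist (F (\<sigma> m) t) (F (\<sigma> n) t) < e / 3" if tT: "t \<in> T" for t
      proof -
        obtain l where "(\<lambda>n. F (\<sigma> n) t) \<longlonglongrightarrow> l" using \<sigma>(2)[OF tT] by blast
        then have "Cauchy (\<lambda>n. F (\<sigma> n) t)" by (rule LIMSEQ_imp_Cauchy)
        then show ?thesis unfolding Cauchy_def using e by (drule_tac x="e/3" in spec) simp
      qed
      then obtain N where N: "\<And>t m n. t \<in> T \<Longrightarrow> m \<ge> N t \<Longrightarrow> n \<ge> N t \<Longrightarrow> dist (F (\<sigma> m) t) (F (\<sigma> n) t) < e / 3"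
        by metis
      define N' where "N' = Max (insert 0 (N ` T'))"
      have N': "N t \<le> N'" if "t \<in> T'" for t using that T'(2) by (auto simp: N'_def)
      show "\<exists>M. \<forall>x\<in>cball z r. \<forall>m\<ge>M. \<forall>n\<ge>M. dist (F (\<sigma> m) x) (F (\<sigma> n) x) < e"
      proof (intro exI[of _ N'] ballI allI impI)
        fix x m n assume x: "x \<in> cball z r" and mn: "N' \<le> m" "N' \<le> n"
        obtain t where t: "t \<in> T'" "dist t x < \<delta>" using T'(3) x by auto
        have l: "dist (F k t) (F k x) < e / 3" for k
        proof -
          have "dist (F k t) (F k x) \<le> L * dist t x" using lip[OF x] t(2) \<delta> by simp
          also have "\<dots> \<le> L * \<delta>" using t(2) L by (intro mult_left_mono) auto
          finally show ?thesis using \<delta>(3) by simp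
        qed
        have "dist (F (\<sigma> m) t) (F (\<sigma> n) t) < e / 3"
          by (rule N) (use N'[OF t(1)] T'(1) t(1) mn in auto)
        moreover have "dist (F (\<sigma> m) x) (F (\<sigma> n) x) \<le> dist (F (\<sigma> m) t) (F (\<sigma> m) x) + (dist (F (\<sigma> m) t) (F (\<sigma> n) t) + dist (F (\<sigma> n) t) (F (\<sigma> n) x))"
          using dist_triangle[of "F (\<sigma> m) x" "F (\<sigma> n) x" "F (\<sigma> m) t"]
            dist_triangle[of "F (\<sigma> m) t" "F (\<sigma> n) x" "F (\<sigma> n) t"]
          by (simp add: dist_commute)
        ultimately show "dist (F (\<sigma> m) x) (F (\<sigma> n) x) < e" using l[of "\<sigma> m"] l[of "\<sigma> n"] by linarith
      qed
    qed
    then have "uniformly_convergent_on (cball z r) (\<lambda>k. F (\<sigma> k))" by (rule Cauchy_uniformly_convergent)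
    moreover have "cball z r \<subseteq> S" using r(2)[of z] r(1) by simp
    ultimately show ?thesis using r(1) by blast
  qed
  have "locally_uniform_limit S (\<lambda>k. F (\<sigma> k)) (\<lambda>z. lim (\<lambda>k. F (\<sigma> k) z))"
    using conv unfolding locally_uniform_limit_def uniformly_convergent_uniform_limit_iff by blast
  then show ?thesis using that \<sigma>(1) by blast
qed

section \<open>Indicatrices\<close>

lemma disc_derivI:
  assumes "(f has_derivative (\<lambda>h. h *s w)) (at \<zeta>)"
  shows "disc_deriv f \<zeta> = w" "(\<lambda>\<zeta>. f \<zeta> $ i) field_differentiable at \<zeta>"
proof -
  have *: "((\<lambda>\<zeta>. f \<zeta> $ i) has_field_derivative w $ i) (at \<zeta>)" for i
    using has_derivative_vec_component[OF assms, of i]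
    by (simp add: has_field_derivative_def mult.commute[of _ "w $ i"])
  show "disc_deriv f \<zeta> = w" using DERIV_imp_deriv[OF *] by (simp add: disc_deriv_def vec_eq_iff)
  show "(\<lambda>\<zeta>. f \<zeta> $ i) field_differentiable at \<zeta>" using * by (auto simp: field_differentiable_def)
qed

lemma holomorphic_discsI:
  assumes "\<And>\<zeta>. norm \<zeta> < 1 \<Longrightarrow> \<exists>w. (f has_derivative (\<lambda>h. h *s w)) (at \<zeta>)"
    and "\<And>\<zeta>. norm \<zeta> < 1 \<Longrightarrow> f \<zeta> \<in> D"
  shows "f \<in> holomorphic_discs D"
proof -
  have "(\<lambda>\<zeta>. f \<zeta> $ i) field_differentiable at \<zeta>" if "norm \<zeta> < 1" for i \<zeta>
    using assms(1)[OF that] disc_derivI(2) by blast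
  then show ?thesis using assms(2)
    by (auto simp: holomorphic_discs_def holomorphic_on_def intro: field_differentiable_at_within)
qed

lemma holomorphic_discs_has_derivative:
  assumes "f \<in> holomorphic_discs D" "norm \<zeta> < 1"
  shows "(f has_derivative (\<lambda>h. h *s disc_deriv f \<zeta>)) (at \<zeta>)"
proof (rule has_derivative_vecI)
  fix i
  have "((\<lambda>\<zeta>. f \<zeta> $ i) has_field_derivative deriv (\<lambda>\<zeta>. f \<zeta> $ i) \<zeta>) (at \<zeta>)"
    by (rule holomorphic_derivI[of _ "ball 0 1"]) (use assms in \<open>auto simp: holomorphic_discs_def\<close>)
  moreover have "(\<lambda>h. (h *s disc_deriv f \<zeta>) $ i) = (*) (deriv (\<lambda>\<zeta>. f \<zeta> $ i) \<zeta>)"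
    by (simp add: fun_eq_iff disc_deriv_def)
  ultimately show "((\<lambda>\<zeta>. f \<zeta> $ i) has_derivative (\<lambda>h. (h *s disc_deriv f \<zeta>) $ i)) (at \<zeta>)"
    by (simp only: has_field_derivative_def)
qed

lemma holomorphic_discs_compose:
  assumes \<phi>: "holomorphic_map_on \<phi> D" "\<phi> ` D \<subseteq> V" and f: "f \<in> holomorphic_discs D"
  shows "(\<lambda>\<zeta>. \<phi> (f \<zeta>)) \<in> holomorphic_discs V"
    and "disc_deriv (\<lambda>\<zeta>. \<phi> (f \<zeta>)) 0 = jacobian \<phi> (f 0) *v disc_deriv f 0"
proof -
  have fD: "f \<zeta> \<in> D" if "norm \<zeta> < 1" for \<zeta> using f that by (auto simp: holomorphic_discs_def)
  have *: "((\<lambda>\<zeta>. \<phi> (f \<zeta>)) has_derivative (\<lambda>h. h *s (jacobian \<phi> (f \<zeta>) *v disc_deriv f \<zeta>))) (at \<zeta>)" if "norm \<zeta> < 1" for \<zeta>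
    using has_derivative_compose[OF holomorphic_discs_has_derivative[OF f that] holomorphic_map_on_jacobian[OF \<phi>(1) fD[OF that]]]
    by (simp add: matrix_vector_mult_cscale)
  show "(\<lambda>\<zeta>. \<phi> (f \<zeta>)) \<in> holomorphic_discs V"
    by (rule holomorphic_discsI) (use * fD \<phi>(2) in blast)+
  show "disc_deriv (\<lambda>\<zeta>. \<phi> (f \<zeta>)) 0 = jacobian \<phi> (f 0) *v disc_deriv f 0"
    by (rule disc_derivI(1)[OF *]) simp
qed

lemma affine_disc_has_derivative:
  "((\<lambda>\<zeta>. x + \<zeta> *s (w :: complex ^ 'n)) has_derivative (\<lambda>h. h *s w)) (at \<zeta>)"
proof -
  have "((\<lambda>\<zeta>. x + \<zeta> *s w) has_derivative (\<lambda>h. 0 + h *s w)) (at \<zeta>)"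
    by (rule has_derivative_add[OF has_derivative_const bounded_linear_imp_has_derivative[OF bounded_linear_cscale_left]])
  then show ?thesis by simp
qed

text \<open>An infimum below 1 yields an element below 1 once the set is nonempty and bounded below;
  a small affine disc supplies the element \<open>1 / e\<close>.\<close>

lemma indicatrix_iff:
  assumes D: "open D" "x \<in> D"
  shows "v \<in> indicatrix D x \<longleftrightarrow>
    (\<exists>l f. 0 < l \<and> l < 1 \<and> f \<in> holomorphic_discs D \<and> f 0 = x \<and> v = l *\<^sub>R disc_deriv f 0)"
proof -
  let ?X = "{l. l > 0 \<and> (\<exists>f\<in>holomorphic_discs D. f 0 = x \<and> l *\<^sub>R disc_deriv f 0 = v)}"
  obtain e where e: "e > 0" "\<And>\<zeta>. norm \<zeta> \<le> 1 \<Longrightarrow> x + \<zeta> *s (of_real e *s v) \<in> D"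
    using small_affine_disc[OF D] by blast
  let ?f = "\<lambda>\<zeta>. x + \<zeta> *s (of_real e *s v)"
  have "?f \<in> holomorphic_discs D"
    by (rule holomorphic_discsI, rule exI, rule affine_disc_has_derivative) (use e in simp)
  moreover have "?f 0 = x" by simp
  moreover have "(1 / e) *\<^sub>R disc_deriv ?f 0 = v"
    unfolding disc_derivI(1)[OF affine_disc_has_derivative] using e(1) by (simp add: scaleR_eq_cscale)
  ultimately have "1 / e \<in> ?X" using e(1) by (intro CollectI conjI bexI[of _ ?f]) simp_all
  then have "?X \<noteq> {}" by blast
  moreover have "bdd_below ?X" by (rule bdd_belowI[of _ 0]) auto
  ultimately have "Inf ?X < 1 \<longleftrightarrow> (\<exists>l\<in>?X. l < 1)" by (rule cInf_less_iff)
  then show ?thesis by (auto simp: indicatrix_def kobayashi_royden_def)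
qed

text \<open>Composing a disc with \<phi> keeps the factor \<open>l\<close> and transports the
  derivative by the chain rule. Applied to an embedding and to its inverse, this contraction
  property becomes biholomorphic invariance.\<close>

lemma indicatrix_image:
  assumes D: "open D" "x \<in> D" and V: "open V" and \<phi>: "holomorphic_map_on \<phi> D" "\<phi> ` D \<subseteq> V"
    and v: "v \<in> indicatrix D x"
  shows "jacobian \<phi> x *v v \<in> indicatrix V (\<phi> x)"
proof -
  obtain l f where lf: "0 < l" "l < 1" "f \<in> holomorphic_discs D" "f 0 = x" "v = l *\<^sub>R disc_deriv f 0"
    using v unfolding indicatrix_iff[OF D] by blast
  have "jacobian \<phi> x *v v = l *\<^sub>R disc_deriv (\<lambda>\<zeta>. \<phi> (f \<zeta>)) 0"
    using holomorphic_discs_compose(2)[OF \<phi> lf(3)] lf(4,5) by (simp add: scaleR_eq_cscale matrix_vector_mult_cscale)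
  moreover have "\<phi> x \<in> V" using \<phi>(2) D(2) by blast
  ultimately show ?thesis
    using indicatrix_iff[OF V, of "\<phi> x"] lf holomorphic_discs_compose(1)[OF \<phi> lf(3)] by blast
qed

text \<open>Precomposing a disc with multiplication by \<open>c\<close>, which maps the unit disc
  into itself, multiplies its derivative at 0 by \<open>c\<close>.\<close>

lemma complete_circular_indicatrix:
  assumes D: "open D" "x \<in> D"
  shows "complete_circular (indicatrix D x)"
  unfolding complete_circular_def
proof (intro ballI allI impI)
  fix v and c :: complex assume v: "v \<in> indicatrix D x" and c: "norm c \<le> 1"
  obtain l f where lf: "0 < l" "l < 1" "f \<in> holomorphic_discs D" "f 0 = x" "v = l *\<^sub>R disc_deriv f 0"
    using v unfolding indicatrix_iff[OF D] by blast
  let ?g = "\<lambda>\<zeta>. f (\<zeta> * c)"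
  have cl: "norm (\<zeta> * c) < 1" if "norm \<zeta> < 1" for \<zeta>
    using that c mult_left_le[of "norm c" "norm \<zeta>"] by (simp add: norm_mult)
  have der: "(?g has_derivative (\<lambda>h. h *s (c *s disc_deriv f (\<zeta> * c)))) (at \<zeta>)" if "norm \<zeta> < 1" for \<zeta>
    using has_derivative_compose[OF has_derivative_mult_left[OF has_derivative_ident] 
        holomorphic_discs_has_derivative[OF lf(3) cl[OF that]]]
    by simp
  have "?g \<in> holomorphic_discs D"
    by (rule holomorphic_discsI, rule exI, erule der) (use cl lf(3) in \<open>auto simp: holomorphic_discs_def\<close>)
  moreover have "c *s v = l *\<^sub>R disc_deriv ?g 0"
    using disc_derivI(1)[OF der[of 0]] lf(5) by (simp add: scaleR_eq_cscale mult.commute)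
  ultimately show "c *s v \<in> indicatrix D x"
    using lf unfolding indicatrix_iff[OF D] by (intro exI[of _ l] exI[of _ ?g]) auto
qed

lemma zero_in_indicatrix:
  assumes D: "open D" "x \<in> D"
  shows "0 \<in> indicatrix D x"
proof -
  have "(\<lambda>\<zeta>. x + \<zeta> *s 0) \<in> holomorphic_discs D"
    by (rule holomorphic_discsI, rule exI, rule affine_disc_has_derivative) (use D in simp)
  moreover have "disc_deriv (\<lambda>\<zeta>. x + \<zeta> *s 0) 0 = 0" by (rule disc_derivI(1)[OF affine_disc_has_derivative])
  ultimately show ?thesis unfolding indicatrix_iff[OF D]
    by (intro exI[of _ "1/2"] exI[of _ "\<lambda>\<zeta>. x + \<zeta> *s 0"]) auto
qed

text \<open>Shrinking the parameter of a disc makes its image relatively compact in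
  \<open>D\<close>, which leaves room for a small linear term \<zeta> u; the factor \<open>l\<close>
  is below 1 and can absorb the shrinking.\<close>

lemma open_indicatrix:
  assumes D: "open D" "x \<in> D"
  shows "open (indicatrix D x)"
  unfolding open_contains_ball
proof
  fix v assume "v \<in> indicatrix D x"
  then obtain l f where lf: "0 < l" "l < 1" "f \<in> holomorphic_discs D" "f 0 = x" "v = l *\<^sub>R disc_deriv f 0"
    unfolding indicatrix_iff[OF D] by blast
  \<comment> \<open>Here \<open>s < 1\<close> gives the compact image and \<open>l < s\<close> keeps
    the new factor \<open>l / s\<close> below 1.\<close>
  define s where "s = (l + 1) / 2"
  have s: "0 < s" "l < s" "s < 1" using lf by (auto simp: s_def)
  have "continuous_on (ball 0 1) f"
    by (rule continuous_at_imp_continuous_on)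
       (use has_derivative_continuous[OF holomorphic_discs_has_derivative[OF lf(3)]] in auto)
  then have "compact (f ` cball 0 s)"
    using s by (intro compact_continuous_image) (auto elim: continuous_on_subset)
  moreover have "f ` cball 0 s \<subseteq> D" using lf(3) s by (auto simp: holomorphic_discs_def)
  ultimately obtain e where e: "e > 0" "(\<Union>y\<in>f ` cball 0 s. cball y e) \<subseteq> D"
    using compact_subset_open_imp_cball_epsilon_subset[OF _ D(1)] by metis
  define l' where "l' = l / s"
  have l': "0 < l'" "l' < 1" using lf s by (auto simp: l'_def)
  have "ball v (l' * e) \<subseteq> indicatrix D x"
  proof
    fix w assume w: "w \<in> ball v (l' * e)"
    \<comment> \<open>The new disc has derivative s f'(0) + u at 0, and \<open>l'\<close> times it
      is v + l' u; this has to be \<open>w\<close>.\<close>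
    define u where "u = (1 / l') *\<^sub>R (w - v)"
    have "norm u = norm (v - w) / l'" unfolding u_def norm_scaleR using l' by (simp add: norm_minus_commute)
    then have u: "norm u \<le> e" using w l' by (simp add: dist_norm pos_divide_le_eq mult.commute)
    let ?g = "\<lambda>\<zeta>. f (\<zeta> * of_real s) + \<zeta> *s u"
    have cl: "norm (\<zeta> * of_real s) \<le> s" if "norm \<zeta> < 1" for \<zeta> :: complex
      using that s mult_right_mono[of "norm \<zeta>" 1 s] by (simp add: norm_mult)
    have der: "(?g has_derivative (\<lambda>h. h *s (of_real s *s disc_deriv f (\<zeta> * of_real s) + u))) (at \<zeta>)" if "norm \<zeta> < 1" for \<zeta>
    proof -
      have "norm (\<zeta> * of_real s) < 1" using cl[OF that] s by linarith
      from has_derivative_compose[OF has_derivative_mult_left[OF has_derivative_ident] holomorphic_discs_has_derivative[OF lf(3) this]]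
      have "((\<lambda>\<zeta>. f (\<zeta> * of_real s)) has_derivative (\<lambda>h. (h * of_real s) *s disc_deriv f (\<zeta> * of_real s))) (at \<zeta>)" .
      from has_derivative_add[OF this bounded_linear_imp_has_derivative[OF bounded_linear_cscale_left, of u]]
      show ?thesis by (simp add: vector_add_ldistrib)
    qed
    have "?g \<in> holomorphic_discs D"
    proof (rule holomorphic_discsI)
      fix \<zeta> :: complex assume \<zeta>: "norm \<zeta> < 1"
      show "\<exists>w. (?g has_derivative (\<lambda>h. h *s w)) (at \<zeta>)" using der[OF \<zeta>] by blast
      have "norm (\<zeta> *s u) \<le> e" using \<zeta> u mult_mono[of "norm \<zeta>" 1 "norm u" e] by (simp add: norm_cscale)
      then have "?g \<zeta> \<in> cball (f (\<zeta> * of_real s)) e" by (simp add: dist_norm)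
      moreover have "f (\<zeta> * of_real s) \<in> f ` cball 0 s" using cl[OF \<zeta>] by auto
      ultimately show "?g \<zeta> \<in> D" using e(2) by blast
    qed
    moreover have "w = l' *\<^sub>R disc_deriv ?g 0"
    proof -
      have "disc_deriv ?g 0 = s *\<^sub>R disc_deriv f 0 + u"
        using disc_derivI(1)[OF der[of 0]] by (simp add: scaleR_eq_cscale)
      moreover have "l' *\<^sub>R u = w - v" using l' by (simp add: u_def)
      moreover have "l' *\<^sub>R (s *\<^sub>R disc_deriv f 0) = v" using s lf(5) by (simp add: l'_def)
      ultimately show ?thesis by (simp add: scaleR_add_right)
    qed
    ultimately show "w \<in> indicatrix D x"
      unfolding indicatrix_iff[OF D] using l' lf(4) by (intro exI[of _ l'] exI[of _ ?g]) auto
  qed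
  then show "\<exists>e>0. ball v e \<subseteq> indicatrix D x" using l' e by (intro exI[of _ "l' * e"]) auto
qed

lemma bounded_indicatrix:
  fixes D :: "(complex ^ 'n) set"
  assumes D: "open D" "x \<in> D" and b: "bounded D"
  shows "bounded (indicatrix D x)"
proof -
  obtain M where M: "\<And>y. y \<in> D \<Longrightarrow> norm y \<le> M" using b unfolding bounded_iff by blast
  have "norm v \<le> real CARD('n) * (2 * M)" if v: "v \<in> indicatrix D x" for v
  proof -
    obtain l f where lf: "0 < l" "l < 1" "f \<in> holomorphic_discs D" "f 0 = x" "v = l *\<^sub>R disc_deriv f 0"
      using v unfolding indicatrix_iff[OF D] by blast
    have "norm v \<le> norm (disc_deriv f 0)" using lf mult_right_mono[of l 1 "norm (disc_deriv f 0)"] by simp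
    also have "\<dots> \<le> (\<Sum>i\<in>UNIV. norm (disc_deriv f 0 $ i))" by (rule norm_vec_le_sum)
    also have "\<dots> \<le> (\<Sum>i\<in>(UNIV::'n set). 2 * M)"
    proof (rule sum_mono)
      fix i
      have hol: "(\<lambda>\<zeta>. f \<zeta> $ i) holomorphic_on ball 0 1" and im: "f ` ball 0 1 \<subseteq> D"
        using lf(3) by (auto simp: holomorphic_discs_def)
      \<comment> \<open>Cauchy's estimate is taken at radius 1/2, because nothing is known of
        \<open>f\<close> on the unit circle; this doubles the bound.\<close>
      have "norm ((deriv ^^ 1) (\<lambda>\<zeta>. f \<zeta> $ i) 0) \<le> fact 1 * M / (1/2) ^ 1"
      proof (rule Cauchy_inequality)
        show "(\<lambda>\<zeta>. f \<zeta> $ i) holomorphic_on ball 0 (1/2)" by (rule holomorphic_on_subset[OF hol]) auto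
        show "continuous_on (cball 0 (1/2)) (\<lambda>\<zeta>. f \<zeta> $ i)"
          by (rule continuous_on_subset[OF holomorphic_on_imp_continuous_on[OF hol]]) auto
        fix \<zeta> :: complex assume "norm (0 - \<zeta>) = 1/2"
        then have "f \<zeta> \<in> D" using im by auto
        then show "norm (f \<zeta> $ i) \<le> M" using M Finite_Cartesian_Product.norm_nth_le[of "f \<zeta>" i] by (meson order_trans)
      qed simp
      then show "norm (disc_deriv f 0 $ i) \<le> 2 * M" by (simp add: disc_deriv_def)
    qed
    finally show ?thesis by simp
  qed
  then show ?thesis unfolding bounded_iff by blast
qed

text \<open>Real factors between 0 and 1 make the set starlike about 0.\<close>

lemma connected_complete_circular:
  fixes D :: "(complex ^ 'n) set"
  assumes "complete_circular D" "0 \<in> D"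
  shows "connected D"
proof -
  have "closed_segment 0 z \<subseteq> D" if "z \<in> D" for z
  proof
    fix w assume "w \<in> closed_segment 0 z"
    then obtain u where u: "0 \<le> u" "u \<le> 1" "w = u *\<^sub>R z" by (auto simp: closed_segment_def)
    then show "w \<in> D" using assms(1) that unfolding complete_circular_def scaleR_eq_cscale by force
  qed
  then have "starlike D" unfolding starlike_def using assms(2) by blast
  then show ?thesis by (rule starlike_imp_connected)
qed

text \<open>A factor above 1 could be iterated and would carry a nonzero point of \<open>J\<close>
  beyond every bound. This is why pinching ratios never exceed 1.\<close>

lemma scale_subset_imp_le_1:
  fixes J :: "(complex ^ 'n) set"
  assumes J: "open J" "0 \<in> J" "bounded J" and t: "(\<lambda>v. t *\<^sub>R v) ` J \<subseteq> J"
  shows "t \<le> 1"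
proof (rule ccontr)
  assume "\<not> t \<le> 1"
  then have t1: "t > 1" by simp
  obtain e where e: "e > 0" "ball 0 e \<subseteq> J" using J open_contains_ball by blast
  obtain v :: "complex ^ 'n" where v: "norm v = e / 2" using vector_choose_size[of "e/2"] e by auto
  have "v \<in> J" using e v by auto
  then have tv: "t ^ k *\<^sub>R v \<in> J" for k
  proof (induction k)
    case (Suc k)
    then have "t *\<^sub>R (t ^ k *\<^sub>R v) \<in> J" using t by blast
    then show ?case by simp
  qed simp
  obtain B where "\<And>y. y \<in> J \<Longrightarrow> norm y \<le> B" using J(3) unfolding bounded_iff by blast
  then have B: "norm (t ^ k *\<^sub>R v) \<le> B" for k using tv by blast
  obtain k where "B / (e / 2) < t ^ k" using real_arch_pow[OF t1] by blast
  then have "B < t ^ k * (e / 2)" using e(1) by (simp add: pos_divide_less_eq)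
  also have "\<dots> = norm (t ^ k *\<^sub>R v)" using v t1 by simp
  finally have "B < norm (t ^ k *\<^sub>R v)" .
  then show False using B[of k] by simp
qed

lemma translation_bounded_embedding:
  assumes "bounded \<Omega>"
  shows "(\<lambda>z. z - x) \<in> bounded_embeddings \<Omega> x"
proof -
  have "((\<lambda>z. z - x) has_derivative (\<lambda>v. v)) (at z)" for z by (auto intro!: derivative_eq_intros)
  then have "holomorphic_map_on (\<lambda>z. z - x) \<Omega>" unfolding holomorphic_map_on_def by blast
  moreover have "bounded ((\<lambda>z. z - x) ` \<Omega>)" using bounded_translation_minus[OF assms] by simp
  ultimately show ?thesis by (auto simp: bounded_embeddings_def inj_on_def)
qed

text \<open>A bounded set can be shrunk into any neighbourhood of 0; this is used from the
  indicatrix into \<open>V\<close> and from \<open>V\<close> into the indicatrix. It makes the set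
  of pinching ratios nonempty, so that its real supremum can be approached by elements.\<close>

lemma circularity_pinching_exists:
  fixes V :: "(complex ^ 'n) set"
  assumes V: "open V" "0 \<in> V" "bounded V"
  shows "\<exists>r>0. \<exists>R>0. (\<lambda>v. r *\<^sub>R v) ` indicatrix V 0 \<subseteq> V \<and> V \<subseteq> (\<lambda>v. R *\<^sub>R v) ` indicatrix V 0"
proof -
  have *: "\<exists>s>0. (\<lambda>v. s *\<^sub>R v) ` A \<subseteq> B" if "bounded A" "open B" "0 \<in> B" for A B :: "(complex ^ 'n) set"
  proof -
    obtain M where M: "M > 0" "\<And>y. y \<in> A \<Longrightarrow> norm y \<le> M" using \<open>bounded A\<close> unfolding bounded_pos by blast
    obtain e where e: "e > 0" "ball 0 e \<subseteq> B"
      using \<open>open B\<close> \<open>0 \<in> B\<close> unfolding open_contains_ball by blast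
    have "(e / (2 * M)) *\<^sub>R y \<in> B" if "y \<in> A" for y
    proof -
      have "norm ((e / (2 * M)) *\<^sub>R y) = e / (2 * M) * norm y" using M(1) e(1) by simp
      also have "\<dots> \<le> e / (2 * M) * M" using M(1) e(1) by (intro mult_left_mono M(2)[OF that]) auto
      also have "\<dots> < e" using M(1) e(1) by simp
      finally show ?thesis using e by auto
    qed
    then show ?thesis using M e by (intro exI[of _ "e / (2 * M)"]) auto
  qed
  obtain r where r: "r > 0" "(\<lambda>v. r *\<^sub>R v) ` indicatrix V 0 \<subseteq> V"
    using *[OF bounded_indicatrix[OF V] V(1,2)] by blast
  obtain s where s: "s > 0" "(\<lambda>v. s *\<^sub>R v) ` V \<subseteq> indicatrix V 0"
    using *[OF V(3) open_indicatrix[OF V(1,2)] zero_in_indicatrix[OF V(1,2)]] by blast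
  have "V \<subseteq> (\<lambda>v. (1/s) *\<^sub>R v) ` indicatrix V 0"
  proof
    fix y assume "y \<in> V"
    then show "y \<in> (\<lambda>v. (1/s) *\<^sub>R v) ` indicatrix V 0"
      using s by (intro image_eqI[of _ _ "s *\<^sub>R y"]) auto
  qed
  then show ?thesis using r s by (intro exI[of _ r] conjI exI[of _ "1/s"]) auto
qed

section \<open>Normalized embeddings and their limits\<close>

text \<open>Real scaling is written as a matrix so that its holomorphy and its Jacobian come from
  the lemmas on matrices.\<close>

lemma matrix_scaleR_mult: "mat (of_real t) *v (v :: complex ^ 'n) = t *\<^sub>R v"
  unfolding scaleR_eq_cscale
  by (simp add: vec_eq_iff matrix_vector_mult_def mat_def if_distrib[of "\<lambda>x. x * _"] sum.delta cong: if_cong)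

lemma jacobian_inv_into_mult:
  fixes \<phi> :: "complex ^ 'n \<Rightarrow> complex ^ 'n"
  assumes "open S" "holomorphic_map_on \<phi> S" "inj_on \<phi> S" "z \<in> S"
  shows "jacobian (inv_into S \<phi>) (\<phi> z) ** jacobian \<phi> z = mat 1"
proof -
  note os = osgood[OF assms(1-3)]
  have "holomorphic_map_on (\<lambda>z. inv_into S \<phi> (\<phi> z)) S"
    by (rule holomorphic_map_on_compose(1)[OF assms(2) os(2)]) simp
  then have "jacobian (\<lambda>z. inv_into S \<phi> (\<phi> z)) z = jacobian ((*v) (mat 1)) z"
    by (rule jacobian_cong[OF assms(1,4), rotated]) (simp add: assms(3))
  then show ?thesis
    by (simp only: holomorphic_map_on_matrix(2) holomorphic_map_on_compose(2)[OF assms(2) os(2) order_refl assms(4)])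
qed

text \<open>Since \<open>jacobian \<phi> x\<close> carries the indicatrix of \<open>\<Omega>\<close> onto that of \<open>\<phi> ` \<Omega>\<close>, composing \<open>\<phi>\<close> with
  its inverse compares the image with one fixed set.\<close>
lemma normalized_embedding:
  fixes \<Omega> :: "(complex ^ 'n) set"
  assumes \<Omega>: "open \<Omega>" "x \<in> \<Omega>" and \<phi>: "\<phi> \<in> bounded_embeddings \<Omega> x" and rR: "r > 0" "R > 0"
    and lo: "(\<lambda>v. r *\<^sub>R v) ` indicatrix (\<phi> ` \<Omega>) 0 \<subseteq> \<phi> ` \<Omega>"
    and hi: "\<phi> ` \<Omega> \<subseteq> (\<lambda>v. R *\<^sub>R v) ` indicatrix (\<phi> ` \<Omega>) 0"
  obtains \<psi> where "holomorphic_map_on \<psi> \<Omega>" "inj_on \<psi> \<Omega>" "\<psi> x = 0"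
    "(\<lambda>v. (r / R) *\<^sub>R v) ` indicatrix \<Omega> x \<subseteq> \<psi> ` \<Omega>" "\<psi> ` \<Omega> \<subseteq> indicatrix \<Omega> x"
proof -
  have h: "holomorphic_map_on \<phi> \<Omega>" "inj_on \<phi> \<Omega>" "\<phi> x = 0"
    using \<phi> by (auto simp: bounded_embeddings_def)
  define V where "V = \<phi> ` \<Omega>"
  define A where "A = jacobian \<phi> x"
  define G where "G = jacobian (inv_into \<Omega> \<phi>) 0"
  note os = osgood[OF \<Omega>(1) h(1,2), folded V_def]
  have GA: "G ** A = mat 1"
    using jacobian_inv_into_mult[OF \<Omega>(1) h(1,2) \<Omega>(2)] by (simp add: G_def A_def h(3))
  then have AG: "A ** G = mat 1" by (simp add: matrix_left_right_inverse)
  have V0: "0 \<in> V" using h(3) \<Omega>(2) by (force simp: V_def)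
  have inv0: "inv_into \<Omega> \<phi> 0 = x" using inv_into_f_f[OF h(2) \<Omega>(2)] h(3) by simp
  have AI: "A *v v \<in> indicatrix V 0" if "v \<in> indicatrix \<Omega> x" for v
    using indicatrix_image[OF \<Omega> os(1) h(1) _ that] by (simp add: V_def A_def h(3))
  have GI: "G *v v \<in> indicatrix \<Omega> x" if "v \<in> indicatrix V 0" for v
  proof -
    have "inv_into \<Omega> \<phi> ` V \<subseteq> \<Omega>" by (auto simp: V_def inv_into_into)
    then show ?thesis using indicatrix_image[OF os(1) V0 \<Omega>(1) os(2) _ that] by (simp add: G_def inv0)
  qed
  \<comment> \<open>\<open>G\<close> undoes the Jacobian \<open>A\<close> of \<phi>; dividing by
    \<open>R\<close> makes the outer inclusion one into the indicatrix itself and leaves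
    \<open>r / R\<close> for the inner one.\<close>
  define \<psi> where "\<psi> = (\<lambda>z. (mat (of_real (1 / R)) ** G) *v \<phi> z)"
  have \<psi>: "\<psi> z = (1 / R) *\<^sub>R (G *v \<phi> z)" for z
    unfolding \<psi>_def matrix_vector_mul_assoc[symmetric] matrix_scaleR_mult ..
  show thesis
  proof (rule that)
    show "holomorphic_map_on \<psi> \<Omega>" unfolding \<psi>_def
      by (rule holomorphic_map_on_compose(1)[OF h(1) holomorphic_map_on_matrix(1) subset_UNIV])
    show "inj_on \<psi> \<Omega>"
    proof (rule inj_onI)
      fix a b assume ab: "a \<in> \<Omega>" "b \<in> \<Omega>" "\<psi> a = \<psi> b"
      then have "G *v \<phi> a = G *v \<phi> b" using rR(2) by (simp add: \<psi>)
      then have "(A ** G) *v \<phi> a = (A ** G) *v \<phi> b" by (simp only: matrix_vector_mul_assoc[symmetric])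
      then have "\<phi> a = \<phi> b" by (simp add: AG)
      then show "a = b" using inj_onD[OF h(2)] ab by blast
    qed
    show "\<psi> x = 0" by (simp add: \<psi> h(3))
    show "(\<lambda>v. (r / R) *\<^sub>R v) ` indicatrix \<Omega> x \<subseteq> \<psi> ` \<Omega>"
    proof (rule image_subsetI)
      fix v assume "v \<in> indicatrix \<Omega> x"
      then have "r *\<^sub>R (A *v v) \<in> \<phi> ` \<Omega>" using AI lo by (auto simp: V_def)
      then obtain z where z: "z \<in> \<Omega>" "\<phi> z = r *\<^sub>R (A *v v)" by auto
      have "G *v (r *\<^sub>R (A *v v)) = r *\<^sub>R ((G ** A) *v v)"
        by (simp only: scaleR_eq_cscale matrix_vector_mult_cscale matrix_vector_mul_assoc)
      then have "\<psi> z = (r / R) *\<^sub>R v" unfolding \<psi> z(2) by (simp add: GA)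
      then show "(r / R) *\<^sub>R v \<in> \<psi> ` \<Omega>" using z(1) by (metis imageI)
    qed
    show "\<psi> ` \<Omega> \<subseteq> indicatrix \<Omega> x"
    proof (rule image_subsetI)
      fix z assume "z \<in> \<Omega>"
      then obtain w where w: "w \<in> indicatrix V 0" "\<phi> z = R *\<^sub>R w" using hi by (auto simp: V_def)
      have "\<psi> z = G *v w" unfolding \<psi> w(2)
        using rR(2) by (simp add: scaleR_eq_cscale matrix_vector_mult_cscale)
      then show "\<psi> z \<in> indicatrix \<Omega> x" using GI[OF w(1)] by simp
    qed
  qed
qed

lemma normalized_embeddings_exist:
  fixes \<Omega> :: "(complex ^ 'n) set"
  assumes \<Omega>: "open \<Omega>" "bounded \<Omega>" "x \<in> \<Omega>" and c: "maximal_circularity \<Omega> x = 1" and e: "e < 1"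
  shows "\<exists>t \<psi>. e < t \<and> 0 < t \<and> t \<le> 1 \<and> holomorphic_map_on \<psi> \<Omega> \<and> inj_on \<psi> \<Omega> \<and> \<psi> x = 0 \<and>
    (\<lambda>v. t *\<^sub>R v) ` indicatrix \<Omega> x \<subseteq> \<psi> ` \<Omega> \<and> \<psi> ` \<Omega> \<subseteq> indicatrix \<Omega> x"
proof -
  let ?P = "\<lambda>r R. R > 0 \<and> r > 0 \<and> (\<exists>\<phi>\<in>bounded_embeddings \<Omega> x.
               (\<lambda>v. r *\<^sub>R v) ` indicatrix (\<phi> ` \<Omega>) 0 \<subseteq> \<phi> ` \<Omega> \<and>
               \<phi> ` \<Omega> \<subseteq> (\<lambda>v. R *\<^sub>R v) ` indicatrix (\<phi> ` \<Omega>) 0)"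
  let ?X = "{r / R | r R. ?P r R}"
  have V: "open (\<phi> ` \<Omega>)" "0 \<in> \<phi> ` \<Omega>" "bounded (\<phi> ` \<Omega>)" if "\<phi> \<in> bounded_embeddings \<Omega> x" for \<phi>
    using that osgood(1)[OF \<Omega>(1)] \<Omega>(3) by (force simp: bounded_embeddings_def)+
  have le1: "q \<le> 1" if "q \<in> ?X" for q
  proof -
    obtain r R \<phi> where rR: "q = r / R" "R > 0" "r > 0" and \<phi>: "\<phi> \<in> bounded_embeddings \<Omega> x"
      "(\<lambda>v. r *\<^sub>R v) ` indicatrix (\<phi> ` \<Omega>) 0 \<subseteq> \<phi> ` \<Omega>" "\<phi> ` \<Omega> \<subseteq> (\<lambda>v. R *\<^sub>R v) ` indicatrix (\<phi> ` \<Omega>) 0"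
      using \<open>q \<in> ?X\<close> by blast
    let ?J = "indicatrix (\<phi> ` \<Omega>) 0"
    \<comment> \<open>With V the image of \<phi>, r J inside V and V inside R J give (r / R) J
      inside J.\<close>
    have "(\<lambda>v. q *\<^sub>R v) ` ?J \<subseteq> ?J"
    proof (rule image_subsetI)
      fix v assume "v \<in> ?J"
      then have "r *\<^sub>R v \<in> (\<lambda>v. R *\<^sub>R v) ` ?J" using \<phi>(2,3) by blast
      then obtain w where w: "w \<in> ?J" "r *\<^sub>R v = R *\<^sub>R w" by blast
      have "(r / R) *\<^sub>R v = (1 / R) *\<^sub>R (r *\<^sub>R v)" by simp
      also have "\<dots> = w" unfolding w(2) using rR(2) by simp
      finally show "q *\<^sub>R v \<in> ?J" using w(1) rR(1) by simp
    qed
    then show ?thesis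
      by (rule scale_subset_imp_le_1[rotated -1])
         (use V[OF \<phi>(1)] in \<open>auto intro: open_indicatrix zero_in_indicatrix bounded_indicatrix\<close>)
  qed
  have "?X \<noteq> {}"
  proof -
    have tr: "(\<lambda>z. z - x) \<in> bounded_embeddings \<Omega> x" by (rule translation_bounded_embedding[OF \<Omega>(2)])
    show ?thesis using circularity_pinching_exists[OF V[OF tr]] tr by blast
  qed
  moreover have "bdd_above ?X" using le1 by (rule bdd_aboveI)
  ultimately have "\<exists>q\<in>?X. max e 0 < q"
    using less_cSup_iff[of ?X "max e 0"] c e unfolding maximal_circularity_def by simp
  then obtain q where q: "q \<in> ?X" "max e 0 < q" by blast
  then obtain r R \<phi> where rR: "q = r / R" "R > 0" "r > 0" and \<phi>: "\<phi> \<in> bounded_embeddings \<Omega> x"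
      "(\<lambda>v. r *\<^sub>R v) ` indicatrix (\<phi> ` \<Omega>) 0 \<subseteq> \<phi> ` \<Omega>" "\<phi> ` \<Omega> \<subseteq> (\<lambda>v. R *\<^sub>R v) ` indicatrix (\<phi> ` \<Omega>) 0"
    by blast
  obtain \<psi> where "holomorphic_map_on \<psi> \<Omega>" "inj_on \<psi> \<Omega>" "\<psi> x = 0"
    "(\<lambda>v. (r / R) *\<^sub>R v) ` indicatrix \<Omega> x \<subseteq> \<psi> ` \<Omega>" "\<psi> ` \<Omega> \<subseteq> indicatrix \<Omega> x"
    using normalized_embedding[OF \<Omega>(1,3) \<phi>(1) rR(3,2) \<phi>(2,3)] .
  then show ?thesis using q(2) le1[OF q(1)] rR(1) by (intro exI[of _ q] exI[of _ \<psi>]) auto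
qed

text \<open>The error between \<open>F k (a k)\<close> and \<open>f (a k)\<close> is uniform on a
  ball about \<open>y\<close>, and continuity takes care of \<open>f (a k)\<close>. This passes to
  the limit in compositions whose inner map also varies.\<close>

lemma locally_uniform_limit_diagonal:
  assumes lim: "locally_uniform_limit S F f" and y: "y \<in> S" and a: "a \<longlonglongrightarrow> y" and f: "isCont f y"
  shows "(\<lambda>k. F k (a k)) \<longlonglongrightarrow> f y"
proof -
  obtain r where r: "r > 0" "cball y r \<subseteq> S" "uniform_limit (cball y r) F f sequentially"
    using locally_uniform_limitE[OF lim y] .
  have fa: "(\<lambda>k. f (a k)) \<longlonglongrightarrow> f y" by (rule isCont_tendsto_compose[OF f a])
  have Fa: "(\<lambda>k. dist (F k (a k)) (f (a k))) \<longlonglongrightarrow> 0"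
  proof (rule tendstoI)
    fix e :: real assume e: "e > 0"
    have "\<forall>\<^sub>F k in sequentially. dist (a k) y < r" by (rule tendstoD[OF a r(1)])
    moreover have "\<forall>\<^sub>F k in sequentially. \<forall>z\<in>cball y r. dist (F k z) (f z) < e" by (rule uniform_limitD[OF r(3) e])
    ultimately show "\<forall>\<^sub>F k in sequentially. dist (dist (F k (a k)) (f (a k))) 0 < e"
      by eventually_elim (auto simp: dist_commute intro: less_imp_le)
  qed
  have "(\<lambda>k. dist (F k (a k)) (f y)) \<longlonglongrightarrow> 0"
  proof (rule Lim_null_comparison)
    show "\<forall>\<^sub>F k in sequentially. norm (dist (F k (a k)) (f y)) \<le> dist (F k (a k)) (f (a k)) + dist (f (a k)) (f y)"
      by (simp add: dist_triangle)
    have "(\<lambda>k. dist (F k (a k)) (f (a k)) + dist (f (a k)) (f y)) \<longlonglongrightarrow> 0 + 0"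
      using fa by (intro tendsto_add Fa) (simp add: tendsto_dist_iff[symmetric])
    then show "(\<lambda>k. dist (F k (a k)) (f (a k)) + dist (f (a k)) (f y)) \<longlonglongrightarrow> 0" by simp
  qed
  then show ?thesis by (simp add: tendsto_dist_iff[symmetric])
qed

lemma biholomorphic_indicatrix:
  fixes \<Omega> :: "(complex ^ 'n) set"
  assumes \<Omega>: "open \<Omega>" "connected \<Omega>" "bounded \<Omega>" "x \<in> \<Omega>" and c: "maximal_circularity \<Omega> x = 1"
  shows "biholomorphic \<Omega> (indicatrix \<Omega> x)"
proof -
  define I where "I = indicatrix \<Omega> x"
  have I: "open I" "0 \<in> I" "bounded I" "complete_circular I"
    unfolding I_def by (fact open_indicatrix[OF \<Omega>(1,4)] zero_in_indicatrix[OF \<Omega>(1,4)]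
      bounded_indicatrix[OF \<Omega>(1,4,3)] complete_circular_indicatrix[OF \<Omega>(1,4)])+
  then have Ic: "connected I" using connected_complete_circular by blast
  have "\<exists>t \<psi>. 1 - 1 / Suc k < t \<and> 0 < t \<and> t \<le> 1 \<and> holomorphic_map_on \<psi> \<Omega> \<and> inj_on \<psi> \<Omega> \<and> \<psi> x = 0 \<and>
    (\<lambda>v. t *\<^sub>R v) ` I \<subseteq> \<psi> ` \<Omega> \<and> \<psi> ` \<Omega> \<subseteq> I" for k
    unfolding I_def by (rule normalized_embeddings_exist[OF \<Omega>(1,3,4) c]) simp
  then obtain t \<psi> where *: "\<And>k. 1 - 1 / Suc k < t k \<and> 0 < t k \<and> t k \<le> 1 \<and> holomorphic_map_on (\<psi> k) \<Omega> \<and>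
      inj_on (\<psi> k) \<Omega> \<and> \<psi> k x = 0 \<and> (\<lambda>v. t k *\<^sub>R v) ` I \<subseteq> \<psi> k ` \<Omega> \<and> \<psi> k ` \<Omega> \<subseteq> I"
    by metis
  then have t: "\<And>k. 1 - 1 / Suc k < t k" "\<And>k. 0 < t k" "\<And>k. t k \<le> 1"
    and \<psi>: "\<And>k. holomorphic_map_on (\<psi> k) \<Omega>" "\<And>k. inj_on (\<psi> k) \<Omega>" "\<And>k. \<psi> k x = 0"
    and lo: "\<And>k. (\<lambda>v. t k *\<^sub>R v) ` I \<subseteq> \<psi> k ` \<Omega>" and hi: "\<And>k. \<psi> k ` \<Omega> \<subseteq> I"
    by auto
  note os = osgood[OF \<Omega>(1) \<psi>(1,2)]
  have t1: "t \<longlonglongrightarrow> 1"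
  proof (rule tendsto_sandwich)
    have "(\<lambda>k. 1 - 1 / real (Suc k)) \<longlonglongrightarrow> 1 - 0" by (intro tendsto_intros lim_1_over_n[THEN LIMSEQ_Suc])
    then show "(\<lambda>k. 1 - 1 / real (Suc k)) \<longlonglongrightarrow> 1" by simp
    show "\<forall>\<^sub>F k in sequentially. 1 - 1 / real (Suc k) \<le> t k"
      by (intro always_eventually allI less_imp_le t(1))
    show "\<forall>\<^sub>F k in sequentially. t k \<le> 1" by (intro always_eventually allI t(3))
  qed simp
  \<comment> \<open>The factor \<open>t k\<close> gives all inverses the common domain
    \<open>I\<close>, as a normal family needs.\<close>
  define g where "g = (\<lambda>k w. inv_into \<Omega> (\<psi> k) (mat (of_real (t k)) *v w))"
  have scale: "(*v) (mat (of_real (t k))) ` I \<subseteq> \<psi> k ` \<Omega>" for k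
    using lo[of k] by (simp add: matrix_scaleR_mult)
  have g: "holomorphic_map_on (g k) I" for k
    unfolding g_def by (rule holomorphic_map_on_compose(1)[OF holomorphic_map_on_matrix(1) os(2) scale])
  have g\<Omega>: "g k ` I \<subseteq> \<Omega>" for k using scale[of k] unfolding g_def by (blast intro: inv_into_into)
  have \<psi>g: "\<psi> k (g k w) = t k *\<^sub>R w" if "w \<in> I" for k w
  proof -
    have "mat (of_real (t k)) *v w \<in> \<psi> k ` \<Omega>" using scale that by blast
    then show ?thesis unfolding g_def by (simp add: f_inv_into_f matrix_scaleR_mult)
  qed
  have ginj: "inj_on (g k) I" for k
  proof (rule inj_onI)
    fix a b assume ab: "a \<in> I" "b \<in> I" "g k a = g k b"
    then have "t k *\<^sub>R a = t k *\<^sub>R b" using \<psi>g by metis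
    then show "a = b" using t(2)[of k] by simp
  qed
  have g0: "g k 0 = x" for k using inv_into_f_f[OF \<psi>(2) \<Omega>(4), of k] \<psi>(3)[of k] by (simp add: g_def)
  \<comment> \<open>Chain rule at 0 for \<open>\<psi> k (g k w) = t k *\<^sub>R w\<close>;
    \<open>g0\<close> fixes the base point of the outer Jacobian at \<open>x\<close> for every
    \<open>k\<close>.\<close>
  have jac: "jacobian (\<psi> k) x ** jacobian (g k) 0 = mat (of_real (t k))" for k
  proof -
    have "jacobian (\<lambda>w. \<psi> k (g k w)) 0 = jacobian ((*v) (mat (of_real (t k)))) 0"
      by (rule jacobian_cong[OF I(1,2) _ holomorphic_map_on_compose(1)[OF g \<psi>(1) g\<Omega>]])
         (simp add: \<psi>g matrix_scaleR_mult)
    then show ?thesis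
      by (simp only: holomorphic_map_on_matrix(2) holomorphic_map_on_compose(2)[OF g \<psi>(1) g\<Omega> I(2)] g0)
  qed
  obtain B where B: "\<And>y. y \<in> I \<Longrightarrow> norm y \<le> B" using I(3) unfolding bounded_iff by blast
  obtain C where C: "\<And>y. y \<in> \<Omega> \<Longrightarrow> norm y \<le> C" using \<Omega>(3) unfolding bounded_iff by blast
  obtain \<sigma> f where \<sigma>: "strict_mono \<sigma>" "locally_uniform_limit \<Omega> (\<lambda>k. \<psi> (\<sigma> k)) f"
  proof (rule montel_maps[OF \<Omega>(1) \<psi>(1)])
    show "norm (\<psi> k y) \<le> B" if "y \<in> \<Omega>" for k y using hi[of k] B that by blast
  qed
  \<comment> \<open>The second subsequence is taken along the first, so that both families converge
    along the same indices.\<close>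
  obtain \<tau> h where \<tau>: "strict_mono \<tau>" "locally_uniform_limit I (\<lambda>k. g (\<sigma> (\<tau> k))) h"
  proof (rule montel_maps[OF I(1), of "\<lambda>k. g (\<sigma> k)"])
    show "norm (g (\<sigma> k) y) \<le> C" if "y \<in> I" for k y using g\<Omega>[of "\<sigma> k"] C that by blast
  qed (rule g)
  define \<rho> where "\<rho> = (\<lambda>k. \<sigma> (\<tau> k))"
  have limf: "locally_uniform_limit \<Omega> (\<lambda>k. \<psi> (\<rho> k)) f"
    unfolding \<rho>_def by (rule locally_uniform_limit_subseq[OF \<sigma>(2) \<tau>(1)])
  have limh: "locally_uniform_limit I (\<lambda>k. g (\<rho> k)) h" using \<tau>(2) by (simp add: \<rho>_def)
  have t1': "(\<lambda>k. t (\<rho> k)) \<longlonglongrightarrow> 1"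
    using LIMSEQ_subseq_LIMSEQ[OF LIMSEQ_subseq_LIMSEQ[OF t1 \<sigma>(1)] \<tau>(1)] by (simp add: \<rho>_def o_def)
  note f = holomorphic_map_on_limit(1)[OF \<psi>(1) \<Omega>(1) limf]
  note h = holomorphic_map_on_limit(1)[OF g I(1) limh]
  have "(\<lambda>k. det (jacobian (\<psi> (\<rho> k)) x) * det (jacobian (g (\<rho> k)) 0)) \<longlonglongrightarrow> det (jacobian f x) * det (jacobian h 0)"
    by (intro tendsto_mult locally_uniform_limit_pointwise[OF locally_uniform_limit_det_jacobian[OF \<psi>(1) \<Omega>(1) limf] \<Omega>(4)]
        locally_uniform_limit_pointwise[OF locally_uniform_limit_det_jacobian[OF g I(1) limh] I(2)])
  moreover have "det (jacobian (\<psi> (\<rho> k)) x) * det (jacobian (g (\<rho> k)) 0) = det (mat (of_real (t (\<rho> k))) :: complex ^ 'n ^ 'n)" for k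
    unfolding jac[symmetric] det_mul ..
  moreover have "(\<lambda>k. det (mat (of_real (t (\<rho> k))) :: complex ^ 'n ^ 'n)) \<longlonglongrightarrow> det (mat (of_real 1) :: complex ^ 'n ^ 'n)"
  proof (rule isCont_tendsto_compose[where g=det])
    show "isCont det (mat (of_real 1) :: complex ^ 'n ^ 'n)"
      using continuous_on_det_complex[of "UNIV :: (complex ^ 'n ^ 'n) set"] by (simp add: continuous_on_eq_continuous_at)
    show "(\<lambda>k. mat (of_real (t (\<rho> k))) :: complex ^ 'n ^ 'n) \<longlonglongrightarrow> mat (of_real 1)"
      unfolding mat_def using tendsto_of_real[OF t1', where ?'a=complex]
      by (intro tendsto_vec_lambda) auto
  qed
  ultimately have "det (jacobian f x) * det (jacobian h 0) = 1"
    using LIMSEQ_unique by (fastforce simp: det_I)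
  then have nz: "det (jacobian f x) \<noteq> 0" "det (jacobian h 0) \<noteq> 0" by auto
  have finj: "inj_on f \<Omega>" and fI: "f ` \<Omega> \<subseteq> I"
    using hurwitz_injective[OF \<Omega>(1,2) \<psi>(1,2) os(3) limf \<Omega>(4) nz(1)] hi by blast+
  \<comment> \<open>The nonvanishing Jacobians of the maps \<open>g k\<close> come from Osgood's
    theorem, now applied on \<open>I\<close>.\<close>
  have h\<Omega>: "h ` I \<subseteq> \<Omega>"
    using hurwitz_injective(2)[OF I(1) Ic g ginj osgood(3)[OF I(1) g ginj] limh I(2) nz(2)] g\<Omega> by blast
  have fh: "f (h w) = w" if w: "w \<in> I" for w
  proof (rule LIMSEQ_unique)
    have hw: "h w \<in> \<Omega>" using h\<Omega> w by blast
    show "(\<lambda>k. \<psi> (\<rho> k) (g (\<rho> k) w)) \<longlonglongrightarrow> f (h w)"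
    proof (rule locally_uniform_limit_diagonal[OF limf hw locally_uniform_limit_pointwise[OF limh w]])
      show "isCont f (h w)"
        using holomorphic_map_on_continuous[OF f] \<Omega>(1) hw by (simp add: continuous_on_eq_continuous_at)
    qed
    have "(\<lambda>k. t (\<rho> k) *\<^sub>R w) \<longlonglongrightarrow> 1 *\<^sub>R w" by (intro tendsto_intros t1')
    then show "(\<lambda>k. \<psi> (\<rho> k) (g (\<rho> k) w)) \<longlonglongrightarrow> w" by (simp add: \<psi>g w)
  qed
  have hf: "h (f z) = z" if z: "z \<in> \<Omega>" for z
  proof (rule inj_onD[OF finj])
    show "f (h (f z)) = f z" using fh fI z by blast
    show "h (f z) \<in> \<Omega>" using h\<Omega> fI z by blast
  qed (rule z)
  have "f ` \<Omega> = I" using fI fh h\<Omega> by (metis image_subset_iff subsetI subset_antisym image_eqI)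
  moreover have "h ` I = \<Omega>" using h\<Omega> hf fI by (metis image_subset_iff subsetI subset_antisym image_eqI)
  ultimately show ?thesis
    unfolding biholomorphic_def I_def[symmetric] using f h hf fh by blast
qed

theorem proposition3p1:
  fixes \<Omega> :: "(complex ^ 'n) set" and x :: "complex ^ 'n"
  assumes "domain_Cn \<Omega>" and "bounded \<Omega>"
    and "x \<in> \<Omega>" and "maximal_circularity \<Omega> x = 1"
  shows "\<exists>D :: (complex ^ 'n) set. domain_Cn D \<and> complete_circular D \<and> biholomorphic \<Omega> D"
proof (intro exI conjI)
  have \<Omega>: "open \<Omega>" "connected \<Omega>" using assms(1) by (auto simp: domain_Cn_def)
  note I = open_indicatrix[OF \<Omega>(1) assms(3)] zero_in_indicatrix[OF \<Omega>(1) assms(3)]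
  show cc: "complete_circular (indicatrix \<Omega> x)" by (rule complete_circular_indicatrix[OF \<Omega>(1) assms(3)])
  show "domain_Cn (indicatrix \<Omega> x)"
    unfolding domain_Cn_def using I connected_complete_circular[OF cc I(2)] by blast
  show "biholomorphic \<Omega> (indicatrix \<Omega> x)"
    by (rule biholomorphic_indicatrix[OF \<Omega> assms(2-4)])
qed

end
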